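(* Fix a reaction term $G$ of ignition type and a conductivity exponent $m>3$. For any $\eta>0$ there exists $k_0>0$ such that, setting $$\mathcal{U}:=\Big\{(\varepsilon,k):\ 0<\varepsilon<\theta,\quad k>k_0,\quad k<\frac{\varepsilon^{\eta}}{\varepsilon^{\frac{1}{m-2}}}\Big\},$$ for any $(\varepsilon,k)\in\mathcal{U}$ there exists a principal eigenvalue $s=s(\varepsilon,k)>0$ such that the problem $$-p_\varepsilon u''+\Big(c_\varepsilon-\frac{2p_\varepsilon'}{m-2}\Big)u'+\Big(k^2p_\varepsilon^{\frac{m}{m-2}}-p_\varepsilon''-G'(p_\varepsilon)\Big)u=s\,u\quad\text{on }\mathbb{R},\qquad u(\pm\infty)=0,$$ has a positive solution $u(x)$ with maximal decay when $x\to-\infty$. Moreover $s(\varepsilon,k)$ is the smallest eigenvalue, there exists no other principal eigenvalue, and the associated eigenspace is one-dimensional. Finally, there exists a constant $\gamma_0=\gamma_0(m,G)>0$ such that $$s(\varepsilon,k)\sim\gamma_0\,k^{1-\frac{1}{m-1}}\qquad\text{when }(\varepsilon,k)\to(0,+\infty)\text{ in }\mathcal{U}.$$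
   Context: Ignition type: $G$ is smooth on $[0,1]$ and there is a threshold $\theta\in(0,1)$ such that $G\equiv0$ on $[0,\theta]$, $G>0$ on $(\theta,1)$, $G(1)=0$ and $G'(1)<0$. Travelling wave: for $\varepsilon\in(0,\theta)$ there is a unique speed $c_\varepsilon>0$ such that $$-pp''+\Big(c_\varepsilon-\frac{p'}{m-2}\Big)p'=G(p)\ \text{ on }\mathbb{R},\qquad p(-\infty)=\varepsilon,\quad p(+\infty)=1,$$ has a solution; the solution is unique up to translation in $x$ (the translation is irrelevant here; it may be fixed for instance by $p(0)=\theta$) and is denoted $p_\varepsilon$. Maximal decay: the equation for $u$ has at $x=-\infty$ the characteristic exponents $$r^{\pm}=\frac{c_\varepsilon\pm\sqrt{c_\varepsilon^2+4\varepsilon\big(k^2\varepsilon^{\frac{m}{m-2}}-s\big)}}{2\varepsilon},$$ and $u$ is said to have maximal decay at $-\infty$ if $u(x)=\mathcal{O}(e^{r^+x})$ as $x\to-\infty$ (with $r^+$ replaced by its real part if the radicand is negative). Eigenvalues: $s\in\mathbb{R}$ is an eigenvalue if the problem has a non-trivial solution $u$ with $u(\pm\infty)=0$ and maximal decay at $-\infty$ (an eigenfunction); the eigenspace is the set of all such solutions together with $0$. An eigenvalue is principal if it admits a positive eigenfunction. The notation $s\sim\gamma_0k^{1-\frac1{m-1}}$ means that the ratio tends to $1$. *)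

theory Defs
  imports "HOL-Analysis.Analysis" "HOL-Library.Landau_Symbols"
begin

text \<open>
  The reaction term is a function on \<open>[0,1]\<close>; its values outside are irrelevant. Its derivatives
  are therefore taken within \<open>[0,1]\<close>, which makes them one-sided at the endpoints.
\<close>

definition deriv01 :: "(real \<Rightarrow> real) \<Rightarrow> real \<Rightarrow> real" where
  "deriv01 f x = vector_derivative f (at x within {0..1})"

definition smooth01 :: "(real \<Rightarrow> real) \<Rightarrow> bool" where
  "smooth01 f \<longleftrightarrow> (\<forall>n. (deriv01 ^^ n) f differentiable_on {0..1})"

definition ignition :: "(real \<Rightarrow> real) \<Rightarrow> real \<Rightarrow> bool" where
  "ignition G \<theta> \<longleftrightarrow>
     smooth01 G \<and> 0 < \<theta> \<and> \<theta> < 1 \<and>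
     (\<forall>y\<in>{0..\<theta>}. G y = 0) \<and> (\<forall>y\<in>{\<theta><..<1}. G y > 0) \<and> G 1 = 0 \<and> deriv01 G 1 < 0"

definition C2 :: "(real \<Rightarrow> real) \<Rightarrow> bool" where
  "C2 f \<longleftrightarrow>
     f differentiable_on UNIV \<and> deriv f differentiable_on UNIV \<and>
     continuous_on UNIV (deriv (deriv f))"

text \<open>
  A travelling wave takes its values in \<open>[0,1]\<close>, where \<open>G\<close> is defined. It is not normalised
  with respect to translations.
\<close>

definition travelling_wave ::
  "real \<Rightarrow> (real \<Rightarrow> real) \<Rightarrow> real \<Rightarrow> real \<Rightarrow> (real \<Rightarrow> real) \<Rightarrow> bool" where
  "travelling_wave m G \<epsilon> c p \<longleftrightarrow>
     c > 0 \<and> C2 p \<and> range p \<subseteq> {0..1} \<and>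
     (\<forall>x. - p x * deriv (deriv p) x + (c - deriv p x / (m - 2)) * deriv p x = G (p x)) \<and>
     (p \<longlongrightarrow> \<epsilon>) at_bot \<and> (p \<longlongrightarrow> 1) at_top"

text \<open>
  The square root is complex, so that the exponent is also meaningful for a negative radicand;
  maximal decay refers to its real part.
\<close>

definition exponent_plus :: "real \<Rightarrow> real \<Rightarrow> real \<Rightarrow> real \<Rightarrow> real \<Rightarrow> complex" where
  "exponent_plus m \<epsilon> k c s =
     (of_real c + csqrt (of_real (c\<^sup>2 + 4 * \<epsilon> * (k\<^sup>2 * \<epsilon> powr (m / (m - 2)) - s))))
       / of_real (2 * \<epsilon>)"

definition maximal_decay ::
  "real \<Rightarrow> real \<Rightarrow> real \<Rightarrow> real \<Rightarrow> real \<Rightarrow> (real \<Rightarrow> real) \<Rightarrow> bool" where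
  "maximal_decay m \<epsilon> k c s u \<longleftrightarrow>
     u \<in> O[at_bot](\<lambda>x. exp (Re (exponent_plus m \<epsilon> k c s) * x))"

definition eigenspace ::
  "real \<Rightarrow> (real \<Rightarrow> real) \<Rightarrow> real \<Rightarrow> real \<Rightarrow> real \<Rightarrow> (real \<Rightarrow> real) \<Rightarrow> real \<Rightarrow> (real \<Rightarrow> real) set" where
  "eigenspace m G \<epsilon> k c p s =
     {u. C2 u \<and>
         (\<forall>x. - p x * deriv (deriv u) x + (c - 2 * deriv p x / (m - 2)) * deriv u x
                + (k\<^sup>2 * p x powr (m / (m - 2)) - deriv (deriv p) x - deriv01 G (p x)) * u x
              = s * u x) \<and>
         (u \<longlongrightarrow> 0) at_bot \<and> (u \<longlongrightarrow> 0) at_top \<and> maximal_decay m \<epsilon> k c s u}"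

definition eigenvalue ::
  "real \<Rightarrow> (real \<Rightarrow> real) \<Rightarrow> real \<Rightarrow> real \<Rightarrow> real \<Rightarrow> (real \<Rightarrow> real) \<Rightarrow> real \<Rightarrow> bool" where
  "eigenvalue m G \<epsilon> k c p s \<longleftrightarrow> (\<exists>u\<in>eigenspace m G \<epsilon> k c p s. u \<noteq> (\<lambda>_. 0))"

definition principal_eigenvalue ::
  "real \<Rightarrow> (real \<Rightarrow> real) \<Rightarrow> real \<Rightarrow> real \<Rightarrow> real \<Rightarrow> (real \<Rightarrow> real) \<Rightarrow> real \<Rightarrow> bool" where
  "principal_eigenvalue m G \<epsilon> k c p s \<longleftrightarrow> (\<exists>u\<in>eigenspace m G \<epsilon> k c p s. \<forall>x. u x > 0)"

text \<open>A set of functions that is a line through the zero function.\<close>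

definition one_dimensional :: "(real \<Rightarrow> real) set \<Rightarrow> bool" where
  "one_dimensional E \<longleftrightarrow> (\<exists>u. u \<noteq> (\<lambda>_. 0) \<and> E = range (\<lambda>a x. a * u x))"

definition region :: "real \<Rightarrow> real \<Rightarrow> real \<Rightarrow> real \<Rightarrow> (real \<times> real) set" where
  "region m \<theta> \<eta> k\<^sub>0 =
     {(\<epsilon>, k). 0 < \<epsilon> \<and> \<epsilon> < \<theta> \<and> k > k\<^sub>0 \<and> k < \<epsilon> powr \<eta> / \<epsilon> powr (1 / (m - 2))}"

end

theory Submission imports Defs
begin

text \<open>
  Since \<open>p'\<close> solves the equation for \<open>k = s = 0\<close>, a solution has the form \<open>u = p' v\<close>, where \<open>v\<close> solves a
  second order equation whose potential term \<open>k\<^sup>2 p\<^bsup>m/(m-2)\<^esup> - s\<close> changes sign once. The solution with maximal decay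
  at \<open>-\<infinity>\<close> depends continuously on \<open>s\<close>. For small \<open>s\<close> the quotient \<open>v\<close> has a positive derivative where the potential
  is positive, so \<open>u\<close> stays positive and \<open>v\<close> grows; for large \<open>s\<close> it vanishes somewhere. Both conditions are open and
  exclude each other, so some \<open>s\<close> in between satisfies neither; then \<open>v\<close> is positive and nonincreasing, and \<open>u\<close> is a
  positive eigenfunction. Minimality, uniqueness and simplicity follow from the Wronskian.

  For the asymptotics let \<open>\<Lambda> = (c/k)\<^bsup>1/(m-1)\<^esup>\<close>. As long as \<open>p \<le> \<theta>\<close>, the wave satisfies
  \<open>(p\<^bsup>1/(m-2)\<^esup>)' = c (p\<^bsup>1/(m-2)\<^esup> - \<epsilon>\<^bsup>1/(m-2)\<^esup>) / p\<close>, and in the variable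
  \<open>t = (p\<^bsup>1/(m-2)\<^esup> - \<epsilon>\<^bsup>1/(m-2)\<^esup>) / \<Lambda>\<close> with \<open>s = \<sigma> k\<^sup>2 \<Lambda>\<^bsup>m\<^esup>\<close> the equation for \<open>v\<close> converges to
  \<open>(t\<^bsup>4-m\<^esup> v')' = (t\<^bsup>m\<^esup> - \<sigma>) v\<close>. Solutions of this limit problem just below and just above its critical
  parameter \<open>\<gamma>\<close> serve as barriers, which squeezes \<open>\<sigma>\<close> towards \<open>\<gamma>\<close>. The speed is increasing in \<open>\<epsilon>\<close> and bounded below,
  so it has a positive limit \<open>c\<^sub>0\<close>, and \<open>\<gamma>\<^sub>0 = \<gamma> c\<^sub>0\<^bsup>m/(m-1)\<^esup>\<close>.
\<close>

text \<open>The problem is singular at -\<infinity>: maximal decay selects one solution, whose sign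
  must be controlled on a whole half line while s varies. In the variable T = exp (c x / 4) the end
  -\<infinity> becomes the point 0 of a Volterra equation with continuous kernel. Its solution is
  jointly continuous in s and T, and positivity for all x \<le> X becomes positivity on a compact
  interval, an open condition on s. The limit problem is singular at t = 0 in the same way; there m
  > 3 makes t^(m-4) integrable. The scale \<Lambda> comes from a balance. While p \<le> \<theta>,
  the equation for v is exactly (t^2 (e1 + t)^(2-m) v')' = ((e1 + t)^m - \<sigma>) v with e1 =
  \<epsilon>^(1/(m-2)) / \<Lambda>, so only \<Lambda> and e1 have to be small. The region ensures
  this, because k \<epsilon>^(1/(m-2)) < 1 there. Beyond \<theta> no approximation is made: once v
  increases where the potential is positive, it increases forever. No positive decaying solution of
  the limit problem is constructed: \<gamma> is a supremum, and only parameters next to it are used.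
  As \<gamma>_0 is fixed before the waves are given, c_0 is an infimum over all waves, and every
  estimate is uniform in them.\<close>

lemma DERIV_at_imp_continuous_on:
  fixes f :: "real \<Rightarrow> real"
  assumes "\<And>x. x \<in> A \<Longrightarrow> (f has_real_derivative f' x) (at x)"
  shows "continuous_on A f"
  using assms by (meson DERIV_isCont continuous_at_imp_continuous_on)

lemma continuous_on_Icc_bounded:
  fixes f :: "real \<Rightarrow> real"
  assumes "continuous_on {a..b} f"
  obtains L where "L > 0" "\<And>x. x \<in> {a..b} \<Longrightarrow> \<bar>f x\<bar> \<le> L"
proof -
  have "bounded (f ` {a..b})"
    using assms by (intro compact_imp_bounded compact_continuous_image) auto
  thus ?thesis using that by (auto simp: bounded_pos)
qed

lemma compact_Collect_le_Icc:
  fixes f :: "real \<Rightarrow> real"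
  assumes "continuous_on {a..b} f"
  shows "compact {x\<in>{a..b}. f x \<le> y}"
proof -
  have "closed {x\<in>{a..b}. f x \<le> y}"
    by (intro continuous_on_closed_Collect_le continuous_on_const assms) auto
  hence "compact ({a..b} \<inter> {x\<in>{a..b}. f x \<le> y})" by (intro compact_Int_closed) auto
  thus ?thesis by (simp add: Int_def conj_commute cong: conj_cong)
qed

section \<open>First and last zeros of continuous functions\<close>

lemma first_zero:
  fixes f :: "real \<Rightarrow> real"
  assumes cont: "continuous_on {a..b} f" and ab: "a \<le> b" "f a > 0" "f b \<le> 0"
  obtains z where "a < z" "z \<le> b" "f z = 0" "\<And>t. a \<le> t \<Longrightarrow> t < z \<Longrightarrow> f t > 0"
proof -
  define S where "S = {t\<in>{a..b}. f t \<le> 0}"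
  have "compact S" unfolding S_def by (rule compact_Collect_le_Icc[OF cont])
  moreover have "b \<in> S" using ab by (auto simp: S_def)
  ultimately obtain z where z: "z \<in> S" "\<And>x. x \<in> S \<Longrightarrow> z \<le> x"
    using compact_attains_inf[of S] by auto
  have pos: "f t > 0" if "a \<le> t" "t < z" for t
    using that z unfolding S_def by (force simp: not_less[symmetric])
  have "z \<noteq> a" using z(1) ab unfolding S_def by auto
  hence az: "a < z" "z \<le> b" using z(1) by (auto simp: S_def)
  have "f z = 0"
  proof (rule ccontr)
    assume "f z \<noteq> 0"
    hence "f z < 0" using z(1) by (auto simp: S_def)
    obtain x where "a \<le> x" "x \<le> z" "f x = 0"
      using IVT2'[of f z 0 a] \<open>f z < 0\<close> ab az continuous_on_subset[OF cont, of "{a..z}"] by auto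
    thus False using pos[of x] \<open>f z \<noteq> 0\<close> by (cases "x = z") auto
  qed
  thus thesis using that az pos by blast
qed

lemma last_zero:
  fixes f :: "real \<Rightarrow> real"
  assumes cont: "continuous_on {a..b} f" and ab: "a \<le> b" "f a \<le> 0" "f b > 0"
  obtains z where "a \<le> z" "z < b" "f z = 0" "\<And>t. z < t \<Longrightarrow> t \<le> b \<Longrightarrow> f t > 0"
proof -
  have "continuous_on {- b.. - a} (\<lambda>t. f (- t))"
    by (rule continuous_on_compose2[OF cont]) (auto intro!: continuous_intros)
  then obtain z where z: "- b < z" "z \<le> - a" "f (- z) = 0" "\<And>t. - b \<le> t \<Longrightarrow> t < z \<Longrightarrow> f (- t) > 0"
    using first_zero[of "- b" "- a" "\<lambda>t. f (- t)"] ab by auto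
  show thesis
  proof (rule that[of "- z"])
    show "f t > 0" if "- z < t" "t \<le> b" for t using z(4)[of "- t"] that by simp
  qed (use z in auto)
qed

section \<open>Linear differential inequalities\<close>

text \<open>Up to the first point with \<open>f \<le> 0\<close> the product
  \<open>f x * exp (L * x)\<close> is nondecreasing, where \<open>L\<close> bounds the absolute
  value of \<open>\<alpha>\<close>, so it cannot fall from a positive value to zero. Hence the
  inequality is demanded only while \<open>f\<close> has been positive since
  \<open>a\<close>.\<close>

lemma linear_inequality_pos:
  fixes f f' \<alpha> :: "real \<Rightarrow> real"
  assumes "a \<le> b" and cont: "continuous_on {a..b} \<alpha>"
    and der: "\<And>x. x \<in> {a..b} \<Longrightarrow> (f has_real_derivative f' x) (at x)"
    and ineq: "\<And>x. x \<in> {a..b} \<Longrightarrow> (\<And>y. y \<in> {a..x} \<Longrightarrow> f y > 0) \<Longrightarrow> f' x \<ge> \<alpha> x * f x"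
    and "f a > 0"
  shows "f b > 0"
proof (rule ccontr)
  assume "\<not> f b > 0"
  obtain L where L: "\<And>x. x \<in> {a..b} \<Longrightarrow> \<bar>\<alpha> x\<bar> \<le> L"
    using continuous_on_Icc_bounded[OF cont] by blast
  have cf: "continuous_on {a..b} f"
    by (rule DERIV_at_imp_continuous_on[OF der])
  define S where "S = {x\<in>{a..b}. f x \<le> 0}"
  have "compact S" unfolding S_def by (rule compact_Collect_le_Icc[OF cf])
  moreover have "b \<in> S" using \<open>\<not> f b > 0\<close> \<open>a \<le> b\<close> by (auto simp: S_def)
  ultimately obtain x0 where x0: "x0 \<in> S" "\<And>x. x \<in> S \<Longrightarrow> x0 \<le> x"
    using compact_attains_inf[of S] by auto
  have "x0 > a" using x0(1) \<open>f a > 0\<close> unfolding S_def by (cases "x0 = a") auto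
  have pos: "f x > 0" if "a \<le> x" "x < x0" for x
    using that x0 unfolding S_def by fastforce
  have "f a * exp (L * a) \<le> f x0 * exp (L * x0)"
  proof (rule DERIV_nonneg_imp_increasing_open[where f="\<lambda>x. f x * exp (L * x)"])
    fix x assume x: "a < x" "x < x0"
    have xi: "x \<in> {a..b}" using x x0(1) by (auto simp: S_def)
    have "f' x \<ge> \<alpha> x * f x" using ineq[OF xi] pos x by simp
    moreover have "\<alpha> x * f x \<ge> - L * f x" 
      using L[OF xi] pos[of x] x by (intro mult_right_mono) auto
    ultimately have "0 \<le> (f' x + L * f x) * exp (L * x)" by simp
    moreover have "((\<lambda>x. f x * exp (L * x)) has_real_derivative (f' x + L * f x) * exp (L * x)) (at x)"
      using der[OF xi] by (auto intro!: derivative_eq_intros simp: algebra_simps)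
    ultimately show "\<exists>y. ((\<lambda>x. f x * exp (L * x)) has_real_derivative y) (at x) \<and> 0 \<le> y" by blast
  next
    show "continuous_on {a..x0} (\<lambda>x. f x * exp (L * x))"
      using x0(1) by (intro continuous_intros continuous_on_subset[OF cf]) (auto simp: S_def)
  qed (use \<open>x0 > a\<close> in auto)
  moreover have "f a * exp (L * a) > 0" using \<open>f a > 0\<close> by simp
  ultimately have "f x0 * exp (L * x0) > 0" by linarith
  hence "f x0 > 0" by (simp add: zero_less_mult_iff)
  thus False using x0(1) by (simp add: S_def)
qed

text \<open>Before the first point where one of the functions fails to be positive both inequalities
  hold, and the scalar lemma applied to the failing function gives a contradiction. This suits a
  quotient and its flux, each of which controls the other only while both are positive.\<close>

lemma linear_system_pos:
  fixes f g f' g' \<alpha> \<gamma> :: "real \<Rightarrow> real"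
  assumes "a \<le> b" and cont: "continuous_on {a..b} \<alpha>" "continuous_on {a..b} \<gamma>"
    and df: "\<And>x. x \<in> {a..b} \<Longrightarrow> (f has_real_derivative f' x) (at x)"
    and dg: "\<And>x. x \<in> {a..b} \<Longrightarrow> (g has_real_derivative g' x) (at x)"
    and f': "\<And>x. x \<in> {a..b} \<Longrightarrow> f x > 0 \<Longrightarrow> g x > 0 \<Longrightarrow> f' x \<ge> \<alpha> x * f x"
    and g': "\<And>x. x \<in> {a..b} \<Longrightarrow> f x > 0 \<Longrightarrow> g x > 0 \<Longrightarrow> g' x \<ge> \<gamma> x * g x"
    and "f a > 0" "g a > 0"
  shows "f b > 0" "g b > 0"
proof -
  have "f b > 0 \<and> g b > 0"
  proof (rule ccontr)
    assume neg: "\<not> (f b > 0 \<and> g b > 0)"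
    have cf: "continuous_on {a..b} f" and cg: "continuous_on {a..b} g"
      by (rule DERIV_at_imp_continuous_on[OF df], assumption, rule DERIV_at_imp_continuous_on[OF dg])
    define S where "S = {x\<in>{a..b}. min (f x) (g x) \<le> 0}"
    have "compact S" unfolding S_def
      by (intro compact_Collect_le_Icc continuous_intros cf cg)
    moreover have "b \<in> S" using neg \<open>a \<le> b\<close> by (auto simp: S_def)
    ultimately obtain x0 where x0: "x0 \<in> S" "\<And>x. x \<in> S \<Longrightarrow> x0 \<le> x"
      using compact_attains_inf[of S] by auto
    have "x0 > a" using x0(1) \<open>f a > 0\<close> \<open>g a > 0\<close> unfolding S_def by (cases "x0 = a") auto
    have pos: "f x > 0 \<and> g x > 0" if "a \<le> x" "x < x0" for x
      using that x0 unfolding S_def by (smt (verit) atLeastAtMost_iff mem_Collect_eq)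
    have sub: "{a..x0} \<subseteq> {a..b}" using x0(1) by (auto simp: S_def)
    consider "f x0 \<le> 0" | "g x0 \<le> 0" using x0(1) unfolding S_def by fastforce
    thus False
    proof cases
      case 1
      have gf: "\<And>y. y \<in> {a..x} \<Longrightarrow> f y > 0" if "x \<in> {a..x0}" "\<And>y. y \<in> {a..x} \<Longrightarrow> f y > 0" for x
        using that by auto
      have "f x0 > 0"
      proof (rule linear_inequality_pos[where a=a and \<alpha>=\<alpha> and f=f and f'=f'])
        fix x assume x: "x \<in> {a..x0}" "\<And>y. y \<in> {a..x} \<Longrightarrow> f y > 0"
        hence "f x > 0" "x \<noteq> x0" using 1 \<open>x0 > a\<close> by fastforce+
        thus "f' x \<ge> \<alpha> x * f x" using x(1) pos[of x] sub by (intro f') auto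
      qed (use \<open>x0 > a\<close> sub df continuous_on_subset[OF cont(1)] \<open>f a > 0\<close> in auto)
      thus False using 1 by simp
    next
      case 2
      have "g x0 > 0"
      proof (rule linear_inequality_pos[where a=a and \<alpha>=\<gamma> and f=g and f'=g'])
        fix x assume x: "x \<in> {a..x0}" "\<And>y. y \<in> {a..x} \<Longrightarrow> g y > 0"
        hence "g x > 0" "x \<noteq> x0" using 2 \<open>x0 > a\<close> by fastforce+
        thus "g' x \<ge> \<gamma> x * g x" using x(1) pos[of x] sub by (intro g') auto
      qed (use \<open>x0 > a\<close> sub dg continuous_on_subset[OF cont(2)] \<open>g a > 0\<close> in auto)
      thus False using 2 by simp
    qed
  qed
  thus "f b > 0" "g b > 0" by auto
qed

text \<open>Gronwall's argument for \<open>f^2 + f1^2\<close>, run in both directions from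
  \<open>x0\<close>: a double zero propagates over the whole interval.\<close>

lemma second_order_uniqueness:
  fixes f f1 f2 :: "real \<Rightarrow> real"
  assumes f: "\<And>x. x \<in> {a..b} \<Longrightarrow> (f has_real_derivative f1 x) (at x)"
    and f1: "\<And>x. x \<in> {a..b} \<Longrightarrow> (f1 has_real_derivative f2 x) (at x)"
    and K: "\<And>x. x \<in> {a..b} \<Longrightarrow> \<bar>f2 x\<bar> \<le> K * (\<bar>f x\<bar> + \<bar>f1 x\<bar>)"
    and x0: "x0 \<in> {a..b}" "f x0 = 0" "f1 x0 = 0" and "x \<in> {a..b}"
  shows "f x = 0"
proof -
  define E where "E = (\<lambda>x. (f x)\<^sup>2 + (f1 x)\<^sup>2)"
  define E' where "E' = (\<lambda>x. 2 * f x * f1 x + 2 * f1 x * f2 x)"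
  define L where "L = 1 + 3 * \<bar>K\<bar>"
  have dE: "(E has_real_derivative E' x) (at x)" if "x \<in> {a..b}" for x
    using f[OF that] f1[OF that] unfolding E_def E'_def
    by (auto intro!: derivative_eq_intros simp: algebra_simps)
  have E'_le: "\<bar>E' x\<bar> \<le> L * E x" if "x \<in> {a..b}" for x
  proof -
    have "\<bar>f2 x\<bar> \<le> \<bar>K\<bar> * (\<bar>f x\<bar> + \<bar>f1 x\<bar>)"
      using K[OF that] mult_right_mono[of K "\<bar>K\<bar>" "\<bar>f x\<bar> + \<bar>f1 x\<bar>"] by linarith
    hence "\<bar>f1 x * f2 x\<bar> \<le> \<bar>f1 x\<bar> * (\<bar>K\<bar> * (\<bar>f x\<bar> + \<bar>f1 x\<bar>))"
      by (simp add: abs_mult mult_left_mono)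
    moreover have "\<bar>f x * f1 x\<bar> * 2 \<le> E x"
      using sum_squares_bound[of "\<bar>f x\<bar>" "\<bar>f1 x\<bar>"] by (simp add: E_def abs_mult)
    moreover have "\<bar>f1 x\<bar> * (\<bar>f x\<bar> + \<bar>f1 x\<bar>) * 2 \<le> 3 * E x"
    proof -
      have "E x = \<bar>f x\<bar>\<^sup>2 + \<bar>f1 x\<bar>\<^sup>2" by (simp add: E_def)
      moreover have "\<bar>f1 x\<bar> * (\<bar>f x\<bar> + \<bar>f1 x\<bar>) * 2 = 2 * \<bar>f x\<bar> * \<bar>f1 x\<bar> + 2 * \<bar>f1 x\<bar>\<^sup>2"
        by (simp add: algebra_simps power2_eq_square)
      moreover have "2 * \<bar>f x\<bar> * \<bar>f1 x\<bar> \<le> \<bar>f x\<bar>\<^sup>2 + \<bar>f1 x\<bar>\<^sup>2" "0 \<le> \<bar>f x\<bar>\<^sup>2"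
        using sum_squares_bound[of "\<bar>f x\<bar>" "\<bar>f1 x\<bar>"] by simp_all
      ultimately show ?thesis by linarith
    qed
    hence "\<bar>K\<bar> * (\<bar>f1 x\<bar> * (\<bar>f x\<bar> + \<bar>f1 x\<bar>) * 2) \<le> \<bar>K\<bar> * (3 * E x)" by (intro mult_left_mono) auto
    ultimately have "2 * \<bar>f x * f1 x\<bar> + 2 * \<bar>f1 x * f2 x\<bar> \<le> L * E x"
      unfolding L_def by (simp add: algebra_simps)
    thus ?thesis unfolding E'_def by linarith
  qed
  have "E x \<le> 0"
  proof (cases "x0 \<le> x")
    case True
    have "E x * exp (- L * x) \<le> E x0 * exp (- L * x0)"
    proof (rule DERIV_nonpos_imp_nonincreasing[OF True, where f="\<lambda>x. E x * exp (- L * x)"])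
      fix y assume "x0 \<le> y" "y \<le> x"
      hence y: "y \<in> {a..b}" using x0 \<open>x \<in> {a..b}\<close> by auto
      have "((\<lambda>x. E x * exp (- L * x)) has_real_derivative (E' y - L * E y) * exp (- L * y)) (at y)"
        using dE[OF y] by (auto intro!: derivative_eq_intros simp: algebra_simps)
      moreover have "(E' y - L * E y) * exp (- L * y) \<le> 0"
        using E'_le[OF y] by (intro mult_nonpos_nonneg) auto
      ultimately show "\<exists>d. ((\<lambda>x. E x * exp (- L * x)) has_real_derivative d) (at y) \<and> d \<le> 0" by blast
    qed
    hence "E x * exp (- L * x) \<le> 0" using x0 by (simp add: E_def)
    thus ?thesis by (simp add: mult_le_0_iff)
  next
    case False
    hence le: "x \<le> x0" by simp
    have "E x * exp (L * x) \<le> E x0 * exp (L * x0)"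
    proof (rule DERIV_nonneg_imp_nondecreasing[OF le, where f="\<lambda>x. E x * exp (L * x)"])
      fix y assume "x \<le> y" "y \<le> x0"
      hence y: "y \<in> {a..b}" using x0 \<open>x \<in> {a..b}\<close> by auto
      have "((\<lambda>x. E x * exp (L * x)) has_real_derivative (E' y + L * E y) * exp (L * y)) (at y)"
        using dE[OF y] by (auto intro!: derivative_eq_intros simp: algebra_simps)
      moreover have "(E' y + L * E y) * exp (L * y) \<ge> 0"
        using E'_le[OF y] by (intro mult_nonneg_nonneg) auto
      ultimately show "\<exists>d. ((\<lambda>x. E x * exp (L * x)) has_real_derivative d) (at y) \<and> 0 \<le> d" by blast
    qed
    hence "E x * exp (L * x) \<le> 0" using x0 by (simp add: E_def)
    thus ?thesis by (simp add: mult_le_0_iff)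
  qed
  moreover have "(f x)\<^sup>2 \<le> E x" by (simp add: E_def)
  ultimately have "(f x)\<^sup>2 \<le> 0" by linarith
  thus ?thesis by simp
qed

text \<open>An interpolation estimate. The mean value theorem gives a point with slope at most 2 S /
  h; from there \<open>f1\<close> varies by at most K h (S + M), where M is its maximum, and
  \<open>K * h \<le> 1 / 2\<close> allows half of M to be absorbed. It transfers decay from a
  solution to its derivative.\<close>

lemma second_order_gradient_bound:
  fixes f f1 f2 :: "real \<Rightarrow> real"
  assumes f: "\<And>x. x \<in> {a..a+h} \<Longrightarrow> (f has_real_derivative f1 x) (at x)"
    and f1: "\<And>x. x \<in> {a..a+h} \<Longrightarrow> (f1 has_real_derivative f2 x) (at x)"
    and K: "\<And>x. x \<in> {a..a+h} \<Longrightarrow> \<bar>f2 x\<bar> \<le> K * (\<bar>f x\<bar> + \<bar>f1 x\<bar>)"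
    and S: "\<And>x. x \<in> {a..a+h} \<Longrightarrow> \<bar>f x\<bar> \<le> S"
    and h: "0 < h" "K \<ge> 0" "K * h \<le> 1 / 2" and "x \<in> {a..a+h}"
  shows "\<bar>f1 x\<bar> \<le> (4 / h + 1) * S"
proof -
  have "continuous_on {a..a+h} (\<lambda>x. \<bar>f1 x\<bar>)"
    by (intro continuous_intros DERIV_at_imp_continuous_on[OF f1])
  then obtain z where z: "z \<in> {a..a+h}" and max: "\<And>x. x \<in> {a..a+h} \<Longrightarrow> \<bar>f1 x\<bar> \<le> \<bar>f1 z\<bar>"
    using continuous_attains_sup[of "{a..a+h}" "\<lambda>x. \<bar>f1 x\<bar>"] h by auto
  define M where "M = \<bar>f1 z\<bar>"
  obtain y where y: "a < y" "y < a + h" "f (a + h) - f a = h * f1 y"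
    using MVT2[of a "a + h" f f1] f h by auto
  have S0: "S \<ge> 0" using S[of a] h by auto
  have "h * \<bar>f1 y\<bar> = \<bar>f (a + h) - f a\<bar>" using y(3) h by (simp add: abs_mult)
  also have "\<dots> \<le> 2 * S" using S[of a] S[of "a + h"] h by auto
  finally have f1y: "\<bar>f1 y\<bar> \<le> 2 * S / h" using h by (simp add: field_simps)
  have "\<bar>f1 z - f1 y\<bar> \<le> K * (S + M) * \<bar>z - y\<bar>"
  proof -
    have "norm (f1 z - f1 y) \<le> K * (S + M) * norm (z - y)"
    proof (rule field_differentiable_bound[of "{a..a+h}" f1 f2])
      fix x assume x: "x \<in> {a..a+h}"
      show "norm (f2 x) \<le> K * (S + M)"
        using K[OF x] S[OF x] max[OF x] h
        by (smt (verit) M_def mult_left_mono real_norm_def)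
    qed (use f1 z y in \<open>auto intro: has_field_derivative_at_within\<close>)
    thus ?thesis by simp
  qed
  also have "\<dots> \<le> K * (S + M) * h"
    using z y h S0 by (intro mult_left_mono) (auto simp: M_def)
  also have "\<dots> = (K * h) * (S + M)" by simp
  also have "\<dots> \<le> 1 / 2 * (S + M)" using h S0 by (intro mult_right_mono) (auto simp: M_def)
  finally have "M \<le> 2 * S / h + 1 / 2 * (S + M)" using f1y unfolding M_def by linarith
  hence "M \<le> (4 / h + 1) * S" by (simp add: field_simps)
  thus ?thesis using max[OF \<open>x \<in> {a..a+h}\<close>] by (simp add: M_def)
qed

section \<open>Singular Volterra equations\<close>

text \<open>Terms of a Neumann series. The integral over {0..T} is rescaled to {0..1}, so that the
  kernel can be continuous up to \<open>T = 0\<close> even where the original coefficients are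
  singular.\<close>

primrec volterra_iterate ::
  "('a \<Rightarrow> real \<Rightarrow> real \<Rightarrow> real) \<Rightarrow> nat \<Rightarrow> 'a \<Rightarrow> real \<Rightarrow> real" where
  "volterra_iterate k 0 s T = 1"
| "volterra_iterate k (Suc j) s T =
     T * integral {0..1} (\<lambda>\<theta>. k s T \<theta> * volterra_iterate k j s (T * \<theta>))"

lemma integral_power_unit_interval: "integral {0..1} (\<lambda>\<theta>. \<theta> ^ j) = (1 / real (Suc j) :: real)"
proof -
  have "((\<lambda>\<theta>::real. \<theta> ^ j) has_integral (1 ^ Suc j / real (Suc j) - 0 ^ Suc j / real (Suc j))) {0..1}"
  proof (rule fundamental_theorem_of_calculus)
    fix x :: real
    have "((\<lambda>x. x ^ Suc j / real (Suc j)) has_real_derivative x ^ j) (at x within {0..1})"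
      by (rule derivative_eq_intros refl | simp)+
    thus "((\<lambda>x. x ^ Suc j / real (Suc j)) has_vector_derivative x ^ j) (at x within {0..1})"
      by (simp add: has_real_derivative_iff_has_vector_derivative)
  qed auto
  thus ?thesis by (simp add: integral_unique)
qed

lemma continuous_on_compose_pair:
  assumes "continuous_on (S \<times> R) (\<lambda>(s, T). f s T)" "continuous_on D a" "continuous_on D b"
    and "\<And>x. x \<in> D \<Longrightarrow> a x \<in> S" "\<And>x. x \<in> D \<Longrightarrow> b x \<in> R"
  shows "continuous_on D (\<lambda>x. f (a x) (b x))"
  using continuous_on_compose2[OF assms(1) continuous_on_Pair[OF assms(2,3)]] assms(4,5)
  by (simp add: image_subset_iff)

lemma continuous_on_compose_triple:
  assumes "continuous_on (S \<times> R \<times> Q) (\<lambda>(s, T, q). f s T q)"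
    and "continuous_on D a" "continuous_on D b" "continuous_on D c"
    and "\<And>x. x \<in> D \<Longrightarrow> a x \<in> S" "\<And>x. x \<in> D \<Longrightarrow> b x \<in> R" "\<And>x. x \<in> D \<Longrightarrow> c x \<in> Q"
  shows "continuous_on D (\<lambda>x. f (a x) (b x) (c x))"
  using continuous_on_compose2[OF assms(1) continuous_on_Pair[OF assms(2) continuous_on_Pair[OF assms(3,4)]]] assms(5-7)
  by (simp add: image_subset_iff)

text \<open>Continuity is local, and every point has a neighbourhood inside a strip of finite
  height; the series below converges uniformly on such strips.\<close>

lemma continuous_on_atLeast_iff:
  fixes f :: "'a::t2_space \<times> real \<Rightarrow> real"
  assumes "\<And>Z. continuous_on (S \<times> {0..Z}) f"
  shows "continuous_on (S \<times> {0..}) f"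
  unfolding continuous_on_eq_continuous_within
proof (rule ballI)
  fix x assume x: "x \<in> S \<times> {0::real..}"
  have "at x within S \<times> {0..snd x + 1} = at x within S \<times> {0..}"
    by (rule at_within_nhd[of _ "UNIV \<times> {..<snd x + 1}"]) (auto intro!: open_Times simp: mem_Times_iff)
  moreover have "continuous (at x within S \<times> {0..snd x + 1}) f"
    using assms[of "snd x + 1"] x unfolding continuous_on_eq_continuous_within by auto
  ultimately show "continuous (at x within S \<times> {0..}) f" by simp
qed

lemma continuous_on_volterra_integrand:
  fixes k :: "'a::topological_space \<Rightarrow> real \<Rightarrow> real \<Rightarrow> real"
  assumes k: "continuous_on (S \<times> {0..} \<times> {0..1}) (\<lambda>(s, T, \<theta>). k s T \<theta>)"
    and f: "continuous_on (S \<times> {0..}) (\<lambda>(s, T). f s T)"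
  shows "continuous_on ((S \<times> {0..}) \<times> {0..1}) (\<lambda>((s, T), \<theta>). k s T \<theta> * f s (T * \<theta>) :: real)"
proof -
  have "continuous_on ((S \<times> {0..}) \<times> {0..1}) (\<lambda>x. k (fst (fst x)) (snd (fst x)) (snd x))"
    by (rule continuous_on_compose_triple[OF k]; (intro continuous_intros)?) auto
  moreover have "continuous_on ((S \<times> {0..}) \<times> {0..1}) (\<lambda>x. f (fst (fst x)) (snd (fst x) * snd x))"
    by (rule continuous_on_compose_pair[OF f]; (intro continuous_intros)?) (auto simp: zero_le_mult_iff)
  ultimately show ?thesis by (simp add: case_prod_unfold continuous_on_mult)
qed

lemma continuous_on_volterra_integral:
  fixes k :: "'a::topological_space \<Rightarrow> real \<Rightarrow> real \<Rightarrow> real"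
  assumes k: "continuous_on (S \<times> {0..} \<times> {0..1}) (\<lambda>(s, T, \<theta>). k s T \<theta>)"
    and f: "continuous_on (S \<times> {0..}) (\<lambda>(s, T). f s T)"
  shows "continuous_on (S \<times> {0..}) (\<lambda>(s, T). integral {0..1} (\<lambda>\<theta>. k s T \<theta> * f s (T * \<theta>)) :: real)"
proof -
  have "continuous_on (S \<times> {0..}) (\<lambda>x. integral (cbox 0 1) (\<lambda>\<theta>. k (fst x) (snd x) \<theta> * f (fst x) (snd x * \<theta>)))"
    using continuous_on_volterra_integrand[OF k f]
    by (intro integral_continuous_on_param) (simp add: case_prod_unfold)
  thus ?thesis by (simp add: case_prod_unfold)
qed

text \<open>On each strip the j-th term of the Neumann series is at most (M T)^j / j!. The resulting
  uniform convergence gives joint continuity in \<open>s\<close> and \<open>T\<close> and allows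
  termwise integration.\<close>

lemma volterra_solution:
  fixes k :: "'a::metric_space \<Rightarrow> real \<Rightarrow> real \<Rightarrow> real"
  assumes "compact S" and k: "continuous_on (S \<times> {0..} \<times> {0..1}) (\<lambda>(s, T, \<theta>). k s T \<theta>)"
  obtains h where "continuous_on (S \<times> {0..}) (\<lambda>(s, T). h s T)"
    and "\<And>s T. s \<in> S \<Longrightarrow> T \<ge> 0 \<Longrightarrow> h s T = 1 + T * integral {0..1} (\<lambda>\<theta>. k s T \<theta> * h s (T * \<theta>))"
proof -
  let ?v = "volterra_iterate k"
  have cont: "continuous_on (S \<times> {0..}) (\<lambda>(s, T). ?v j s T)" for j
  proof (induction j)
    case (Suc j)
    show ?case using continuous_on_volterra_integral[OF k Suc]
      by (auto simp: case_prod_unfold intro!: continuous_intros)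
  qed (simp add: case_prod_unfold)
  have cont_integrand: "continuous_on {0..1} (\<lambda>\<theta>. k s T \<theta> * f s (T * \<theta>))"
    if "s \<in> S" "T \<ge> 0" "continuous_on (S \<times> {0..}) (\<lambda>(s, T). f s T)" for s T and f :: "'a \<Rightarrow> real \<Rightarrow> real"
    using that
    by (intro continuous_on_mult continuous_on_compose_triple[OF k] continuous_on_compose_pair[OF that(3)])
       (auto intro!: continuous_intros)
  define h where "h = (\<lambda>s T. \<Sum>j. ?v j s T)"
  have bound: "\<exists>M\<ge>0. \<forall>j. \<forall>s\<in>S. \<forall>T\<in>{0..Z}. \<bar>?v j s T\<bar> \<le> (M * T) ^ j / fact j" for Z
  proof -
    have "compact (S \<times> {0..Z} \<times> {0..1::real})" using \<open>compact S\<close> by (intro compact_Times) auto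
    moreover have "continuous_on (S \<times> {0..Z} \<times> {0..1}) (\<lambda>(s, T, \<theta>). k s T \<theta>)"
      by (rule continuous_on_subset[OF k]) auto
    ultimately have "bounded ((\<lambda>(s, T, \<theta>). k s T \<theta>) ` (S \<times> {0..Z} \<times> {0..1}))"
      by (intro compact_imp_bounded compact_continuous_image)
    then obtain M where M: "M > 0" "\<forall>x\<in>(\<lambda>(s, T, \<theta>). k s T \<theta>) ` (S \<times> {0..Z} \<times> {0..1}). norm x \<le> M"
      unfolding bounded_pos by blast
    hence kM: "\<bar>k s T \<theta>\<bar> \<le> M" if "s \<in> S" "T \<in> {0..Z}" "\<theta> \<in> {0..1}" for s T \<theta>
      using that by fastforce
    \<comment> \<open>The factor \<theta>^j in the bound for the previous term integrates to 1 / (j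
      + 1), which builds up the factorial.\<close>
    have "\<bar>?v j s T\<bar> \<le> (M * T) ^ j / fact j" if "s \<in> S" "T \<in> {0..Z}" for j s T
      using that
    proof (induction j arbitrary: T)
      case (Suc j)
      have "\<bar>integral {0..1} (\<lambda>\<theta>. k s T \<theta> * ?v j s (T * \<theta>))\<bar> 
              \<le> integral {0..1} (\<lambda>\<theta>. M * ((M * T) ^ j / fact j) * \<theta> ^ j)"
      proof (subst real_norm_def[symmetric], rule integral_norm_bound_integral)
        show "(\<lambda>\<theta>. k s T \<theta> * ?v j s (T * \<theta>)) integrable_on {0..1}"
          using Suc.prems cont_integrand[OF _ _ cont] by (intro integrable_continuous_real) auto
        show "(\<lambda>\<theta>. M * ((M * T) ^ j / fact j) * \<theta> ^ j) integrable_on {0..1}"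
          by (intro integrable_continuous_real continuous_intros)
        fix \<theta> :: real assume \<theta>: "\<theta> \<in> {0..1}"
        have T\<theta>: "T * \<theta> \<in> {0..Z}" using \<theta> Suc.prems by (auto intro: order_trans[OF mult_left_le])
        have "\<bar>k s T \<theta>\<bar> * \<bar>?v j s (T * \<theta>)\<bar> \<le> M * ((M * (T * \<theta>)) ^ j / fact j)"
          using kM[of s T \<theta>] Suc.IH[OF Suc.prems(1) T\<theta>] \<theta> Suc.prems M(1) by (intro mult_mono) auto
        also have "\<dots> = M * ((M * T) ^ j / fact j) * \<theta> ^ j" by (simp add: power_mult_distrib)
        finally show "norm (k s T \<theta> * ?v j s (T * \<theta>)) \<le> M * ((M * T) ^ j / fact j) * \<theta> ^ j"
          by (simp add: abs_mult)
      qed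
      also have "\<dots> = M * ((M * T) ^ j / fact j) / Suc j"
        using integral_power_unit_interval[of j] by simp
      finally have "T * \<bar>integral {0..1} (\<lambda>\<theta>. k s T \<theta> * ?v j s (T * \<theta>))\<bar> 
          \<le> T * (M * ((M * T) ^ j / fact j) / Suc j)"
        using Suc.prems by (intro mult_left_mono) auto
      also have "\<dots> = (M * T) ^ Suc j / fact (Suc j)" by (simp add: field_simps)
      finally show ?case using Suc.prems by (simp add: abs_mult)
    qed simp
    thus ?thesis using M(1) by (intro exI[of _ M]) auto
  qed
  have unif: "uniform_limit (S \<times> {0..Z}) (\<lambda>n (s, T). \<Sum>j<n. ?v j s T) (\<lambda>(s, T). h s T) sequentially" for Z
  proof -
    obtain M where M: "M \<ge> 0" "\<And>j s T. s \<in> S \<Longrightarrow> T \<in> {0..Z} \<Longrightarrow> \<bar>?v j s T\<bar> \<le> (M * T) ^ j / fact j"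
      using bound[of Z] by blast
    have "uniform_limit (S \<times> {0..Z}) (\<lambda>n x. \<Sum>j<n. ?v j (fst x) (snd x)) 
            (\<lambda>x. \<Sum>j. ?v j (fst x) (snd x)) sequentially"
    proof (rule Weierstrass_m_test[where M = "\<lambda>j. (M * Z) ^ j / fact j"])
      fix n x assume x: "x \<in> S \<times> {0..Z}"
      have "\<bar>?v n (fst x) (snd x)\<bar> \<le> (M * snd x) ^ n / fact n" using M(2)[of "fst x" "snd x" n] x by auto
      also have "\<dots> \<le> (M * Z) ^ n / fact n"
        using x M(1) by (intro divide_right_mono power_mono mult_left_mono) auto
      finally show "norm (?v n (fst x) (snd x)) \<le> (M * Z) ^ n / fact n" by simp
    next
      show "summable (\<lambda>j. (M * Z) ^ j / fact j)"
        using summable_exp[of "M * Z"] by (simp add: field_simps)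
    qed
    thus ?thesis by (simp add: case_prod_unfold h_def)
  qed
  have cont_h: "continuous_on (S \<times> {0..}) (\<lambda>(s, T). h s T)"
  proof (rule continuous_on_atLeast_iff, rule uniform_limit_theorem[OF _ unif])
    fix Z :: real
    have "continuous_on (S \<times> {0..Z}) (\<lambda>x. ?v j (fst x) (snd x))" for j
      by (rule continuous_on_subset[OF cont[unfolded case_prod_unfold]]) auto
    thus "\<forall>\<^sub>F n in sequentially. continuous_on (S \<times> {0..Z}) (\<lambda>(s, T). \<Sum>j<n. ?v j s T)"
      unfolding case_prod_unfold by (intro always_eventually allI continuous_on_sum) auto
  qed auto
  show thesis
  proof (rule that[OF cont_h])
    fix s and T :: real assume s: "s \<in> S" and T: "T \<ge> 0"
    have lim_h: "(\<lambda>n. \<Sum>j<n. ?v j s T) \<longlonglongrightarrow> h s T" 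
      using tendsto_uniform_limitI[OF unif[of T], of "(s, T)"] s T by simp
    have ul: "uniform_limit {0..1} (\<lambda>n \<theta>. k s T \<theta> * (\<Sum>j<n. ?v j s (T * \<theta>))) 
                (\<lambda>\<theta>. k s T \<theta> * h s (T * \<theta>)) sequentially"
    proof (rule uniform_lim_mult)
      show "uniform_limit {0..1} (\<lambda>n. k s T) (k s T) sequentially" by (rule uniform_limit_const)
      have "uniform_limit {0..1} (\<lambda>n \<theta>. (\<lambda>n (s, T). \<Sum>j<n. ?v j s T) n (s, T * \<theta>)) 
              (\<lambda>\<theta>. (\<lambda>(s, T). h s T) (s, T * \<theta>)) sequentially"
        using T s by (intro uniform_limit_compose'[OF unif[of T]]) (auto intro: mult_left_le)
      thus "uniform_limit {0..1} (\<lambda>n \<theta>. \<Sum>j<n. ?v j s (T * \<theta>)) (\<lambda>\<theta>. h s (T * \<theta>)) sequentially"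
        by simp
      have "continuous_on {0..1} (\<lambda>\<theta>. k s T \<theta>)"
        using s T by (intro continuous_on_compose_triple[OF k]) (auto intro!: continuous_intros)
      thus "bounded (k s T ` {0..1})" by (intro compact_imp_bounded compact_continuous_image) auto
      have "continuous_on {0..1} (\<lambda>\<theta>. h s (T * \<theta>))"
        using s T by (intro continuous_on_compose_pair[OF cont_h]) (auto intro!: continuous_intros)
      thus "bounded ((\<lambda>\<theta>. h s (T * \<theta>)) ` {0..1})" by (intro compact_imp_bounded compact_continuous_image) auto
    qed
    have cont_v: "continuous_on {0..1} (\<lambda>\<theta>. k s T \<theta> * ?v j s (T * \<theta>))" for j
      using cont_integrand[OF s T cont] .
    have "(\<lambda>n. integral {0..1} (\<lambda>\<theta>. k s T \<theta> * (\<Sum>j<n. ?v j s (T * \<theta>)))) \<longlonglongrightarrow>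
            integral {0..1} (\<lambda>\<theta>. k s T \<theta> * h s (T * \<theta>))"
    proof (rule uniform_limit_integral[OF ul])
      show "continuous_on {0..1} (\<lambda>\<theta>. k s T \<theta> * (\<Sum>j<n. ?v j s (T * \<theta>)))" for n
        unfolding sum_distrib_left by (intro continuous_on_sum cont_v)
      fix I J assume IJ: "\<And>n. ((\<lambda>\<theta>. k s T \<theta> * (\<Sum>j<n. ?v j s (T * \<theta>))) has_integral I n) {0..1}"
        "((\<lambda>\<theta>. k s T \<theta> * h s (T * \<theta>)) has_integral J) {0..1}" "I \<longlonglongrightarrow> J"
      show ?thesis unfolding IJ(1)[THEN integral_unique] IJ(2)[THEN integral_unique] by (rule IJ(3))
    qed auto
    hence "(\<lambda>n. 1 + T * integral {0..1} (\<lambda>\<theta>. k s T \<theta> * (\<Sum>j<n. ?v j s (T * \<theta>)))) \<longlonglongrightarrow>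
            1 + T * integral {0..1} (\<lambda>\<theta>. k s T \<theta> * h s (T * \<theta>))"
      by (intro tendsto_intros)
    moreover have "1 + T * integral {0..1} (\<lambda>\<theta>. k s T \<theta> * (\<Sum>j<n. ?v j s (T * \<theta>))) = (\<Sum>j<Suc n. ?v j s T)" for n
    proof -
      have "integral {0..1} (\<lambda>\<theta>. k s T \<theta> * (\<Sum>j<n. ?v j s (T * \<theta>))) = 
              (\<Sum>j<n. integral {0..1} (\<lambda>\<theta>. k s T \<theta> * ?v j s (T * \<theta>)))"
        unfolding sum_distrib_left by (intro integral_sum integrable_continuous_real cont_v) auto
      thus ?thesis unfolding sum.lessThan_Suc_shift by (simp add: sum_distrib_left)
    qed
    ultimately have "(\<lambda>n. \<Sum>j<Suc n. ?v j s T) \<longlonglongrightarrow> 1 + T * integral {0..1} (\<lambda>\<theta>. k s T \<theta> * h s (T * \<theta>))"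
      by simp
    moreover have "(\<lambda>n. \<Sum>j<Suc n. ?v j s T) \<longlonglongrightarrow> h s T" using lim_h by (rule LIMSEQ_Suc)
    ultimately show "h s T = 1 + T * integral {0..1} (\<lambda>\<theta>. k s T \<theta> * h s (T * \<theta>))"
      using LIMSEQ_unique by blast
  qed
qed

lemma integral_rescale:
  fixes f :: "real \<Rightarrow> real"
  assumes f: "continuous_on {0..} f" and T: "T \<ge> 0"
  shows "T * integral {0..1} (\<lambda>\<theta>. f (T * \<theta>)) = integral {0..T} f"
proof (cases "T = 0")
  case False
  hence T: "T > 0" using T by simp
  have "(f has_integral integral {0..T} f) (cbox 0 T)"
    using continuous_on_subset[OF f] by (auto intro!: integrable_integral integrable_continuous_real)
  from has_integral_affinity[OF this, of T 0] T
  have "((\<lambda>x. f (T * x)) has_integral integral {0..T} f / T) {0..1}"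
    by (simp add: scaleR_conv_of_real field_simps image_divide_atLeastAtMost)
  thus ?thesis using T by (simp add: integral_unique)
qed auto

lemma integral_has_derivative_at:
  fixes f :: "real \<Rightarrow> real"
  assumes f: "continuous_on {0..} f" and T: "T > 0"
  shows "((\<lambda>T. integral {0..T} f) has_real_derivative f T) (at T)"
proof -
  have "((\<lambda>T. integral {0..T} f) has_real_derivative f T) (at T within {0..T+1})"
    using T by (intro integral_has_real_derivative continuous_on_subset[OF f]) auto
  moreover have "at T within {0..T+1} = at T" using T by (intro at_within_interior) (auto simp: interior_atLeastAtMost_real)
  ultimately show ?thesis by simp
qed

text \<open>
  The equation \<open>(h' / B')' = A h\<close> on the half line with \<open>h = 1\<close> and \<open>h' / B' = 0\<close> at the
  singular end \<open>0\<close>, where \<open>B\<close> may blow up.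
\<close>

lemma singular_initial_value_problem:
  fixes A B C B' :: "real \<Rightarrow> real \<Rightarrow> real"
  assumes S: "compact S" and k: "continuous_on (S \<times> {0..} \<times> {0..1}) (\<lambda>(s, T, \<theta>). k s T \<theta>)"
    and A: "continuous_on (S \<times> {0..}) (\<lambda>(s, T). A s T)" and C: "continuous_on (S \<times> {0..}) (\<lambda>(s, T). C s T)"
    and B: "\<And>s T. s \<in> S \<Longrightarrow> T > 0 \<Longrightarrow> (B s has_real_derivative B' s T) (at T)"
    and k_eq: "\<And>s T \<theta>. s \<in> S \<Longrightarrow> T > 0 \<Longrightarrow> \<theta> \<in> {0..1} \<Longrightarrow> k s T \<theta> = B s T * A s (T * \<theta>) - C s (T * \<theta>)"
    and C_eq: "\<And>s T. s \<in> S \<Longrightarrow> T > 0 \<Longrightarrow> C s T = B s T * A s T"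
  obtains h r where
    "continuous_on (S \<times> {0..}) (\<lambda>(s, T). h s T)" "continuous_on (S \<times> {0..}) (\<lambda>(s, T). r s T)"
    "\<And>s. s \<in> S \<Longrightarrow> h s 0 = 1"
    "\<And>s T. s \<in> S \<Longrightarrow> T \<ge> 0 \<Longrightarrow> r s T = integral {0..1} (\<lambda>\<theta>. A s (T * \<theta>) * h s (T * \<theta>))"
    "\<And>s T. s \<in> S \<Longrightarrow> T > 0 \<Longrightarrow> (h s has_real_derivative B' s T * (T * r s T)) (at T)"
    "\<And>s T. s \<in> S \<Longrightarrow> T > 0 \<Longrightarrow> ((\<lambda>T. T * r s T) has_real_derivative A s T * h s T) (at T)"
proof -
  obtain h where h: "continuous_on (S \<times> {0..}) (\<lambda>(s, T). h s T)"
    and h_eq: "\<And>s T. s \<in> S \<Longrightarrow> T \<ge> 0 \<Longrightarrow> h s T = 1 + T * integral {0..1} (\<lambda>\<theta>. k s T \<theta> * h s (T * \<theta>))"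
    using volterra_solution[OF S k] by blast
  define r where "r = (\<lambda>s T. integral {0..1} (\<lambda>\<theta>. A s (T * \<theta>) * h s (T * \<theta>)))"
  define W where "W = (\<lambda>s T. T * r s T)"
  have sec: "continuous_on {0..} (f s)"
    if "continuous_on (S \<times> {0..}) (\<lambda>(s, T). f s T)" "s \<in> S" for f :: "real \<Rightarrow> real \<Rightarrow> real" and s
    using that(2) by (intro continuous_on_compose_pair[OF that(1)]) (auto intro!: continuous_intros)
  have contr: "continuous_on (S \<times> {0..}) (\<lambda>(s, T). r s T)"
    unfolding r_def
  proof (rule continuous_on_volterra_integral[OF _ h])
    show "continuous_on (S \<times> {0..} \<times> {0..1}) (\<lambda>(s, T, \<theta>). A s (T * \<theta>))"
      unfolding case_prod_unfold
      by (rule continuous_on_compose_pair[OF A]; (intro continuous_intros)?) (auto simp: zero_le_mult_iff)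
  qed
  have Ah: "continuous_on {0..} (\<lambda>T. A s T * h s T)" and Ch: "continuous_on {0..} (\<lambda>T. C s T * h s T)" 
    if "s \<in> S" for s
    using sec[OF A that] sec[OF h that] sec[OF C that] by (auto intro!: continuous_intros)
  have W_eq: "W s T = integral {0..T} (\<lambda>T. A s T * h s T)" if "s \<in> S" "T \<ge> 0" for s T
    unfolding W_def r_def using integral_rescale[OF Ah[OF that(1)] that(2)] by simp
  have dW: "(W s has_real_derivative A s T * h s T) (at T)" if s: "s \<in> S" and T: "T > 0" for s T
    using integral_has_derivative_at[OF Ah[OF s] T]
    by (rule DERIV_cong_ev[THEN iffD2, OF refl _ refl, rotated])
       (use T eventually_gt_at_top in \<open>auto intro!: eventually_mono[OF eventually_nhds_in_open[of "{0<..}" T]] W_eq[OF s]\<close>)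
  \<comment> \<open>With W the integral of A h, exchanging the integrals in h = 1 + \<integral> B' W
    gives the kernel (B(T) - B(t)) A(t). While \<open>B\<close> may blow up at 0, the combinations
    \<open>k\<close> and \<open>C\<close> extend continuously. In this form the terms B A h and C h
    cancel on differentiation, which leaves B' W.\<close>
  have h_eq2: "h s T = 1 + (B s T * W s T - integral {0..T} (\<lambda>T. C s T * h s T))" if s: "s \<in> S" and T: "T > 0" for s T
  proof -
    have c: "continuous_on {0..1} (\<lambda>\<theta>. f (T * \<theta>))" if "continuous_on {0..} f" for f :: "real \<Rightarrow> real"
      using T by (intro continuous_on_compose2[OF that]) (auto intro!: continuous_intros)
    have "integral {0..1} (\<lambda>\<theta>. k s T \<theta> * h s (T * \<theta>)) = 
          integral {0..1} (\<lambda>\<theta>. B s T * (A s (T * \<theta>) * h s (T * \<theta>)) - C s (T * \<theta>) * h s (T * \<theta>))"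
      by (intro integral_cong) (simp add: k_eq[OF s T] algebra_simps)
    also have "\<dots> = integral {0..1} (\<lambda>\<theta>. B s T * (A s (T * \<theta>) * h s (T * \<theta>))) 
                   - integral {0..1} (\<lambda>\<theta>. C s (T * \<theta>) * h s (T * \<theta>))"
      by (intro integral_diff integrable_continuous_real continuous_intros c[OF Ah[OF s]] c[OF Ch[OF s]])
    finally have "T * integral {0..1} (\<lambda>\<theta>. k s T \<theta> * h s (T * \<theta>)) = 
        B s T * W s T - T * integral {0..1} (\<lambda>\<theta>. C s (T * \<theta>) * h s (T * \<theta>))"
      by (simp add: W_def r_def right_diff_distrib)
    thus ?thesis using h_eq[OF s] integral_rescale[OF Ch[OF s]] T by simp
  qed
  have dh: "(h s has_real_derivative B' s T * W s T) (at T)" if s: "s \<in> S" and T: "T > 0" for s T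
  proof -
    have "((\<lambda>T. 1 + (B s T * W s T - integral {0..T} (\<lambda>T. C s T * h s T))) has_real_derivative B' s T * W s T) (at T)"
      using B[OF s T] dW[OF s T] integral_has_derivative_at[OF Ch[OF s] T] C_eq[OF s T]
      by (auto intro!: derivative_eq_intros)
    thus ?thesis
      by (rule DERIV_cong_ev[THEN iffD2, OF refl _ refl, rotated])
         (use T in \<open>auto intro!: eventually_mono[OF eventually_nhds_in_open[of "{0<..}" T]] h_eq2[OF s]\<close>)
  qed
  show thesis
  proof (rule that[of h r])
    show "h s 0 = 1" if "s \<in> S" for s using h_eq[OF that, of 0] by simp
    show "((\<lambda>T. T * r s T) has_real_derivative A s T * h s T) (at T)" if "s \<in> S" "T > 0" for s T
      using dW[OF that] by (simp add: W_def[abs_def])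
  qed (use h contr dh in \<open>auto simp: W_def r_def\<close>)
qed

section \<open>The limit problem\<close>

text \<open>The equation (t^(4-m) v')' = (t^m - \<sigma>) v as a first-order system. The flux
  t^(4-m) v' is written \<open>t * r t\<close> because it behaves like -\<sigma> t at 0; so
  \<open>r\<close> is continuous there with value -\<sigma>.\<close>

definition limit_solution :: "real \<Rightarrow> real \<Rightarrow> (real \<Rightarrow> real) \<Rightarrow> (real \<Rightarrow> real) \<Rightarrow> bool" where
  "limit_solution m \<sigma> v r \<longleftrightarrow>
     continuous_on {0..} v \<and> continuous_on {0..} r \<and> v 0 = 1 \<and> r 0 = - \<sigma> \<and>
     (\<forall>t>0. (v has_real_derivative t powr (m - 3) * r t) (at t) \<and>
            ((\<lambda>t. t * r t) has_real_derivative (t powr m - \<sigma>) * v t) (at t))"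

text \<open>The claim concerns some solution, so its negation speaks about every solution; whichever
  one has been constructed can then be used without a uniqueness theorem.\<close>

definition turning :: "real \<Rightarrow> real \<Rightarrow> bool" where
  "turning m \<sigma> \<longleftrightarrow> (\<exists>v r. limit_solution m \<sigma> v r \<and> (\<exists>Z>0. (\<forall>t\<in>{0..Z}. v t > 0) \<and> r Z > 0))"

definition vanishing :: "real \<Rightarrow> real \<Rightarrow> bool" where
  "vanishing m \<sigma> \<longleftrightarrow> (\<exists>v r. limit_solution m \<sigma> v r \<and>
     (\<exists>Z>0. v Z = 0 \<and> (\<forall>t\<in>{0..<Z}. v t > 0) \<and> (\<forall>t\<in>{0<..<Z}. r t \<le> 0)))"

lemma limit_solutionD:
  assumes "limit_solution m \<sigma> v r"
  shows "continuous_on {0..} v" "continuous_on {0..} r" "v 0 = 1" "r 0 = - \<sigma>"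
    and "\<And>t. t > 0 \<Longrightarrow> (v has_real_derivative t powr (m - 3) * r t) (at t)"
    and "\<And>t. t > 0 \<Longrightarrow> ((\<lambda>t. t * r t) has_real_derivative (t powr m - \<sigma>) * v t) (at t)"
  using assms unfolding limit_solution_def by auto

text \<open>Here B' = t^(m-4), and m > 3 is what makes its primitive t^(m-3) / (m - 3) continuous at
  the singular end.\<close>

lemma limit_solution_exists:
  assumes "m > 3"
  obtains v r where "limit_solution m \<sigma> v r"
proof -
  define A where "A = (\<lambda>(s::real) T. T powr m - s)"
  define B where "B = (\<lambda>(s::real) T. T powr (m - 3) / (m - 3))"
  define k where "k = (\<lambda>s T \<theta>. B s T * A s (T * \<theta>) - B s (T * \<theta>) * A s (T * \<theta>))"
  have contA: "continuous_on (S \<times> {0..}) (\<lambda>(s, T). A s T)" for S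
    unfolding A_def case_prod_unfold using assms by (intro continuous_intros continuous_on_powr') auto
  have contB: "continuous_on (S \<times> {0..}) (\<lambda>(s, T). B s T)" for S
    unfolding B_def case_prod_unfold using assms by (intro continuous_intros continuous_on_powr') auto
  have k: "continuous_on (S \<times> {0..} \<times> {0..1}) (\<lambda>(s, T, \<theta>). k s T \<theta>)" for S
    unfolding k_def case_prod_unfold
    by (intro continuous_on_diff continuous_on_mult continuous_on_compose_pair[OF contA[of S]] continuous_on_compose_pair[OF contB[of S]];
        (intro continuous_intros)?) (auto simp: zero_le_mult_iff)
  obtain h r where hr: "continuous_on ({\<sigma>} \<times> {0..}) (\<lambda>(s, T). h s T)" "continuous_on ({\<sigma>} \<times> {0..}) (\<lambda>(s, T). r s T)"
    "h \<sigma> 0 = 1" and r0: "\<And>T. T \<ge> 0 \<Longrightarrow> r \<sigma> T = integral {0..1} (\<lambda>\<theta>. A \<sigma> (T * \<theta>) * h \<sigma> (T * \<theta>))"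
    and dh: "\<And>T. T > 0 \<Longrightarrow> (h \<sigma> has_real_derivative T powr (m - 4) * (T * r \<sigma> T)) (at T)"
    and dr: "\<And>T. T > 0 \<Longrightarrow> ((\<lambda>T. T * r \<sigma> T) has_real_derivative A \<sigma> T * h \<sigma> T) (at T)"
  proof (rule singular_initial_value_problem[OF _ k contA, where B=B and C="\<lambda>s T. B s T * A s T" and S="{\<sigma>}" and B' = "\<lambda>s T. T powr (m - 4)"])
    show "continuous_on ({\<sigma>} \<times> {0..}) (\<lambda>(s, T). B s T * A s T)"
      unfolding case_prod_unfold
      by (intro continuous_on_mult contA[unfolded case_prod_unfold] contB[unfolded case_prod_unfold])
    show "(B s has_real_derivative T powr (m - 4)) (at T)" if "T > 0" for s T
      unfolding B_def using that assms by (auto intro!: derivative_eq_intros)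
  qed (auto simp: k_def)
  have sec: "continuous_on {0..} (f \<sigma>)"
    if "continuous_on ({\<sigma>} \<times> {0..}) (\<lambda>(s, T). f s T)" for f :: "real \<Rightarrow> real \<Rightarrow> real"
    by (rule continuous_on_compose_pair[OF that, of _ "\<lambda>_. \<sigma>" "\<lambda>x. x"]) auto
  have "limit_solution m \<sigma> (h \<sigma>) (r \<sigma>)"
    unfolding limit_solution_def
  proof (intro conjI allI impI sec hr)
    show "r \<sigma> 0 = - \<sigma>" using r0[of 0] hr(3) assms by (simp add: A_def)
    fix t :: real assume t: "t > 0"
    have "t powr (m - 4) * t = t powr (m - 3)" using t powr_add[of t "m - 4" 1] by simp
    thus "(h \<sigma> has_real_derivative t powr (m - 3) * r \<sigma> t) (at t)"
      using dh[OF t] by (simp add: mult.assoc[symmetric])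
    show "((\<lambda>t. t * r \<sigma> t) has_real_derivative (t powr m - \<sigma>) * h \<sigma> t) (at t)"
      using dr[OF t] by (simp add: A_def)
  qed
  thus thesis by (rule that)
qed

text \<open>The flux starts from 0 and decreases as long as \<open>t powr m \<le> \<sigma>\<close>,
  so it can become positive only later.\<close>

lemma turning_power_gt:
  assumes "m > 3" "limit_solution m \<sigma> v r" "Z > 0" "\<And>t. t \<in> {0..Z} \<Longrightarrow> v t > 0" "r Z > 0"
  shows "Z powr m > \<sigma>"
proof (rule ccontr)
  assume neg: "\<not> Z powr m > \<sigma>"
  note L = limit_solutionD[OF assms(2)]
  have "Z * r Z \<le> 0 * r 0"
  proof (rule DERIV_nonpos_imp_decreasing_open[where f="\<lambda>t. t * r t"])
    fix t assume t: "0 < t" "t < Z"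
    have "t powr m \<le> Z powr m" using t assms by (intro powr_mono2) auto
    hence "(t powr m - \<sigma>) * v t \<le> 0"
      using neg assms(4)[of t] t by (intro mult_nonpos_nonneg) auto
    thus "\<exists>y. ((\<lambda>t. t * r t) has_real_derivative y) (at t) \<and> y \<le> 0" using L(6)[OF t(1)] by blast
  next
    show "continuous_on {0..Z} (\<lambda>t. t * r t)"
      by (intro continuous_intros continuous_on_subset[OF L(2)]) auto
  qed (use assms in auto)
  thus False using assms(3,5) by (simp add: mult_le_0_iff)
qed

text \<open>\<open>- g\<close> is a subsolution of the Riccati equation for flux divided by
  \<open>v\<close>. Positivity of \<open>F\<close> bounds the logarithmic derivative of
  \<open>v\<close> from below, which keeps \<open>v\<close> positive, and at 1 the value g = -2
  \<sigma> makes the flux positive. In F' the slope 2 \<sigma> of \<open>g\<close> at 0 pays for the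
  -\<sigma> of the potential and for g^2 t^(m-4) \<le> 16 \<sigma>^2 \<le> \<sigma>; the rest of g'
  is absorbed by t^m since \<open>4 * \<sigma> * (m + 1) \<le> 1\<close>.\<close>

lemma turning_small:
  assumes m: "m > 3" and \<sigma>: "0 < \<sigma>" "\<sigma> < 1 / 16" "4 * \<sigma> * (m + 1) \<le> 1"
  shows "turning m \<sigma>"
proof -
  obtain v r where vr: "limit_solution m \<sigma> v r" using limit_solution_exists[OF m] .
  note L = limit_solutionD[OF vr]
  define g where "g = (\<lambda>t. 2 * \<sigma> * t - 4 * \<sigma> * t powr (m + 1))"
  define F where "F = (\<lambda>t. t * r t + g t * v t)"
  \<comment> \<open>\<open>F\<close> vanishes at 0, but F / t has the limit \<sigma> > 0 there; this
    provides a starting point \<open>a > 0\<close>.\<close>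
  define q where "q = (\<lambda>t. r t + (2 * \<sigma> - 4 * \<sigma> * t powr m) * v t)"
  have F_q: "F t = t * q t" if "t > 0" for t
  proof -
    have "t powr (m + 1) = t powr m * t" using that powr_add[of t m 1] by simp
    thus ?thesis by (simp add: F_def q_def g_def algebra_simps)
  qed
  have cont_q: "continuous_on {0..} q"
    unfolding q_def using m by (intro continuous_intros L(1,2) continuous_on_powr') auto
  have "((\<lambda>t. min (q t) (v t)) \<longlongrightarrow> min (q 0) (v 0)) (at 0 within {0..})"
    using cont_q L(1) unfolding continuous_on_def by (intro tendsto_min) auto
  moreover have "min (q 0) (v 0) > 0" using \<sigma> L(3,4) m by (simp add: q_def)
  ultimately have "eventually (\<lambda>t. min (q t) (v t) > 0) (at 0 within {0..})"
    by (rule order_tendstoD(1))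
  then obtain d where d: "d > 0" "\<And>t. t \<ge> 0 \<Longrightarrow> t \<noteq> 0 \<Longrightarrow> dist t 0 < d \<Longrightarrow> q t > 0 \<and> v t > 0"
    unfolding eventually_at by auto
  define a where "a = min (d / 2) 1"
  have a: "0 < a" "a \<le> 1" "a < d" using d(1) by (auto simp: a_def min_def)
  have pos: "v b > 0 \<and> F b > 0" if b: "b \<in> {a..1}" for b
  proof -
    have g_der: "(g has_real_derivative 2 * \<sigma> - 4 * \<sigma> * (m + 1) * t powr m) (at t)" if "t > 0" for t
      unfolding g_def using that by (auto intro!: derivative_eq_intros)
    have dv: "(v has_real_derivative t powr (m - 4) * (F t - g t * v t)) (at t)" if "t > 0" for t
    proof -
      have "t powr (m - 3) = t powr (m - 4) * t" using that powr_add[of t "m - 4" 1] by simp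
      thus ?thesis using L(5)[OF that] by (simp add: F_def mult.assoc)
    qed
    have dF: "(F has_real_derivative (t powr m - \<sigma>) * v t + ((2 * \<sigma> - 4 * \<sigma> * (m + 1) * t powr m) * v t +
        g t * (t powr (m - 4) * (F t - g t * v t)))) (at t)" if "t > 0" for t
      unfolding F_def[abs_def] 
      by (rule DERIV_add[OF L(6)[OF that] DERIV_cong[OF DERIV_mult'[OF g_der[OF that] dv[OF that]]]])
         (simp add: F_def algebra_simps)
    have cg: "continuous_on {a..b} (\<lambda>t. g t * t powr (m - 4))"
      unfolding g_def using a by (intro continuous_intros continuous_on_powr) auto
    show "v b > 0 \<and> F b > 0"
    proof -
      have 1: "t powr (m - 4) * (F t - g t * v t) \<ge> - (g t * t powr (m - 4)) * v t" if "F t > 0" for t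
        using that by (simp add: algebra_simps)
      have 2: "(t powr m - \<sigma>) * v t + ((2 * \<sigma> - 4 * \<sigma> * (m + 1) * t powr m) * v t +
        g t * (t powr (m - 4) * (F t - g t * v t))) \<ge> g t * t powr (m - 4) * F t" 
        if t: "t \<in> {a..b}" and "v t > 0" for t
      proof -
        have t01: "0 < t" "t \<le> 1" using t b a by auto
        have "\<bar>2 * \<sigma> - 4 * \<sigma> * t powr m\<bar> \<le> 4 * \<sigma>"
        proof -
          have "t powr m \<le> 1" using t01 m powr_mono2[of m t 1] by simp
          hence "4 * \<sigma> * t powr m \<le> 4 * \<sigma> * 1" "0 \<le> 4 * \<sigma> * t powr m" using \<sigma> by (auto intro!: mult_left_mono)
          thus ?thesis unfolding abs_le_iff using \<sigma> by linarith
        qed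
        hence "(2 * \<sigma> - 4 * \<sigma> * t powr m)\<^sup>2 \<le> (4 * \<sigma>)\<^sup>2" by (intro abs_le_square_iff[THEN iffD1]) (use \<sigma> in simp)
        moreover have "t powr (m - 2) \<le> 1" using t01 m powr_mono2[of "m - 2" t 1] by simp
        ultimately have "(2 * \<sigma> - 4 * \<sigma> * t powr m)\<^sup>2 * t powr (m - 2) \<le> (4 * \<sigma>)\<^sup>2 * 1"
          by (intro mult_mono) auto
        also have "\<dots> = \<sigma> * (16 * \<sigma>)" by (simp add: power2_eq_square)
        also have "\<dots> \<le> \<sigma> * 1" using \<sigma> by (intro mult_left_mono) auto
        finally have b1: "(2 * \<sigma> - 4 * \<sigma> * t powr m)\<^sup>2 * t powr (m - 2) \<le> \<sigma>" by simp
        have "g t = t * (2 * \<sigma> - 4 * \<sigma> * t powr m)"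
          using t01 powr_add[of t m 1] by (simp add: g_def algebra_simps)
        hence "(g t)\<^sup>2 * t powr (m - 4) = (2 * \<sigma> - 4 * \<sigma> * t powr m)\<^sup>2 * (t powr 2 * t powr (m - 4))"
          using t01 by (simp add: power_mult_distrib)
        also have "t powr 2 * t powr (m - 4) = t powr (m - 2)"
          by (simp add: powr_add[symmetric])
        finally have b2: "(g t)\<^sup>2 * t powr (m - 4) \<le> \<sigma>" using b1 by simp
        have "4 * \<sigma> * (m + 1) * t powr m \<le> 1 * t powr m" using \<sigma> by (intro mult_right_mono) auto
        hence "0 \<le> t powr m - \<sigma> + (2 * \<sigma> - 4 * \<sigma> * (m + 1) * t powr m) - (g t)\<^sup>2 * t powr (m - 4)"
          using b2 by simp
        hence "0 \<le> (t powr m - \<sigma> + (2 * \<sigma> - 4 * \<sigma> * (m + 1) * t powr m) - (g t)\<^sup>2 * t powr (m - 4)) * v t"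
          using \<open>v t > 0\<close> by simp
        thus ?thesis by (simp add: algebra_simps power2_eq_square)
      qed
      have "v a > 0" "q a > 0" using d(2)[of a] a by (auto simp: dist_norm)
      hence a0: "v a > 0" "F a > 0" using F_q[of a] a by auto
      show ?thesis
        using linear_system_pos[where f = v and g = F and a = a and b = b and \<alpha> = "\<lambda>t. - (g t * t powr (m - 4))"
            and \<gamma> = "\<lambda>t. g t * t powr (m - 4)" and f' = "\<lambda>t. t powr (m - 4) * (F t - g t * v t)" 
            and g' = "\<lambda>t. (t powr m - \<sigma>) * v t + ((2 * \<sigma> - 4 * \<sigma> * (m + 1) * t powr m) * v t +
              g t * (t powr (m - 4) * (F t - g t * v t)))", OF _ continuous_on_minus[OF cg] cg dv dF 1 2 a0] a b
        by auto
    qed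
  qed
  have "v t > 0" if t01: "t \<in> {0..1}" for t
  proof -
    consider "t = 0" | "0 < t" "t < a" | "t \<in> {a..1}" using t01 by fastforce
    thus ?thesis using L(3) d(2)[of t] a pos by cases (auto simp: dist_norm)
  qed
  moreover have "r 1 > 0"
    using pos[of 1] a \<sigma> by (simp add: F_def g_def) (smt (verit) mult_pos_pos)
  ultimately show ?thesis unfolding turning_def using vr by (intro exI[of _ v] exI[of _ r] conjI exI[of _ 1]) auto
qed

text \<open>Sturm comparison on {1..2} with a sine in the variable \<open>R\<close>, a primitive of
  t^(m-4); it vanishes at 1 and 2 and is positive between. For \<sigma> > K the solution is still
  positive on this interval and the Wronskian \<open>W\<close> is nonincreasing, although
  \<open>W 1 < 0 < W 2\<close>. \<open>K\<close> collects upper bounds for t^m and \<omega>^2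
  t^(m-4).\<close>

lemma turning_bounded:
  assumes m: "m > 3"
  shows "\<exists>K. \<forall>\<sigma>. turning m \<sigma> \<longrightarrow> \<sigma> \<le> K"
proof -
  define R where "R = (\<lambda>t::real. t powr (m - 3) / (m - 3))"
  have R12: "R 1 < R 2" unfolding R_def using m powr_less_mono2[of "m - 3" 1 2] by (intro divide_strict_right_mono) auto
  define \<omega> where "\<omega> = pi / (R 2 - R 1)"
  have \<omega>: "\<omega> > 0" "\<omega> * (R 2 - R 1) = pi" using R12 by (auto simp: \<omega>_def)
  define K where "K = 2 powr m + \<omega>\<^sup>2 * 2 powr m"
  have "\<sigma> \<le> K" if tu: "turning m \<sigma>" for \<sigma>
  proof (rule ccontr)
    assume "\<not> \<sigma> \<le> K" hence \<sigma>: "\<sigma> > K" by simp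
    obtain v r Z where vr: "limit_solution m \<sigma> v r" and "Z > 0 \<and> (\<forall>t\<in>{0..Z}. v t > 0) \<and> r Z > 0"
      using tu unfolding turning_def by blast
    hence Z: "Z > 0" "\<And>t. t \<in> {0..Z} \<Longrightarrow> v t > 0" "r Z > 0" by auto
    note L = limit_solutionD[OF vr]
    have "2 powr m \<le> K" unfolding K_def by simp
    hence "Z > 2" using turning_power_gt[OF m vr Z] \<sigma> powr_mono2[of m Z 2] m Z(1) by force
    define ps where "ps = (\<lambda>t. sin (\<omega> * (R t - R 1)))"
    define ch where "ch = (\<lambda>t. \<omega> * cos (\<omega> * (R t - R 1)))"
    define W where "W = (\<lambda>t. t * r t * ps t - v t * ch t)"
    have dR: "(R has_real_derivative t powr (m - 4)) (at t)" if "t > 0" for t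
      unfolding R_def using that m by (auto intro!: derivative_eq_intros)
    have dps: "(ps has_real_derivative ch t * t powr (m - 4)) (at t)" if "t > 0" for t
      unfolding ps_def ch_def using dR[OF that] by (auto intro!: derivative_eq_intros)
    have dch: "(ch has_real_derivative - \<omega>\<^sup>2 * ps t * t powr (m - 4)) (at t)" if "t > 0" for t
      unfolding ps_def ch_def using dR[OF that] by (auto intro!: derivative_eq_intros simp: power2_eq_square)
    have dW: "(W has_real_derivative (t powr m - \<sigma> + \<omega>\<^sup>2 * t powr (m - 4)) * v t * ps t) (at t)" if t: "t > 0" for t
    proof -
      have "t powr (m - 3) = t powr (m - 4) * t" using that powr_add[of t "m - 4" 1] by simp
      thus ?thesis unfolding W_def
        by (intro DERIV_cong[OF DERIV_diff[OF DERIV_mult'[OF L(6)[OF t] dps[OF t]] DERIV_mult'[OF L(5)[OF t] dch[OF t]]]])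
           (simp add: algebra_simps)
    qed
    have "W 2 \<le> W 1"
    proof (rule DERIV_nonpos_imp_nonincreasing[where f = W])
      fix t :: real assume t: "1 \<le> t" "t \<le> 2"
      have "R 1 \<le> R t" "R t \<le> R 2" unfolding R_def using t m
        by (auto intro!: divide_right_mono powr_mono2 simp del: powr_one_eq_one)
      hence "0 \<le> \<omega> * (R t - R 1)" "\<omega> * (R t - R 1) \<le> \<omega> * (R 2 - R 1)" using \<omega>(1) by (auto intro!: mult_left_mono)
      hence ps: "ps t \<ge> 0" unfolding ps_def using \<omega>(2) by (intro sin_ge_zero) auto
      have "t powr (m - 4) \<le> t powr m" using t by (intro powr_mono) auto
      also have tm: "t powr m \<le> 2 powr m" using t m by (intro powr_mono2) auto
      finally have "\<omega>\<^sup>2 * t powr (m - 4) \<le> \<omega>\<^sup>2 * 2 powr m" by (intro mult_left_mono) auto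
      hence "t powr m - \<sigma> + \<omega>\<^sup>2 * t powr (m - 4) \<le> 0" using \<sigma> tm by (simp add: K_def)
      moreover have "v t > 0" using Z(2)[of t] t \<open>Z > 2\<close> by simp
      ultimately have "(t powr m - \<sigma> + \<omega>\<^sup>2 * t powr (m - 4)) * v t * ps t \<le> 0"
        using ps by (simp add: mult_nonpos_nonneg)
      thus "\<exists>y. (W has_real_derivative y) (at t) \<and> y \<le> 0" using dW[of t] t by force
    qed auto
    moreover have "W 1 < 0" using Z(2)[of 1] \<open>Z > 2\<close> \<omega> by (simp add: W_def ps_def ch_def)
    moreover have "W 2 > 0" using Z(2)[of 2] \<open>Z > 2\<close> \<omega> by (simp add: W_def ps_def ch_def)
    ultimately show False by simp
  qed
  thus ?thesis by blast
qed

text \<open>The Wronskian of the two solutions vanishes at 0 and has derivative (\<sigma>_2 -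
  \<sigma>_1) v_1 v_2 > 0, whereas positive nonincreasing solutions decay and force it to 0 at
  infinity.\<close>

lemma limit_ground_state_unique:
  assumes m: "m > 3" and "\<sigma>\<^sub>1 < \<sigma>\<^sub>2"
    and 1: "limit_solution m \<sigma>\<^sub>1 v\<^sub>1 r\<^sub>1" "\<And>t. t \<ge> 0 \<Longrightarrow> v\<^sub>1 t > 0" "\<And>t. t > 0 \<Longrightarrow> r\<^sub>1 t \<le> 0"
    and 2: "limit_solution m \<sigma>\<^sub>2 v\<^sub>2 r\<^sub>2" "\<And>t. t \<ge> 0 \<Longrightarrow> v\<^sub>2 t > 0" "\<And>t. t > 0 \<Longrightarrow> r\<^sub>2 t \<le> 0"
  shows False
proof -
  \<comment> \<open>Beyond \<open>t0\<close> the potential is at least 1, so the flux grows by at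
    least (t - t0) v(t); as it stays nonpositive, both it and this product are bounded by its size
    at \<open>t0\<close>.\<close>
  have decay: "\<exists>K t0. t0 > 0 \<and> K \<ge> 0 \<and> (\<forall>t>t0. \<bar>t * r t\<bar> \<le> K \<and> v t \<le> K / (t - t0))"
    if vr: "limit_solution m \<sigma> v r" and pos: "\<And>t. t \<ge> 0 \<Longrightarrow> v t > 0" and neg: "\<And>t. t > 0 \<Longrightarrow> r t \<le> 0"
    for \<sigma> v r
  proof -
    note L = limit_solutionD[OF vr]
    define t0 where "t0 = (\<bar>\<sigma>\<bar> + 1) powr (1 / m)"
    have t0: "t0 > 0" "t0 powr m = \<bar>\<sigma>\<bar> + 1" using m by (auto simp: t0_def powr_powr)
    have mono: "v t \<le> v s" if "0 < s" "s \<le> t" for s t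
    proof (rule DERIV_nonpos_imp_nonincreasing[OF that(2), where f = v])
      fix x assume "s \<le> x" "x \<le> t"
      hence x: "x > 0" using that by simp
      have "x powr (m - 3) * r x \<le> 0" using neg[OF x] by (intro mult_nonneg_nonpos) auto
      thus "\<exists>y. (v has_real_derivative y) (at x) \<and> y \<le> 0" using L(5)[OF x] by blast
    qed
    have key: "(t - t0) * v t \<le> t * r t - t0 * r t0" if t: "t > t0" for t
    proof -
      obtain z where z: "t0 < z" "z < t" "t * r t - t0 * r t0 = (t - t0) * ((z powr m - \<sigma>) * v z)"
        using MVT2[of t0 t "\<lambda>t. t * r t" "\<lambda>t. (t powr m - \<sigma>) * v t"] L(6) t t0 by auto
      have "t0 powr m \<le> z powr m" using z t0 m by (intro powr_mono2) auto
      hence "1 * v z \<le> (z powr m - \<sigma>) * v z" using t0 pos[of z] z by (intro mult_right_mono) auto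
      moreover have "v t \<le> v z" using mono z t0 by simp
      ultimately have "(t - t0) * v t \<le> (t - t0) * ((z powr m - \<sigma>) * v z)" using t by (intro mult_left_mono) auto
      thus ?thesis using z by simp
    qed
    show ?thesis
    proof (rule exI[of _ "- (t0 * r t0)"], rule exI[of _ t0], intro conjI allI impI)
      show "0 \<le> - (t0 * r t0)" using neg[OF t0(1)] t0 by (simp add: mult_le_0_iff)
      fix t assume t: "t0 < t"
      have "0 \<le> (t - t0) * v t" using t pos[of t] t0 by simp
      moreover have "t * r t \<le> 0" using neg[of t] t t0 by (simp add: mult_le_0_iff)
      ultimately show "\<bar>t * r t\<bar> \<le> - (t0 * r t0)" using key[OF t] by linarith
      have "(t - t0) * v t \<le> - (t0 * r t0)" using key[OF t] \<open>t * r t \<le> 0\<close> by linarith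
      thus "v t \<le> - (t0 * r t0) / (t - t0)" using t by (simp add: field_simps)
    qed (rule t0)
  qed
  obtain K1 a1 where d1: "a1 > 0" "K1 \<ge> 0" "\<And>t. t > a1 \<Longrightarrow> \<bar>t * r\<^sub>1 t\<bar> \<le> K1" "\<And>t. t > a1 \<Longrightarrow> v\<^sub>1 t \<le> K1 / (t - a1)"
    using decay[OF 1] by blast
  obtain K2 a2 where d2: "a2 > 0" "K2 \<ge> 0" "\<And>t. t > a2 \<Longrightarrow> \<bar>t * r\<^sub>2 t\<bar> \<le> K2" "\<And>t. t > a2 \<Longrightarrow> v\<^sub>2 t \<le> K2 / (t - a2)"
    using decay[OF 2] by blast
  note L1 = limit_solutionD[OF 1(1)] and L2 = limit_solutionD[OF 2(1)]
  define W where "W = (\<lambda>t. (t * r\<^sub>1 t) * v\<^sub>2 t - v\<^sub>1 t * (t * r\<^sub>2 t))"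
  have dW: "(W has_real_derivative (\<sigma>\<^sub>2 - \<sigma>\<^sub>1) * (v\<^sub>1 t * v\<^sub>2 t)) (at t)" if "t > 0" for t
    unfolding W_def
    by (intro DERIV_cong[OF DERIV_diff[OF DERIV_mult'[OF L1(6)[OF that] L2(5)[OF that]] DERIV_mult'[OF L1(5)[OF that] L2(6)[OF that]]]])
       (simp add: algebra_simps)
  have der: "\<exists>y. (W has_real_derivative y) (at t) \<and> 0 < y" if "t > 0" for t
    using that \<open>\<sigma>\<^sub>1 < \<sigma>\<^sub>2\<close> 1(2)[of t] 2(2)[of t] by (intro exI[of _ "(\<sigma>\<^sub>2 - \<sigma>\<^sub>1) * (v\<^sub>1 t * v\<^sub>2 t)"] conjI dW) auto
  have "W 0 < W 1"
    by (rule DERIV_pos_imp_increasing_open)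
       (use der in \<open>auto simp: W_def intro!: continuous_intros continuous_on_subset[OF L1(1)] continuous_on_subset[OF L1(2)]
          continuous_on_subset[OF L2(1)] continuous_on_subset[OF L2(2)]\<close>)
  hence W1: "W 1 > 0" by (simp add: W_def)
  have W_ge: "W t \<ge> W 1" if "t \<ge> 1" for t
    by (rule DERIV_nonneg_imp_nondecreasing[OF that, where f = W]) (meson der less_imp_le less_le_trans zero_less_one)
  \<comment> \<open>So far out that the decay bound 2 K1 K2 / (t - a) for the Wronskian falls below
    \<open>W 1\<close>.\<close>
  define t where "t = 1 + a1 + a2 + (2 * K1 * K2 + 1) / W 1"
  have pos: "(2 * K1 * K2 + 1) / W 1 > 0" using W1 d1(2) d2(2) by (intro divide_pos_pos add_nonneg_pos) auto
  have t: "t > 1" "t > a1" "t > a2" using pos d1 d2 by (auto simp: t_def)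
  define y where "y = (2 * K1 * K2 + 1) / W 1"
  have le: "K / (t - a) \<le> K / y" if "K \<ge> 0" "a = a1 \<or> a = a2" for K a
    using that pos d1(1) d2(1) unfolding y_def[symmetric] t_def by (intro divide_left_mono) auto
  have "\<bar>W t\<bar> \<le> \<bar>t * r\<^sub>1 t\<bar> * v\<^sub>2 t + v\<^sub>1 t * \<bar>t * r\<^sub>2 t\<bar>"
    using 1(2)[of t] 2(2)[of t] t unfolding W_def by (simp add: abs_mult abs_triangle_ineq4[THEN order_trans])
  also have "\<dots> \<le> K1 * (K2 / y) + K1 / y * K2"
    using d1(2) d1(3)[of t] d1(4)[of t] d2(2) d2(3)[of t] d2(4)[of t] t le[of K2 a2] le[of K1 a1] 1(2)[of t] 2(2)[of t]
    by (intro add_mono mult_mono) auto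
  also have "\<dots> = 2 * K1 * K2 / y" by simp
  also have "\<dots> < W 1" using pos W1 d1(2) d2(2) unfolding y_def by (simp add: divide_simps)
  finally show False using W_ge[of t] t by simp
qed

text \<open>If \<open>v\<close> never turns, its flux is nonpositive as long as \<open>v\<close> is
  positive, so \<open>v\<close> either reaches zero or stays positive forever. The second behaviour
  is possible for at most one parameter.\<close>

lemma vanishing_cases:
  assumes m: "m > 3" and "\<sigma>\<^sub>1 < \<sigma>\<^sub>2" "\<not> turning m \<sigma>\<^sub>1" "\<not> turning m \<sigma>\<^sub>2"
  shows "vanishing m \<sigma>\<^sub>1 \<or> vanishing m \<sigma>\<^sub>2"
proof -
  have *: "vanishing m \<sigma> \<or> (\<exists>v r. limit_solution m \<sigma> v r \<and> (\<forall>t\<ge>0. v t > 0) \<and> (\<forall>t>0. r t \<le> 0))"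
    if nt: "\<not> turning m \<sigma>" for \<sigma>
  proof -
    obtain v r where vr: "limit_solution m \<sigma> v r" using limit_solution_exists[OF m] .
    note L = limit_solutionD[OF vr]
    have r: "r t \<le> 0" if "t > 0" "\<And>s. s \<in> {0..t} \<Longrightarrow> v s > 0" for t
      using nt vr that unfolding turning_def by (meson not_le)
    show ?thesis
    proof (cases "\<forall>t\<ge>0. v t > 0")
      case True
      thus ?thesis using vr r by (intro disjI2 exI[of _ v] exI[of _ r]) auto
    next
      case False
      then obtain b where b: "b \<ge> 0" "v b \<le> 0" by (auto simp: not_less)
      have cv: "continuous_on {0..b} v" by (rule continuous_on_subset[OF L(1)]) auto
      have "v 0 > 0" using L(3) by simp
      obtain Z where Z: "0 < Z" "v Z = 0" "\<And>t. 0 \<le> t \<Longrightarrow> t < Z \<Longrightarrow> v t > 0"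
        using first_zero[OF cv b(1) \<open>v 0 > 0\<close> b(2)] by metis
      have pos: "v t > 0" if "t \<in> {0..<Z}" for t using Z(3) that by simp
      have "r t \<le> 0" if "t \<in> {0<..<Z}" for t
        using that pos by (intro r) auto
      thus ?thesis using vr Z pos unfolding vanishing_def by blast
    qed
  qed
  show ?thesis
    using *[OF assms(3)] *[OF assms(4)] limit_ground_state_unique[OF m assms(2)] by blast
qed

theorem limit_eigenvalue_exists:
  assumes m: "m > 3"
  obtains \<gamma> where "\<gamma> > 0"
    and "\<And>\<delta>. \<delta> > 0 \<Longrightarrow> \<exists>\<sigma>. 0 < \<sigma> \<and> \<gamma> - \<delta> < \<sigma> \<and> \<sigma> \<le> \<gamma> \<and> turning m \<sigma>"
    and "\<And>\<delta>. \<delta> > 0 \<Longrightarrow> \<exists>\<sigma>. \<gamma> < \<sigma> \<and> \<sigma> < \<gamma> + \<delta> \<and> vanishing m \<sigma>"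
proof -
  define X where "X = {\<sigma>. \<sigma> > 0 \<and> turning m \<sigma>}"
  have bdd: "bdd_above X" using turning_bounded[OF m] unfolding X_def bdd_above_def by auto
  define s0 where "s0 = min (1 / 32) (1 / (4 * (m + 1)))"
  have s0: "0 < s0" "s0 < 1 / 16" "4 * s0 * (m + 1) \<le> 1"
    using m by (auto simp: s0_def min_def field_simps)
  have "s0 \<in> X" unfolding X_def using turning_small[OF m s0] s0 by simp
  show thesis
  proof (rule that[of "Sup X"])
    show "Sup X > 0" using cSup_upper[OF \<open>s0 \<in> X\<close> bdd] s0 by simp
    fix \<delta> :: real assume \<delta>: "\<delta> > 0"
    have "Sup X - \<delta> < Sup X" using \<delta> by simp
    then obtain \<sigma> where "\<sigma> \<in> X" "Sup X - \<delta> < \<sigma>" using less_cSup_iff[of X] \<open>s0 \<in> X\<close> bdd by blast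
    thus "\<exists>\<sigma>. 0 < \<sigma> \<and> Sup X - \<delta> < \<sigma> \<and> \<sigma> \<le> Sup X \<and> turning m \<sigma>"
      using cSup_upper[OF _ bdd, of \<sigma>] by (auto simp: X_def)
    have nt: "\<not> turning m \<sigma>" if "\<sigma> > Sup X" for \<sigma>
    proof
      assume "turning m \<sigma>"
      moreover have "\<sigma> > 0" using that cSup_upper[OF \<open>s0 \<in> X\<close> bdd] s0 by simp
      ultimately have "\<sigma> \<in> X" by (simp add: X_def)
      thus False using cSup_upper[OF _ bdd] that by fastforce
    qed
    \<comment> \<open>Two trial parameters above the supremum, as one of them might be the
      exceptional parameter with a positive decaying solution.\<close>
    have "vanishing m (Sup X + \<delta> / 3) \<or> vanishing m (Sup X + \<delta> / 2)"
      using \<delta> by (intro vanishing_cases[OF m] nt) auto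
    thus "\<exists>\<sigma>. Sup X < \<sigma> \<and> \<sigma> < Sup X + \<delta> \<and> vanishing m \<sigma>"
    proof
      assume "vanishing m (Sup X + \<delta> / 3)"
      thus ?thesis using \<delta> by (intro exI[of _ "Sup X + \<delta> / 3"]) auto
    next
      assume "vanishing m (Sup X + \<delta> / 2)"
      thus ?thesis using \<delta> by (intro exI[of _ "Sup X + \<delta> / 2"]) auto
    qed
  qed
qed

section \<open>Travelling waves\<close>

lemma antiderivative_on_real_line:
  fixes f :: "real \<Rightarrow> real"
  assumes "\<And>t. isCont f t"
  obtains B where "\<And>t. (B has_real_derivative f t) (at t)"
  using einterval_antiderivative[of "-\<infinity>" "\<infinity>" f] assms
  by (auto simp: has_real_derivative_iff_has_vector_derivative)

section \<open>Regularity of the reaction term\<close>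

context
  fixes G :: "real \<Rightarrow> real" and \<theta> :: real
  assumes ign: "ignition G \<theta>"
begin

lemma ignition_has_derivative_within:
  assumes "x \<in> {0..1}"
  shows "(G has_real_derivative deriv01 G x) (at x within {0..1})"
proof -
  have "(deriv01 ^^ 0) G differentiable_on {0..1}"
    using ign unfolding ignition_def smooth01_def by blast
  hence "G differentiable (at x within {0..1})" using assms by (simp add: differentiable_on_def)
  thus ?thesis unfolding deriv01_def
    by (simp add: vector_derivative_works has_real_derivative_iff_has_vector_derivative)
qed

lemma ignition_has_derivative:
  assumes "0 < x" "x < 1"
  shows "(G has_real_derivative deriv01 G x) (at x)"
proof -
  have "at x within {0..1} = at x" using assms by (intro at_within_interior) auto
  thus ?thesis using ignition_has_derivative_within[of x] assms by simp
qed

lemma continuous_on_deriv01_ignition: "continuous_on {0..1} (deriv01 G)"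
proof -
  have "(deriv01 ^^ 1) G differentiable_on {0..1}"
    using ign unfolding ignition_def smooth01_def by blast
  thus ?thesis by (intro differentiable_imp_continuous_on) simp
qed

lemma continuous_on_ignition: "continuous_on {0..1} G"
  using ignition_has_derivative_within by (rule DERIV_continuous_on)

lemma deriv01_ignition_eq_0:
  assumes "0 < x" "x < \<theta>"
  shows "deriv01 G x = 0"
proof -
  have \<theta>: "\<theta> < 1" and G0: "\<forall>y\<in>{0..\<theta>}. G y = 0" using ign unfolding ignition_def by auto
  have "eventually (\<lambda>y. y \<in> {0<..<\<theta>}) (nhds x)" using assms by (intro eventually_nhds_in_open) auto
  hence "eventually (\<lambda>y. G y = 0) (nhds x)" by eventually_elim (use G0 in auto)
  hence "(G has_real_derivative 0) (at x)" by (subst DERIV_cong_ev[OF refl _ refl]) auto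
  thus ?thesis using ignition_has_derivative[of x] assms \<theta> DERIV_unique by fastforce
qed

lemma ignition_nonneg: "x \<in> {0..1} \<Longrightarrow> G x \<ge> 0"
  using ign unfolding ignition_def
  by (cases "x \<le> \<theta>"; cases "x = 1") (auto intro: less_imp_le)

text \<open>Makes the wave equation a linear second-order inequality for 1 - p, to which the
  uniqueness and gradient lemmas apply.\<close>

lemma ignition_lipschitz_at_1: "\<exists>L>0. \<forall>x\<in>{0..1}. \<bar>G x\<bar> \<le> L * (1 - x)"
proof -
  obtain L where L: "L > 0" "\<And>x. x \<in> {0..1} \<Longrightarrow> \<bar>deriv01 G x\<bar> \<le> L"
    using continuous_on_Icc_bounded[OF continuous_on_deriv01_ignition] by blast
  have "G 1 = 0" using ign unfolding ignition_def by auto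
  have "\<bar>G x\<bar> \<le> L * (1 - x)" if "x \<in> {0..1}" for x
    using field_differentiable_bound[of "{0..1}" G "deriv01 G" L x 1] ignition_has_derivative_within L(2) that \<open>G 1 = 0\<close>
    by auto
  thus ?thesis using L(1) by blast
qed

end

lemma two_term_bound:
  fixes K L y q :: real
  assumes "0 \<le> K" "0 \<le> L" "y \<le> 1"
  shows "K * \<bar>q\<bar> + L * (1 - y) \<le> (K + L) * (\<bar>1 - y\<bar> + \<bar>q\<bar>)"
proof -
  have "0 \<le> K * (1 - y) + L * \<bar>q\<bar>" using assms by simp
  also have "\<dots> = (K + L) * (\<bar>1 - y\<bar> + \<bar>q\<bar>) - (K * \<bar>q\<bar> + L * (1 - y))"
    using assms(3) by (simp add: algebra_simps)
  finally show ?thesis by simp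
qed

section \<open>Energy, positivity and monotonicity of the wave\<close>

locale wave =
  fixes m \<theta> \<epsilon> c :: real and G p :: "real \<Rightarrow> real"
  assumes m: "m > 3" and ign: "ignition G \<theta>" and \<epsilon>: "0 < \<epsilon>" "\<epsilon> < \<theta>"
    and tw: "travelling_wave m G \<epsilon> c p"
begin

abbreviation "n \<equiv> 1 / (m - 2)"
abbreviation "e \<equiv> \<epsilon> powr n"
abbreviation "p1 \<equiv> deriv p"
abbreviation "p2 \<equiv> deriv p1"

lemma \<theta>: "0 < \<theta>" "\<theta> < 1" using ign unfolding ignition_def by auto

lemma G_eq_0: "y \<in> {0..\<theta>} \<Longrightarrow> G y = 0" using ign unfolding ignition_def by auto

lemma c_pos: "c > 0" and p_range: "p x \<in> {0..1}" 
  and p_at_bot: "(p \<longlongrightarrow> \<epsilon>) at_bot" and p_at_top: "(p \<longlongrightarrow> 1) at_top"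
  using tw unfolding travelling_wave_def by blast+

lemma ode: "p x * p2 x = (c - p1 x / (m - 2)) * p1 x - G (p x)"
proof -
  have "- p x * p2 x + (c - p1 x / (m - 2)) * p1 x = G (p x)"
    using tw unfolding travelling_wave_def by blast
  thus ?thesis by linarith
qed

lemma n_pos: "n > 0" and n_mult: "n * (m - 2) = 1" using m by auto

lemma p_der: "(p has_real_derivative p1 x) (at x)" and p1_der: "(p1 has_real_derivative p2 x) (at x)"
  and p2_cont: "continuous_on UNIV p2"
  using tw unfolding travelling_wave_def C2_def differentiable_on_def
  by (auto simp: DERIV_deriv_iff_real_differentiable)

lemma p_cont: "continuous_on A p" and p1_cont: "continuous_on A p1"
  by (rule DERIV_at_imp_continuous_on, rule p_der, rule DERIV_at_imp_continuous_on, rule p1_der)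

text \<open>Multiplying the wave equation by p^(n-1) makes all but the reaction term exact. This is
  the resulting first integral: constant while G (p) = 0 and nonincreasing in general.\<close>

definition "energy x = p x powr n * (p1 x - c * (m - 2))"

lemma energy_der:
  assumes "p x > 0"
  shows "(energy has_real_derivative - (p x powr n / p x * G (p x))) (at x)"
proof -
  have "(energy has_real_derivative p x powr n * p2 x + p x powr n * (p1 x * n / p x) * (p1 x - c * (m - 2))) (at x)"
    unfolding energy_def[abs_def] using p_der p1_der assms
    by (auto intro!: derivative_eq_intros simp: powr_diff)
  moreover have "p x powr n * p2 x + p x powr n * (p1 x * n / p x) * (p1 x - c * (m - 2)) =
      p x powr n / p x * (p x * p2 x + n * (p1 x)\<^sup>2 - n * (m - 2) * c * p1 x)"
    using assms by (simp add: field_simps power2_eq_square)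
  moreover have "p x * p2 x + n * (p1 x)\<^sup>2 - n * (m - 2) * c * p1 x = - G (p x)"
    unfolding n_mult ode by (simp add: algebra_simps power2_eq_square)
  ultimately show ?thesis by simp
qed

lemma energy_cont: "continuous_on A energy"
  unfolding energy_def using p_range n_pos by (intro continuous_intros p_cont p1_cont continuous_on_powr') auto

lemma energy_antimono:
  assumes "x \<le> y" "\<And>t. t \<in> {x<..<y} \<Longrightarrow> p t > 0"
  shows "energy y \<le> energy x"
proof (rule DERIV_nonpos_imp_decreasing_open[OF assms(1) _ energy_cont])
  fix t assume "x < t" "t < y"
  hence "p t > 0" using assms(2) by auto
  moreover have "G (p t) \<ge> 0" using ignition_nonneg[OF ign p_range] .
  ultimately show "\<exists>d. (energy has_real_derivative d) (at t) \<and> d \<le> 0"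
    using energy_der[of t] by (intro exI[of _ "- (p t powr n / p t * G (p t))"]) auto
qed

text \<open>At a first zero of \<open>p\<close> the energy would be 0. It is negative at some point
  near -\<infinity>, where the slope lies below c (m - 2), and it does not increase up to that
  zero.\<close>

lemma p_pos: "p x > 0"
proof (rule ccontr)
  assume "\<not> p x > 0"
  hence x: "p x \<le> 0" by simp
  have "eventually (\<lambda>y. \<bar>p y - \<epsilon>\<bar> < min (\<epsilon> / 2) (c * (m - 2) / 3)) at_bot"
    using tendstoD[OF p_at_bot, of "min (\<epsilon> / 2) (c * (m - 2) / 3)"] \<epsilon> c_pos m by (simp add: dist_real_def)
  then obtain a where a: "\<And>y. y \<le> a \<Longrightarrow> \<bar>p y - \<epsilon>\<bar> < min (\<epsilon> / 2) (c * (m - 2) / 3)"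
    unfolding eventually_at_bot_linorder by blast
  have pa: "p y > 0" if "y \<le> a" for y using a[OF that] \<epsilon> by linarith
  obtain y where y: "a - 1 < y" "y < a" "p a - p (a - 1) = (a - (a - 1)) * p1 y"
    using MVT2[of "a - 1" a p p1] p_der by auto
  have "p1 y < c * (m - 2)" using y(3) a[of a] a[of "a - 1"] c_pos m by simp (smt (verit) mult_pos_pos)
  hence Ey: "energy y < 0" using pa[of y] y unfolding energy_def by (intro mult_pos_neg) auto
  have "a < x" using x pa[of x] by force
  define S where "S = {t\<in>{a..x}. p t \<le> 0}"
  have "compact S" unfolding S_def by (rule compact_Collect_le_Icc[OF p_cont])
  moreover have "x \<in> S" using x \<open>a < x\<close> by (auto simp: S_def)
  ultimately obtain x0 where x0: "x0 \<in> S" "\<And>t. t \<in> S \<Longrightarrow> x0 \<le> t"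
    using compact_attains_inf[of S] by auto
  have pos: "p t > 0" if "t < x0" for t
  proof (cases "t < a")
    case False
    thus ?thesis using that x0 unfolding S_def by (force simp: not_less[symmetric])
  qed (use pa in auto)
  have "p x0 = 0" using x0(1) p_range[of x0] by (auto simp: S_def)
  hence "energy x0 = 0" by (simp add: energy_def)
  moreover have "y \<le> x0" using y x0 by (auto simp: S_def)
  ultimately show False using energy_antimono[of y x0] pos Ey by auto
qed

lemma z_der: "((\<lambda>x. p x powr n) has_real_derivative p x powr n * (p1 x * n / p x)) (at x)"
  using p_der p_pos[of x] by (auto intro!: derivative_eq_intros simp: powr_diff)

lemma p2_abs: "\<bar>p2 t\<bar> = \<bar>1 / p t\<bar> * \<bar>(c - p1 t / (m - 2)) * p1 t - G (p t)\<bar>"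
  unfolding ode[symmetric] using p_pos[of t] by (simp add: abs_mult)

lemma energy_le: "x \<le> y \<Longrightarrow> energy y \<le> energy x"
  using energy_antimono p_pos by blast

text \<open>Convergence of p' at -\<infinity> is not yet known. A sequence from the mean value
  theorem on unit intervals suffices, since the energy is monotone.\<close>

lemma p1_sequence:
  obtains Y where "filterlim Y at_bot sequentially" "(\<lambda>i. p1 (Y i)) \<longlonglongrightarrow> 0"
proof -
  have "\<forall>i::nat. \<exists>y. - real i - 1 < y \<and> y < - real i \<and> p1 y = p (- real i) - p (- real i - 1)"
  proof
    fix i :: nat
    obtain y where "- real i - 1 < y" "y < - real i" "p (- real i) - p (- real i - 1) = (- real i - (- real i - 1)) * p1 y"
      using MVT2[of "- real i - 1" "- real i" p p1] p_der by auto
    thus "\<exists>y. - real i - 1 < y \<and> y < - real i \<and> p1 y = p (- real i) - p (- real i - 1)" by auto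
  qed
  then obtain Y where Y: "\<And>i. - real i - 1 < Y i \<and> Y i < - real i \<and> p1 (Y i) = p (- real i) - p (- real i - 1)"
    by metis
  have lim: "filterlim (\<lambda>i. - real i) at_bot sequentially"
    using filterlim_real_sequentially by (simp add: filterlim_uminus_at_top)
  show thesis
  proof (rule that)
    have mono: "filterlim f at_bot sequentially" if "\<And>i. f i \<le> - real i" for f :: "nat \<Rightarrow> real"
      unfolding filterlim_at_bot
    proof
      fix Z :: real
      have "eventually (\<lambda>i. - real i \<le> Z) sequentially" using lim by (simp only: filterlim_at_bot)
      thus "eventually (\<lambda>i. f i \<le> Z) sequentially" by eventually_elim (rule order_trans[OF that])
    qed
    show "filterlim Y at_bot sequentially"
      by (rule mono, rule less_imp_le) (use Y in simp)
    have lim': "filterlim (\<lambda>i. - real i - 1) at_bot sequentially"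
      by (rule mono) simp
    have "(\<lambda>i. p (- real i) - p (- real i - 1)) \<longlonglongrightarrow> \<epsilon> - \<epsilon>"
      by (intro tendsto_diff filterlim_compose[OF p_at_bot] lim lim')
    thus "(\<lambda>i. p1 (Y i)) \<longlonglongrightarrow> 0" using Y by simp
  qed
qed

lemma energy_sequence:
  obtains Y where "filterlim Y at_bot sequentially" "(\<lambda>i. energy (Y i)) \<longlonglongrightarrow> - (c * (m - 2) * e)"
proof -
  obtain Y where Y: "filterlim Y at_bot sequentially" "(\<lambda>i. p1 (Y i)) \<longlonglongrightarrow> 0" by (rule p1_sequence)
  have "(\<lambda>i. energy (Y i)) \<longlonglongrightarrow> e * (0 - c * (m - 2))"
    unfolding energy_def
    by (intro tendsto_intros Y filterlim_compose[OF p_at_bot Y(1)]) (use \<epsilon> in auto)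
  thus thesis using that Y by (simp add: mult.commute)
qed

lemma energy_upper: "energy x \<le> - (c * (m - 2) * e)"
proof -
  obtain Y where Y: "filterlim Y at_bot sequentially" "(\<lambda>i. energy (Y i)) \<longlonglongrightarrow> - (c * (m - 2) * e)" by (rule energy_sequence)
  have "eventually (\<lambda>i. Y i \<le> x) sequentially" using Y(1) by (simp add: filterlim_at_bot)
  hence "eventually (\<lambda>i. energy x \<le> energy (Y i)) sequentially" by eventually_elim (rule energy_le)
  thus ?thesis using tendsto_lowerbound[OF Y(2)] by simp
qed

text \<open>If p'(x) \<le> 0, monotonicity of the energy gives (p^n)' \<le> (c / p) (p^n - p(x)^n)
  to the right of x, so p never exceeds p(x) there and p(x) = 1 by the limit at +\<infinity>. Then p
  has a maximum at x, and uniqueness makes it equal to 1 on the whole left half line, against the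
  limit \<epsilon>.\<close>

lemma p1_pos: "p1 x > 0"
proof (rule ccontr)
  assume "\<not> p1 x > 0"
  hence x: "p1 x \<le> 0" by simp
  define f where "f = (\<lambda>t. p t powr n - p x powr n)"
  obtain B where B: "\<And>t. (B has_real_derivative c / p t) (at t)"
  proof -
    have "isCont (\<lambda>t. c / p t) t" for t
      using p_pos[of t] DERIV_isCont[OF p_der] by (intro continuous_intros) auto
    thus thesis using antiderivative_on_real_line that by blast
  qed
  have le: "p t \<le> p x" if t: "x \<le> t" for t
  proof -
    have "f t * exp (- B t) \<le> f x * exp (- B x)"
    proof (rule DERIV_nonpos_imp_nonincreasing[OF t, where f = "\<lambda>t. f t * exp (- B t)"])
      fix s assume s: "x \<le> s" "s \<le> t"
      have "energy s \<le> energy x" using energy_le s by simp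
      also have "\<dots> \<le> p x powr n * (- (c * (m - 2)))"
        unfolding energy_def using x by (intro mult_left_mono) auto
      finally have "p s powr n * p1 s \<le> c * (m - 2) * f s" by (simp add: energy_def f_def algebra_simps)
      hence "n * (p s powr n * p1 s) \<le> n * (c * (m - 2) * f s)" using n_pos by (intro mult_left_mono) auto
      also have "\<dots> = c * f s" using m by simp
      finally have "n * (p s powr n * p1 s) / p s \<le> c * f s / p s" using p_pos[of s] by (intro divide_right_mono) auto
      hence "(p s powr n * (p1 s * n / p s) - c / p s * f s) * exp (- B s) \<le> 0"
        by (intro mult_nonpos_nonneg) (auto simp: algebra_simps)
      moreover have "((\<lambda>t. f t * exp (- B t)) has_real_derivative (p s powr n * (p1 s * n / p s) - c / p s * f s) * exp (- B s)) (at s)"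
      proof -
        have "(f has_real_derivative p s powr n * (p1 s * n / p s)) (at s)"
          unfolding f_def using DERIV_diff[OF z_der[of s] DERIV_const] by simp
        moreover have "((\<lambda>t. exp (- B t)) has_real_derivative exp (- B s) * - (c / p s)) (at s)"
          using B by (auto intro!: derivative_eq_intros)
        ultimately show ?thesis
          by (rule DERIV_cong[OF DERIV_mult']) (simp add: left_diff_distrib right_diff_distrib mult_ac)
      qed
      ultimately show "\<exists>y. ((\<lambda>t. f t * exp (- B t)) has_real_derivative y) (at s) \<and> y \<le> 0" by blast
    qed
    hence "f t * exp (- B t) \<le> 0" by (simp add: f_def)
    hence "f t \<le> 0" by (simp add: mult_le_0_iff)
    hence "p t powr n \<le> p x powr n" by (simp add: f_def)
    thus ?thesis using powr_less_mono2[of n "p x" "p t"] n_pos p_pos[of x] by force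
  qed
  have "1 \<le> p x"
    by (rule tendsto_upperbound[OF p_at_top]) (use le in \<open>auto intro: eventually_mono[OF eventually_ge_at_top[of x]]\<close>)
  hence px: "p x = 1" using p_range[of x] by simp
  have "p1 x = 0"
    by (rule DERIV_local_max[OF p_der[of x], of 1]) (use px p_range in auto)
  have "p y = 1" if "y \<le> x" for y
  proof -
    obtain K where K: "K > 0" "\<And>t. t \<in> {y..x} \<Longrightarrow> \<bar>c - p1 t / (m - 2)\<bar> \<le> K"
    proof -
      have "continuous_on {y..x} (\<lambda>t. c - p1 t / (m - 2))"
        using m by (intro continuous_intros p1_cont) auto
      thus thesis using continuous_on_Icc_bounded that by blast
    qed
    obtain D where D: "D > 0" "\<And>t. t \<in> {y..x} \<Longrightarrow> \<bar>1 / p t\<bar> \<le> D"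
    proof -
      have "continuous_on {y..x} (\<lambda>t. 1 / p t)" using p_pos by (intro continuous_intros p_cont) (auto simp: less_imp_neq[symmetric])
      thus thesis using continuous_on_Icc_bounded that by blast
    qed
    obtain L where L: "L > 0" "\<forall>x\<in>{0..1}. \<bar>G x\<bar> \<le> L * (1 - x)" using ignition_lipschitz_at_1[OF ign] by blast
    have "1 - p y = 0"
    proof (rule second_order_uniqueness[where f = "\<lambda>t. 1 - p t" and ?f1.0 = "\<lambda>t. - p1 t" and ?f2.0 = "\<lambda>t. - p2 t" and a = y and b = x 
          and K = "D * (K + L)" and ?x0.0 = x])
      fix t assume t: "t \<in> {y..x}"
      have "\<bar>p2 t\<bar> = \<bar>1 / p t\<bar> * \<bar>(c - p1 t / (m - 2)) * p1 t - G (p t)\<bar>"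
        by (rule p2_abs)
      also have "\<dots> \<le> D * (K * \<bar>p1 t\<bar> + L * (1 - p t))"
      proof (intro mult_mono D t)
        have "\<bar>(c - p1 t / (m - 2)) * p1 t\<bar> \<le> K * \<bar>p1 t\<bar>" unfolding abs_mult using K(2)[OF t] by (intro mult_right_mono) auto
        thus "\<bar>(c - p1 t / (m - 2)) * p1 t - G (p t)\<bar> \<le> K * \<bar>p1 t\<bar> + L * (1 - p t)"
          using L(2)[rule_format, OF p_range[of t]] by linarith
      qed (use D in auto)
      also have "\<dots> \<le> D * (K + L) * (\<bar>1 - p t\<bar> + \<bar>p1 t\<bar>)"
        unfolding mult.assoc using K(1) L(1) D(1) p_range[of t] by (intro mult_left_mono two_term_bound) auto
      finally show "\<bar>- p2 t\<bar> \<le> D * (K + L) * (\<bar>1 - p t\<bar> + \<bar>- p1 t\<bar>)" by simp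
    qed (use that px \<open>p1 x = 0\<close> p_der p1_der in \<open>auto intro!: derivative_eq_intros\<close>)
    thus ?thesis by simp
  qed
  hence "eventually (\<lambda>y. p y = 1) at_bot" using eventually_le_at_bot[of x] by (rule eventually_mono[rotated])
  hence "(p \<longlongrightarrow> 1) at_bot" using tendsto_cong[of p "\<lambda>_. 1" at_bot] by auto
  thus False using tendsto_unique[OF _ p_at_bot] \<epsilon> \<theta> by fastforce
qed

lemma p_strict_mono: "x < y \<Longrightarrow> p x < p y"
  using DERIV_pos_imp_increasing[of x y p] p_der p1_pos by blast

lemma p_mono: "x \<le> y \<Longrightarrow> p x \<le> p y"
  using p_strict_mono[of x y] by (cases "x = y") auto

lemma p_gt: "p x > \<epsilon>"
  using DERIV_pos_imp_increasing_at_bot[OF _ p_at_bot, of x] p_der p1_pos by blast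

lemma p_less_1: "p x < 1"
  using p_strict_mono[of x "x + 1"] p_range[of "x + 1"] by simp

lemma z_gt: "p x powr n > e"
  using p_gt[of x] \<epsilon> n_pos by (intro powr_less_mono2) auto

lemma e_pos: "e > 0" using \<epsilon> by simp

lemma p1_upper: "p x powr n * p1 x \<le> c * (m - 2) * (p x powr n - e)"
  using energy_upper[of x] unfolding energy_def by (simp add: algebra_simps)

lemma p1_less: "p1 x < c * (m - 2)"
proof -
  have "p x powr n * p1 x < p x powr n * (c * (m - 2))"
    using p1_upper[of x] mult_pos_pos[OF mult_pos_pos[OF c_pos, of "m - 2"] e_pos] m by (simp add: algebra_simps)
  thus ?thesis using p_pos[of x] by simp
qed

text \<open>Below the ignition temperature the energy is constant back to -\<infinity>. The wave
  thus obeys an explicit first-order equation there, from which all information on its tail is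
  drawn.\<close>

lemma p1_eq:
  assumes "p x \<le> \<theta>"
  shows "p x powr n * p1 x = c * (m - 2) * (p x powr n - e)"
proof -
  have const: "energy x = energy y" if "y \<le> x" for y
  proof (cases "y = x")
    case False
    hence "y < x" using that by simp
    show ?thesis
    proof (rule DERIV_isconst_end[OF \<open>y < x\<close> energy_cont])
      fix t assume "y < t" "t < x"
      hence "p t \<le> \<theta>" using p_mono[of t x] assms by simp
      hence "G (p t) = 0" using p_pos[of t] by (intro G_eq_0) auto
      thus "(energy has_real_derivative 0) (at t)" using energy_der[OF p_pos[of t]] by simp
    qed
  qed simp
  obtain Y where Y: "filterlim Y at_bot sequentially" "(\<lambda>i. energy (Y i)) \<longlonglongrightarrow> - (c * (m - 2) * e)" by (rule energy_sequence)
  have "eventually (\<lambda>i. Y i \<le> x) sequentially" using Y(1) by (simp add: filterlim_at_bot)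
  hence "eventually (\<lambda>i. energy (Y i) = energy x) sequentially" by eventually_elim (use const in auto)
  hence "(\<lambda>i. energy (Y i)) \<longlonglongrightarrow> energy x" by (rule tendsto_eventually)
  hence "energy x = - (c * (m - 2) * e)" using LIMSEQ_unique[OF Y(2)] by simp
  thus ?thesis unfolding energy_def by (simp add: algebra_simps)
qed

lemma p_le_\<theta>_at_bot: obtains x0 where "\<And>x. x \<le> x0 \<Longrightarrow> p x < \<theta>"
  using order_tendstoD(2)[OF p_at_bot \<epsilon>(2)] unfolding eventually_at_bot_linorder by blast

lemma p2_bound:
  obtains K where "K > 0" "\<And>x. \<bar>p2 x\<bar> \<le> K * (\<bar>1 - p x\<bar> + \<bar>p1 x\<bar>)"
proof -
  obtain L where L: "L > 0" "\<forall>x\<in>{0..1}. \<bar>G x\<bar> \<le> L * (1 - x)" using ignition_lipschitz_at_1[OF ign] by blast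
  have "\<bar>p2 t\<bar> \<le> (c + L) / \<epsilon> * (\<bar>1 - p t\<bar> + \<bar>p1 t\<bar>)" for t
  proof -
    have "\<bar>p2 t\<bar> = \<bar>1 / p t\<bar> * \<bar>(c - p1 t / (m - 2)) * p1 t - G (p t)\<bar>"
      by (rule p2_abs)
    also have "\<dots> \<le> 1 / \<epsilon> * (c * \<bar>p1 t\<bar> + L * (1 - p t))"
    proof (intro mult_mono)
      have "p1 t / (m - 2) < c" using p1_less[of t] m by (simp add: field_simps)
      moreover have "p1 t / (m - 2) > 0" using p1_pos[of t] m by simp
      ultimately have "\<bar>c - p1 t / (m - 2)\<bar> \<le> c" by simp
      hence "\<bar>(c - p1 t / (m - 2)) * p1 t\<bar> \<le> c * \<bar>p1 t\<bar>" unfolding abs_mult by (intro mult_right_mono) auto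
      thus "\<bar>(c - p1 t / (m - 2)) * p1 t - G (p t)\<bar> \<le> c * \<bar>p1 t\<bar> + L * (1 - p t)"
        using L(2)[rule_format, OF p_range[of t]] by linarith
      show "\<bar>1 / p t\<bar> \<le> 1 / \<epsilon>" using p_gt[of t] \<epsilon> p_pos[of t] by (simp add: frac_le)
    qed (use \<epsilon> in auto)
    also have "\<dots> \<le> 1 / \<epsilon> * ((c + L) * (\<bar>1 - p t\<bar> + \<bar>p1 t\<bar>))"
      using c_pos L(1) \<epsilon> p_range[of t] by (intro mult_left_mono two_term_bound) auto
    finally show ?thesis by simp
  qed
  thus thesis using that[of "(c + L) / \<epsilon>"] c_pos L \<epsilon> by simp
qed

text \<open>The gradient bound for 1 - p, whose supremum on the right of x is attained at x by
  monotonicity, dominates p' by a multiple of 1 - p.\<close>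

lemma p1_at_top: "(p1 \<longlongrightarrow> 0) at_top"
proof -
  obtain K where K: "K > 0" "\<And>x. \<bar>p2 x\<bar> \<le> K * (\<bar>1 - p x\<bar> + \<bar>p1 x\<bar>)" using p2_bound by blast
  define h where "h = 1 / (2 * K)"
  have h: "h > 0" "K * h \<le> 1 / 2" using K(1) by (auto simp: h_def)
  have bound: "\<bar>p1 x\<bar> \<le> (4 / h + 1) * (1 - p x)" for x
  proof -
    have "\<bar>- p1 x\<bar> \<le> (4 / h + 1) * (1 - p x)"
    proof (rule second_order_gradient_bound[where a = x and h = h and K = K and f = "\<lambda>t. 1 - p t" 
          and ?f1.0 = "\<lambda>t. - p1 t" and ?f2.0 = "\<lambda>t. - p2 t" and x = x])
      fix t assume "t \<in> {x..x+h}"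
      hence "p x \<le> p t" by (intro p_mono) auto
      thus "\<bar>1 - p t\<bar> \<le> 1 - p x" using p_less_1[of t] by simp
    qed (use h K p_der p1_der in \<open>auto intro!: derivative_eq_intros\<close>)
    thus ?thesis by simp
  qed
  have "((\<lambda>x. (4 / h + 1) * (1 - p x)) \<longlongrightarrow> (4 / h + 1) * (1 - 1)) at_top"
    by (intro tendsto_intros p_at_top)
  hence "((\<lambda>x. (4 / h + 1) * (1 - p x)) \<longlongrightarrow> 0) at_top" by simp
  thus ?thesis by (rule Lim_null_comparison[rotated]) (use bound in auto)
qed

lemma p1_at_bot: "(p1 \<longlongrightarrow> 0) at_bot"
proof -
  obtain x0 where x0: "\<And>x. x \<le> x0 \<Longrightarrow> p x < \<theta>" by (rule p_le_\<theta>_at_bot) blast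
  have ev: "eventually (\<lambda>x. c * (m - 2) * (p x powr n - e) / p x powr n = p1 x) at_bot"
    using eventually_le_at_bot[of x0]
  proof eventually_elim
    case (elim x)
    thus ?case using p1_eq[of x] x0[of x] p_pos[of x] by (simp add: field_simps)
  qed
  have "((\<lambda>x. c * (m - 2) * (p x powr n - e) / p x powr n) \<longlongrightarrow> c * (m - 2) * (e - e) / e) at_bot"
    using e_pos \<epsilon> by (intro tendsto_intros p_at_bot) auto
  hence "((\<lambda>x. c * (m - 2) * (p x powr n - e) / p x powr n) \<longlongrightarrow> 0) at_bot" by simp
  thus ?thesis using tendsto_cong[OF ev] by simp
qed

section \<open>Sturm theory for the linearised equation\<close>

definition "drift x = (c - 2 * p1 x / (m - 2)) / p x"
definition "pot k s x = (k\<^sup>2 * p x powr (m / (m - 2)) - p2 x - deriv01 G (p x) - s) / p x"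

definition "solves k s u \<longleftrightarrow> (\<forall>x. (u has_real_derivative deriv u x) (at x) \<and>
   (deriv u has_real_derivative drift x * deriv u x + pot k s x * u x) (at x))"

abbreviation "radicand k s \<equiv> c\<^sup>2 + 4 * \<epsilon> * (k\<^sup>2 * \<epsilon> powr (m / (m - 2)) - s)"

lemma solvesD:
  assumes "solves k s u"
  shows "(u has_real_derivative deriv u x) (at x)"
    and "(deriv u has_real_derivative drift x * deriv u x + pot k s x * u x) (at x)"
  using assms unfolding solves_def by auto

lemma G'_cont: "continuous_on UNIV (\<lambda>x. deriv01 G (p x))"
  by (rule continuous_on_compose2[OF continuous_on_deriv01_ignition[OF ign] p_cont]) (use p_range in auto)

lemma drift_cont: "continuous_on UNIV drift"
  unfolding drift_def[abs_def] using p_pos m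
  by (intro continuous_intros p_cont p1_cont) (auto simp: less_imp_neq[THEN not_sym])

lemma pot_cont: "continuous_on UNIV (pot k s)"
  unfolding pot_def[abs_def] using p_pos m
  by (intro continuous_intros p_cont p2_cont G'_cont continuous_on_powr) (auto simp: less_imp_neq[THEN not_sym])

lemma drift_upper: "drift x \<le> c / \<epsilon>"
proof -
  have "drift x \<le> c / p x" unfolding drift_def using p_pos[of x] p1_pos[of x] m by (intro divide_right_mono) auto
  also have "\<dots> \<le> c / \<epsilon>" using p_gt[of x] c_pos \<epsilon> by (intro divide_left_mono) auto
  finally show ?thesis .
qed

lemma drift_bound: "\<bar>drift x\<bar> \<le> c / \<epsilon>"
proof -
  have "2 * p1 x / (m - 2) \<le> 2 * c" using p1_less[of x] m by (simp add: field_simps)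
  hence "- c / p x \<le> drift x"
    unfolding drift_def using p_pos[of x] by (intro divide_right_mono) auto
  moreover have "c / p x \<le> c / \<epsilon>" using p_gt[of x] c_pos \<epsilon> by (intro divide_left_mono) auto
  ultimately show ?thesis using drift_upper[of x] by linarith
qed

lemma pot_bounded: obtains K where "K > 0" "\<And>x. \<bar>pot k s x\<bar> \<le> K"
proof -
  obtain A where A: "A > 0" "\<And>x. \<bar>p2 x\<bar> \<le> A * (\<bar>1 - p x\<bar> + \<bar>p1 x\<bar>)" using p2_bound by blast
  obtain L where L: "L > 0" "\<And>x. x \<in> {0..1} \<Longrightarrow> \<bar>deriv01 G x\<bar> \<le> L"
    using continuous_on_Icc_bounded[OF continuous_on_deriv01_ignition[OF ign]] by blast
  define K where "K = (k\<^sup>2 + A * (1 + c * (m - 2)) + L + \<bar>s\<bar>) / \<epsilon>"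
  have "\<bar>pot k s x\<bar> \<le> K" for x
  proof -
    have "p x powr (m / (m - 2)) \<le> 1" using p_pos[of x] p_less_1[of x] m by (intro powr_le1) auto
    hence a: "k\<^sup>2 * p x powr (m / (m - 2)) \<le> k\<^sup>2" by (intro mult_left_le) auto
    have "\<bar>1 - p x\<bar> + \<bar>p1 x\<bar> \<le> 1 + c * (m - 2)" using p_pos[of x] p_less_1[of x] p1_pos[of x] p1_less[of x] by simp
    hence "A * (\<bar>1 - p x\<bar> + \<bar>p1 x\<bar>) \<le> A * (1 + c * (m - 2))" using A by (intro mult_left_mono) auto
    hence b: "\<bar>p2 x\<bar> \<le> A * (1 + c * (m - 2))" using A(2)[of x] by linarith
    have "\<bar>k\<^sup>2 * p x powr (m / (m - 2)) - p2 x - deriv01 G (p x) - s\<bar> \<le> k\<^sup>2 + A * (1 + c * (m - 2)) + L + \<bar>s\<bar>"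
    proof -
      have "0 \<le> k\<^sup>2 * p x powr (m / (m - 2))" by simp
      thus ?thesis using a b L(2)[OF p_range[of x]] by linarith
    qed
    hence "\<bar>pot k s x\<bar> \<le> (k\<^sup>2 + A * (1 + c * (m - 2)) + L + \<bar>s\<bar>) / p x"
      unfolding pot_def abs_divide using p_pos[of x] by (simp add: divide_right_mono)
    also have "\<dots> \<le> K" unfolding K_def using p_gt[of x] \<epsilon> A(1) L(1) c_pos m
      by (intro divide_left_mono add_nonneg_nonneg mult_nonneg_nonneg) auto
    finally show ?thesis .
  qed
  moreover have "K > 0" unfolding K_def using \<epsilon> A(1) L(1) c_pos m
    by (intro divide_pos_pos add_pos_nonneg add_nonneg_pos mult_nonneg_nonneg) auto
  ultimately show thesis using that by blast
qed

lemma eigenspace_iff: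
  "u \<in> eigenspace m G \<epsilon> k c p s \<longleftrightarrow> solves k s u \<and> (u \<longlongrightarrow> 0) at_bot \<and> (u \<longlongrightarrow> 0) at_top \<and> maximal_decay m \<epsilon> k c s u"
proof -
  have eq: "(- p x * u2 + (c - 2 * p1 x / (m - 2)) * u1
                + (k\<^sup>2 * p x powr (m / (m - 2)) - p2 x - deriv01 G (p x)) * u x = s * u x) \<longleftrightarrow>
     u2 = drift x * u1 + pot k s x * u x" for u u1 u2 x
  proof -
    have E: "drift x * u1 + pot k s x * u x = 
      ((c - 2 * p1 x / (m - 2)) * u1 + (k\<^sup>2 * p x powr (m / (m - 2)) - p2 x - deriv01 G (p x) - s) * u x) / p x"
      unfolding drift_def pot_def by (simp add: add_divide_distrib)
    show ?thesis unfolding E using p_pos[of x] by (auto simp: eq_divide_eq algebra_simps)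
  qed
  have "C2 u \<and> (\<forall>x. deriv (deriv u) x = drift x * deriv u x + pot k s x * u x) \<longleftrightarrow> solves k s u"
  proof
    assume *: "C2 u \<and> (\<forall>x. deriv (deriv u) x = drift x * deriv u x + pot k s x * u x)"
    thus "solves k s u" unfolding solves_def C2_def differentiable_on_def
      by (metis DERIV_deriv_iff_real_differentiable UNIV_I)
  next
    assume *: "solves k s u"
    note D = solvesD[OF *]
    have d2: "deriv (deriv u) = (\<lambda>x. drift x * deriv u x + pot k s x * u x)"
      using D(2) by (intro ext DERIV_imp_deriv)
    have "continuous_on UNIV (deriv (deriv u))" unfolding d2
      by (intro continuous_intros drift_cont pot_cont DERIV_at_imp_continuous_on[OF D(1)] DERIV_at_imp_continuous_on[OF D(2)])
    moreover have "u differentiable_on UNIV" "deriv u differentiable_on UNIV"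
      unfolding differentiable_on_def using D real_differentiable_def by blast+
    ultimately show "C2 u \<and> (\<forall>x. deriv (deriv u) x = drift x * deriv u x + pot k s x * u x)"
      unfolding C2_def by (simp add: d2)
  qed
  thus ?thesis unfolding eigenspace_def mem_Collect_eq eq by blast
qed

lemma solves_second_derivative_bound:
  obtains K where "K > 0" "\<And>u x. \<bar>drift x * deriv u x + pot k s x * u x\<bar> \<le> K * (\<bar>u x\<bar> + \<bar>deriv u x\<bar>)"
proof -
  obtain K where K: "K > 0" "\<And>x. \<bar>pot k s x\<bar> \<le> K" using pot_bounded by blast
  define D where "D = c / \<epsilon> + K"
  have D: "D > 0" "c / \<epsilon> \<le> D" "K \<le> D" using K(1) c_pos \<epsilon> by (auto simp: D_def add_pos_pos)
  have "\<bar>drift x * deriv u x + pot k s x * u x\<bar> \<le> D * (\<bar>u x\<bar> + \<bar>deriv u x\<bar>)" for u x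
  proof -
    have "\<bar>drift x * deriv u x + pot k s x * u x\<bar> \<le> \<bar>drift x\<bar> * \<bar>deriv u x\<bar> + \<bar>pot k s x\<bar> * \<bar>u x\<bar>"
      by (metis abs_mult abs_triangle_ineq)
    also have "\<dots> \<le> D * \<bar>deriv u x\<bar> + D * \<bar>u x\<bar>"
      using drift_bound[of x] K(2)[of x] D by (intro add_mono mult_right_mono) auto
    finally show ?thesis by (simp add: algebra_simps)
  qed
  thus thesis using that[of D] D(1) by simp
qed

text \<open>\<open>M\<close> and \<open>h\<close> depend neither on the solution nor on the
  interval, so decay of a solution at either end passes to its derivative.\<close>

lemma solves_gradient:
  obtains M h where "M > 0" "h > 0"
    "\<And>u a x S. solves k s u \<Longrightarrow> (\<And>y. y \<in> {a..a+h} \<Longrightarrow> \<bar>u y\<bar> \<le> S) \<Longrightarrow> x \<in> {a..a+h} \<Longrightarrow> \<bar>deriv u x\<bar> \<le> M * S"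
proof -
  obtain D where D: "D > 0" "\<And>u x. \<bar>drift x * deriv u x + pot k s x * u x\<bar> \<le> D * (\<bar>u x\<bar> + \<bar>deriv u x\<bar>)"
    using solves_second_derivative_bound[of k s] by blast
  define h where "h = 1 / (2 * D)"
  have h: "h > 0" "D * h \<le> 1 / 2" using D(1) by (auto simp: h_def)
  have "\<bar>deriv u x\<bar> \<le> (4 / h + 1) * S"
    if u: "solves k s u" "\<And>y. y \<in> {a..a+h} \<Longrightarrow> \<bar>u y\<bar> \<le> S" "x \<in> {a..a+h}" for u a x S
    by (rule second_order_gradient_bound[where f = u and ?f1.0 = "deriv u" and ?f2.0 = "\<lambda>x. drift x * deriv u x + pot k s x * u x"
        and a = a and h = h and K = D and x = x]) (use u h D solvesD[OF u(1)] in auto)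
  moreover have "4 / h + 1 > 0" using h by (simp add: add_pos_pos)
  ultimately show thesis using that[of "4 / h + 1" h] h by blast
qed

lemma solves_deriv_at_top:
  assumes u: "solves k s u" "(u \<longlongrightarrow> 0) at_top"
  shows "(deriv u \<longlongrightarrow> 0) at_top"
proof (rule tendstoI)
  fix d :: real assume d: "d > 0"
  obtain M h where Mh: "M > 0" "h > 0" 
    "\<And>u a x S. solves k s u \<Longrightarrow> (\<And>y. y \<in> {a..a+h} \<Longrightarrow> \<bar>u y\<bar> \<le> S) \<Longrightarrow> x \<in> {a..a+h} \<Longrightarrow> \<bar>deriv u x\<bar> \<le> M * S"
    using solves_gradient[of k s] by metis
  have "eventually (\<lambda>x. \<bar>u x\<bar> < d / (2 * M)) at_top"
    using tendstoD[OF u(2), of "d / (2 * M)"] d Mh(1) by (simp add: dist_real_def)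
  then obtain x0 where x0: "\<And>x. x \<ge> x0 \<Longrightarrow> \<bar>u x\<bar> < d / (2 * M)" unfolding eventually_at_top_linorder by blast
  have "\<bar>deriv u x\<bar> < d" if "x \<ge> x0" for x
  proof -
    have "\<bar>deriv u x\<bar> \<le> M * (d / (2 * M))"
      by (rule Mh(3)[OF u(1), of x]) (use x0 that Mh(2) in \<open>auto intro!: less_imp_le\<close>)
    thus ?thesis using Mh(1) d by simp
  qed
  thus "eventually (\<lambda>x. dist (deriv u x) 0 < d) at_top"
    using eventually_at_top_linorder by (auto simp: dist_real_def)
qed

lemma solves_deriv_at_bot:
  assumes u: "solves k s u" and bd: "\<And>x. x \<le> x0 \<Longrightarrow> \<bar>u x\<bar> \<le> C * exp (R * x)" and "R \<ge> 0" "C \<ge> 0"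
  obtains C' where "C' \<ge> 0" "\<And>x. x \<le> x0 \<Longrightarrow> \<bar>deriv u x\<bar> \<le> C' * exp (R * x)"
proof -
  obtain M h where Mh: "M > 0" "h > 0" 
    "\<And>u a x S. solves k s u \<Longrightarrow> (\<And>y. y \<in> {a..a+h} \<Longrightarrow> \<bar>u y\<bar> \<le> S) \<Longrightarrow> x \<in> {a..a+h} \<Longrightarrow> \<bar>deriv u x\<bar> \<le> M * S"
    using solves_gradient[of k s] by metis
  have "\<bar>deriv u x\<bar> \<le> M * C * exp (R * x)" if "x \<le> x0" for x
  proof -
    have "\<bar>deriv u x\<bar> \<le> M * (C * exp (R * x))"
    proof (rule Mh(3)[OF u, of "x - h"])
      fix y assume y: "y \<in> {x - h..x - h + h}"
      have "\<bar>u y\<bar> \<le> C * exp (R * y)" using bd[of y] y that by simp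
      also have "\<dots> \<le> C * exp (R * x)" using assms(3,4) y by (intro mult_left_mono) (auto intro!: mult_left_mono)
      finally show "\<bar>u y\<bar> \<le> C * exp (R * x)" .
    qed (use Mh in auto)
    thus ?thesis by (simp add: mult.assoc)
  qed
  thus thesis using that[of "M * C"] Mh(1) assms(4) by simp
qed

section \<open>The weighted Wronskian\<close>

definition "drift_int = (SOME B. \<forall>x. (B has_real_derivative drift x) (at x))"

lemma drift_int_der: "(drift_int has_real_derivative drift x) (at x)"
proof -
  have "isCont drift t" for t using drift_cont continuous_on_eq_continuous_at open_UNIV by blast
  then obtain B where "\<forall>x. (B has_real_derivative drift x) (at x)" using antiderivative_on_real_line by metis
  hence "\<forall>x. (drift_int has_real_derivative drift x) (at x)" unfolding drift_int_def
    by (rule someI[of "\<lambda>B. \<forall>x. (B has_real_derivative drift x) (at x)"])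
  thus ?thesis by blast
qed

text \<open>Near +\<infinity> the drift tends to c > 0, so the weight is bounded and decay of the
  functions alone makes the Wronskian vanish.\<close>

lemma weight_at_top: obtains x0 C where "\<And>x. x \<ge> x0 \<Longrightarrow> exp (- drift_int x) \<le> C"
proof -
  have "(drift \<longlongrightarrow> (c - 2 * 0 / (m - 2)) / 1) at_top"
    unfolding drift_def[abs_def] using m by (intro tendsto_intros p_at_top p1_at_top) auto
  hence "eventually (\<lambda>x. drift x > 0) at_top" by (rule order_tendstoD) (use c_pos in simp)
  then obtain x0 where x0: "\<And>x. x \<ge> x0 \<Longrightarrow> drift x > 0" unfolding eventually_at_top_linorder by blast
  have "drift_int x0 \<le> drift_int x" if "x \<ge> x0" for x
    by (rule DERIV_nonneg_imp_nondecreasing[OF that]) (use x0 drift_int_der less_imp_le in blast)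
  thus thesis using that[of x0 "exp (- drift_int x0)"] by simp
qed

lemma weight_at_bot: obtains C where "C > 0" "\<And>x. x \<le> 0 \<Longrightarrow> exp (- drift_int x) \<le> C * exp (- (c / \<epsilon>) * x)"
proof -
  have mono: "drift_int 0 - c / \<epsilon> * 0 \<le> drift_int x - c / \<epsilon> * x" if "x \<le> 0" for x
  proof (rule DERIV_nonpos_imp_nonincreasing[OF that, where f = "\<lambda>x. drift_int x - c / \<epsilon> * x"])
    fix t
    have "((\<lambda>x. drift_int x - c / \<epsilon> * x) has_real_derivative drift t - c / \<epsilon> * 1) (at t)"
      by (intro DERIV_diff drift_int_der DERIV_cmult DERIV_ident)
    thus "\<exists>y. ((\<lambda>x. drift_int x - c / \<epsilon> * x) has_real_derivative y) (at t) \<and> y \<le> 0"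
      using drift_upper[of t] by (intro exI conjI) auto
  qed
  have "exp (- drift_int x) \<le> exp (- drift_int 0) * exp (- (c / \<epsilon>) * x)" if "x \<le> 0" for x
    using mono[OF that] unfolding exp_add[symmetric] by simp
  thus thesis using that[of "exp (- drift_int 0)"] by simp
qed

text \<open>The factor exp (- drift_int) is the integrating factor of u'' - drift u'; with it the
  derivative of the Wronskian contains only the product u v.\<close>

definition "wronskian u v x = exp (- drift_int x) * (deriv u x * v x - u x * deriv v x)"

lemma wronskian_der:
  assumes "solves k s u" "solves k s' v"
  shows "(wronskian u v has_real_derivative exp (- drift_int x) * ((s' - s) / p x * (u x * v x))) (at x)"
proof -
  have "(wronskian u v has_real_derivative exp (- drift_int x) * ((pot k s x - pot k s' x) * (u x * v x))) (at x)"
    unfolding wronskian_def[abs_def]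
    using solvesD[OF assms(1), of x] solvesD[OF assms(2), of x] drift_int_der[of x]
    by (auto intro!: derivative_eq_intros) (simp add: algebra_simps)
  moreover have "pot k s x - pot k s' x = (s' - s) / p x"
    unfolding pot_def by (simp add: diff_divide_distrib[symmetric])
  ultimately show ?thesis by simp
qed

lemma wronskian_at_top:
  assumes u: "solves k s u" "(u \<longlongrightarrow> 0) at_top" and v: "solves k s' v" "(v \<longlongrightarrow> 0) at_top"
  shows "(wronskian u v \<longlongrightarrow> 0) at_top"
proof -
  obtain x0 C where x0: "\<And>x. x \<ge> x0 \<Longrightarrow> exp (- drift_int x) \<le> C" using weight_at_top by blast
  have "((\<lambda>x. C * \<bar>deriv u x * v x - u x * deriv v x\<bar>) \<longlongrightarrow> C * \<bar>0 * 0 - 0 * 0\<bar>) at_top"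
    by (intro tendsto_intros u v solves_deriv_at_top[OF u] solves_deriv_at_top[OF v])
  hence "((\<lambda>x. C * \<bar>deriv u x * v x - u x * deriv v x\<bar>) \<longlongrightarrow> 0) at_top" by simp
  thus ?thesis
  proof (rule Lim_null_comparison[rotated])
    show "eventually (\<lambda>x. norm (wronskian u v x) \<le> C * \<bar>deriv u x * v x - u x * deriv v x\<bar>) at_top"
      using eventually_ge_at_top[of x0]
      by eventually_elim (auto simp: wronskian_def abs_mult intro!: mult_right_mono x0)
  qed
qed

text \<open>The weight may grow like exp (- c x / \<epsilon>) towards -\<infinity>, so decay of the
  solutions has to beat the rate c / \<epsilon>. Each exponent r^+ has real part at least c / (2
  \<epsilon>), and positivity of the radicand makes one of the two larger, so the sum exceeds c /
  \<epsilon>. The other radicand may be negative.\<close>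

lemma wronskian_at_bot:
  assumes u: "solves k s u" "maximal_decay m \<epsilon> k c s u" and v: "solves k s' v" "maximal_decay m \<epsilon> k c s' v"
    and rad: "radicand k s > 0"
  shows "(wronskian u v \<longlongrightarrow> 0) at_bot"
proof -
  define R where "R = (\<lambda>s. Re (exponent_plus m \<epsilon> k c s))"
  have R_eq: "R s = (c + Re (csqrt (of_real (radicand k s)))) / (2 * \<epsilon>)" for s
    unfolding R_def exponent_plus_def by (simp only: Re_divide_of_real plus_complex.simps Re_complex_of_real)
  have R_ge: "R s \<ge> c / (2 * \<epsilon>)" for s
    using Re_csqrt[of "of_real (radicand k s)"] \<epsilon> unfolding R_eq by (intro divide_right_mono) linarith+
  have R_gt: "R s > c / (2 * \<epsilon>)"
  proof -
    have "csqrt (of_real (radicand k s)) = of_real (sqrt (radicand k s))" using rad by (intro of_real_sqrt[symmetric]) simp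
    hence "R s = (c + sqrt (radicand k s)) / (2 * \<epsilon>)"
      unfolding R_eq by (simp only: Re_complex_of_real)
    thus ?thesis using rad \<epsilon> by (simp add: divide_strict_right_mono)
  qed
  have c\<epsilon>: "c / (2 * \<epsilon>) > 0" using c_pos \<epsilon> by simp
  have decay: "\<exists>C x0. C \<ge> 0 \<and> (\<forall>x\<le>x0. \<bar>f x\<bar> \<le> C * exp (R s * x) \<and> \<bar>deriv f x\<bar> \<le> C * exp (R s * x))"
    if f: "solves k s f" "maximal_decay m \<epsilon> k c s f" for f s
  proof -
    obtain C where C: "C > 0" "eventually (\<lambda>x. norm (f x) \<le> C * norm (exp (R s * x))) at_bot"
      using f(2) unfolding maximal_decay_def R_def by (rule landau_o.bigE)
    obtain x0 where x0: "\<And>x. x \<le> x0 \<Longrightarrow> \<bar>f x\<bar> \<le> C * exp (R s * x)"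
      using C(2) unfolding eventually_at_bot_linorder by auto
    obtain C' where C': "C' \<ge> 0" "\<And>x. x \<le> x0 \<Longrightarrow> \<bar>deriv f x\<bar> \<le> C' * exp (R s * x)"
      using solves_deriv_at_bot[OF f(1) x0] R_ge[of s] c\<epsilon> C(1) by auto
    have mx: "C * exp (R s * x) \<le> max C C' * exp (R s * x)" "C' * exp (R s * x) \<le> max C C' * exp (R s * x)" for x
      by (intro mult_right_mono; simp)+
    show ?thesis using C(1) order_trans[OF x0 mx(1)] order_trans[OF C'(2) mx(2)]
      by (rule_tac exI[of _ "max C C'"], rule_tac exI[of _ x0]) auto
  qed
  obtain C1 x1 where 1: "C1 \<ge> 0" "\<And>x. x \<le> x1 \<Longrightarrow> \<bar>u x\<bar> \<le> C1 * exp (R s * x)" "\<And>x. x \<le> x1 \<Longrightarrow> \<bar>deriv u x\<bar> \<le> C1 * exp (R s * x)"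
    using decay[OF u] by blast
  obtain C2 x2 where 2: "C2 \<ge> 0" "\<And>x. x \<le> x2 \<Longrightarrow> \<bar>v x\<bar> \<le> C2 * exp (R s' * x)" "\<And>x. x \<le> x2 \<Longrightarrow> \<bar>deriv v x\<bar> \<le> C2 * exp (R s' * x)"
    using decay[OF v] by blast
  obtain C where C: "C > 0" "\<And>x. x \<le> 0 \<Longrightarrow> exp (- drift_int x) \<le> C * exp (- (c / \<epsilon>) * x)" using weight_at_bot by blast
  define \<delta> where "\<delta> = R s + R s' - c / \<epsilon>"
  have "\<delta> > 0" using R_gt R_ge[of s'] unfolding \<delta>_def by (simp add: field_simps)
  have bound: "norm (wronskian u v x) \<le> C * (2 * C1 * C2) * exp (\<delta> * x)" if x: "x \<le> min 0 (min x1 x2)" for x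
  proof -
    have "\<bar>deriv u x * v x - u x * deriv v x\<bar> \<le> \<bar>deriv u x\<bar> * \<bar>v x\<bar> + \<bar>u x\<bar> * \<bar>deriv v x\<bar>"
      unfolding abs_mult[symmetric] by linarith
    also have "\<dots> \<le> (C1 * exp (R s * x)) * (C2 * exp (R s' * x)) + (C1 * exp (R s * x)) * (C2 * exp (R s' * x))"
      using x by (intro add_mono mult_mono 1 2 mult_nonneg_nonneg) auto
    also have "\<dots> = 2 * C1 * C2 * exp (R s * x + R s' * x)" by (simp add: exp_add)
    finally have "norm (wronskian u v x) \<le> (C * exp (- (c / \<epsilon>) * x)) * (2 * C1 * C2 * exp (R s * x + R s' * x))"
      unfolding wronskian_def real_norm_def abs_mult using C x by (intro mult_mono) auto
    also have "\<dots> = C * (2 * C1 * C2) * (exp (- (c / \<epsilon>) * x) * exp (R s * x + R s' * x))" by simp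
    also have "exp (- (c / \<epsilon>) * x) * exp (R s * x + R s' * x) = exp (\<delta> * x)"
      unfolding exp_add[symmetric] \<delta>_def by (simp add: algebra_simps)
    finally show ?thesis .
  qed
  have "((\<lambda>x. exp (\<delta> * x)) \<longlongrightarrow> 0) at_bot"
    using \<open>\<delta> > 0\<close> by (intro filterlim_compose[OF exp_at_bot] filterlim_tendsto_pos_mult_at_bot[OF tendsto_const]) (auto simp: filterlim_ident)
  hence "((\<lambda>x. C * (2 * C1 * C2) * exp (\<delta> * x)) \<longlongrightarrow> 0) at_bot" by (rule tendsto_mult_right_zero)
  thus ?thesis
    by (rule Lim_null_comparison[rotated]) (use eventually_le_at_bot[of "min 0 (min x1 x2)"] bound in \<open>auto elim!: eventually_mono\<close>)
qed

lemma eigenspace_scale: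
  assumes "u \<in> eigenspace m G \<epsilon> k c p s"
  shows "(\<lambda>x. a * u x) \<in> eigenspace m G \<epsilon> k c p s"
proof -
  have u: "solves k s u" "(u \<longlongrightarrow> 0) at_bot" "(u \<longlongrightarrow> 0) at_top" "maximal_decay m \<epsilon> k c s u"
    using assms unfolding eigenspace_iff by auto
  have d: "deriv (\<lambda>x. a * u x) = (\<lambda>x. a * deriv u x)"
    using solvesD(1)[OF u(1)] by (intro ext DERIV_imp_deriv) (auto intro!: derivative_eq_intros)
  have "solves k s (\<lambda>x. a * u x)" unfolding solves_def d
    using solvesD[OF u(1)] by (auto intro!: derivative_eq_intros simp: algebra_simps)
  moreover have "((\<lambda>x. a * u x) \<longlongrightarrow> 0) at_bot" "((\<lambda>x. a * u x) \<longlongrightarrow> 0) at_top"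
    using u by (auto intro: tendsto_mult_right_zero)
  moreover have "maximal_decay m \<epsilon> k c s (\<lambda>x. a * u x)"
    using u(4) unfolding maximal_decay_def by simp
  ultimately show ?thesis unfolding eigenspace_iff by blast
qed

text \<open>Where u > 0, the Wronskian with v increases strictly. At the right end of a component of
  {u > 0} it is at most 0 and at the left end at least 0, be the end a zero of u or infinity, which
  is impossible. The same argument applies to -u.\<close>

lemma no_eigenfunction_below:
  assumes u: "u \<in> eigenspace m G \<epsilon> k c p s" and v: "v \<in> eigenspace m G \<epsilon> k c p s'" "\<And>x. v x > 0"
    and s: "s < s'" "radicand k s > 0"
  shows "u = (\<lambda>_. 0)"
proof -
  have False if u: "u \<in> eigenspace m G \<epsilon> k c p s" and x0: "u x0 > 0" for u x0
  proof -
    have u: "solves k s u" "(u \<longlongrightarrow> 0) at_top" "maximal_decay m \<epsilon> k c s u"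
      using u unfolding eigenspace_iff by auto
    have v': "solves k s' v" "(v \<longlongrightarrow> 0) at_top" "maximal_decay m \<epsilon> k c s' v"
      using v(1) unfolding eigenspace_iff by auto
    define W where "W = wronskian u v"
    have dW: "\<exists>y. (W has_real_derivative y) (at x) \<and> 0 < y" if "u x > 0" for x
    proof (intro exI conjI)
      show "(W has_real_derivative exp (- drift_int x) * ((s' - s) / p x * (u x * v x))) (at x)"
        unfolding W_def by (rule wronskian_der[OF u(1) v'(1)])
      show "0 < exp (- drift_int x) * ((s' - s) / p x * (u x * v x))"
        using that v(2)[of x] s p_pos[of x] by simp
    qed
    have contu: "continuous_on A u" for A by (rule DERIV_at_imp_continuous_on, rule solvesD[OF u(1)])
    have contW: "continuous_on A W" for A unfolding W_def
      by (rule DERIV_at_imp_continuous_on, rule wronskian_der[OF u(1) v'(1)])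
    have less: "W x < W y" if "x < y" "\<And>t. x < t \<Longrightarrow> t < y \<Longrightarrow> u t > 0" for x y
      by (rule DERIV_pos_imp_increasing_open[OF that(1) _ contW]) (use dW that(2) in auto)
    have "W x0 < 0"
    proof (cases "\<exists>b\<ge>x0. u b \<le> 0")
      case True
      then obtain b where "b \<ge> x0" "u b \<le> 0" by blast
      then obtain z where z: "x0 < z" "u z = 0" "\<And>t. x0 \<le> t \<Longrightarrow> t < z \<Longrightarrow> u t > 0"
        using first_zero[OF contu, of x0 b] x0 by metis
      have "deriv u z \<le> 0"
      proof (rule ccontr)
        assume "\<not> deriv u z \<le> 0"
        then obtain d where d: "d > 0" "\<And>h. h > 0 \<Longrightarrow> h < d \<Longrightarrow> u (z - h) < u z"
          using DERIV_pos_inc_left[OF solvesD(1)[OF u(1), of z]] by auto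
        define h where "h = min (d / 2) (z - x0)"
        have "h > 0" "h < d" "z - h \<ge> x0" "z - h < z" using d z by (auto simp: h_def)
        thus False using d(2)[of h] z(2) z(3)[of "z - h"] by simp
      qed
      hence "W z \<le> 0" unfolding W_def wronskian_def using z(2) v(2)[of z] by (simp add: mult_nonneg_nonpos mult_nonpos_nonneg)
      thus ?thesis using less[of x0 z] z by simp
    next
      case False
      hence pos: "u t > 0" if "t \<ge> x0" for t using that by force
      have "W (x0 + 1) \<le> 0"
      proof (rule tendsto_lowerbound)
        show "(W \<longlongrightarrow> 0) at_top" unfolding W_def by (rule wronskian_at_top[OF u(1,2) v'(1,2)])
        show "eventually (\<lambda>x. W (x0 + 1) \<le> W x) at_top" using eventually_gt_at_top[of "x0 + 1"]
          by eventually_elim (use less pos in \<open>auto intro!: less_imp_le\<close>)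
      qed auto
      thus ?thesis using less[of x0 "x0 + 1"] pos by simp
    qed
    moreover have "W x0 > 0"
    proof (cases "\<exists>a\<le>x0. u a \<le> 0")
      case True
      then obtain a where "a \<le> x0" "u a \<le> 0" by blast
      then obtain z where z: "z < x0" "u z = 0" "\<And>t. z < t \<Longrightarrow> t \<le> x0 \<Longrightarrow> u t > 0"
        using last_zero[OF contu, of a x0] x0 by metis
      have "deriv u z \<ge> 0"
      proof (rule ccontr)
        assume "\<not> deriv u z \<ge> 0"
        then obtain d where d: "d > 0" "\<And>h. h > 0 \<Longrightarrow> h < d \<Longrightarrow> u (z + h) < u z"
          using DERIV_neg_dec_right[OF solvesD(1)[OF u(1), of z]] by auto
        define h where "h = min (d / 2) (x0 - z)"
        have "h > 0" "h < d" "z + h \<le> x0" "z + h > z" using d z by (auto simp: h_def)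
        thus False using d(2)[of h] z(2) z(3)[of "z + h"] by simp
      qed
      hence "W z \<ge> 0" unfolding W_def wronskian_def using z(2) v(2)[of z] by simp
      thus ?thesis using less[of z x0] z by simp
    next
      case False
      hence pos: "u t > 0" if "t \<le> x0" for t using that by force
      have "W (x0 - 1) \<ge> 0"
      proof (rule tendsto_upperbound)
        show "(W \<longlongrightarrow> 0) at_bot" unfolding W_def by (rule wronskian_at_bot[OF u(1,3) v'(1,3) s(2)])
        show "eventually (\<lambda>x. W x \<le> W (x0 - 1)) at_bot" using eventually_gt_at_bot[of "x0 - 1"]
          by eventually_elim (use less pos in \<open>auto intro!: less_imp_le\<close>)
      qed auto
      thus ?thesis using less[of "x0 - 1" x0] pos by simp
    qed
    ultimately show False by simp
  qed
  hence "\<not> u x > 0" "\<not> - 1 * u x > 0" for x using u eigenspace_scale[OF u, of "- 1"] by blast+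
  thus ?thesis by (intro ext) (smt (verit))
qed

text \<open>For equal parameters the Wronskian is constant, and its limit 0 at +\<infinity> makes u
  / v constant.\<close>

lemma eigenspace_one_dimensional:
  assumes v: "v \<in> eigenspace m G \<epsilon> k c p s" "\<And>x. v x > 0" and rad: "radicand k s > 0"
  shows "one_dimensional (eigenspace m G \<epsilon> k c p s)"
proof -
  have "\<exists>a. u = (\<lambda>x. a * v x)" if u: "u \<in> eigenspace m G \<epsilon> k c p s" for u
  proof -
    have u: "solves k s u" "(u \<longlongrightarrow> 0) at_top" using u unfolding eigenspace_iff by auto
    have v': "solves k s v" "(v \<longlongrightarrow> 0) at_top" using v(1) unfolding eigenspace_iff by auto
    have "(wronskian u v has_real_derivative 0) (at x)" for x using wronskian_der[OF u(1) v'(1), of x] by simp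
    hence const: "wronskian u v x = wronskian u v y" for x y using DERIV_isconst_all by blast
    have "wronskian u v x = 0" for x
    proof -
      have "(wronskian u v \<longlongrightarrow> wronskian u v x) at_top"
        by (intro tendsto_eventually always_eventually allI const)
      thus ?thesis using tendsto_unique[OF _ _ wronskian_at_top[OF u v']] by simp
    qed
    hence W0: "deriv u x * v x = u x * deriv v x" for x by (simp add: wronskian_def)
    have "((\<lambda>x. u x / v x) has_real_derivative 0) (at x)" for x
    proof -
      have "v x \<noteq> 0" using v(2)[of x] by simp
      from DERIV_divide[OF solvesD(1)[OF u(1), of x] solvesD(1)[OF v'(1), of x] this] show ?thesis by (simp add: W0)
    qed
    hence "u x / v x = u 0 / v 0" for x using DERIV_isconst_all by blast
    hence "u x = u 0 / v 0 * v x" for x using v(2)[of x] by (metis divide_eq_eq less_irrefl)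
    thus ?thesis by (intro exI[of _ "u 0 / v 0"] ext)
  qed
  hence "eigenspace m G \<epsilon> k c p s = range (\<lambda>a x. a * v x)" using eigenspace_scale[OF v(1)] by fastforce
  moreover have "v \<noteq> (\<lambda>_. 0)" using v(2)[of 0] by force
  ultimately show ?thesis unfolding one_dimensional_def by blast
qed

text \<open>The comparison is used in both directions: the positive \<open>v\<close> excludes
  eigenvalues below \<open>s\<close>, and a positive eigenfunction for some s' > s would exclude
  \<open>v\<close> itself. The radicand decreases in the parameter, so its sign at \<open>s\<close>
  serves both cases.\<close>

theorem principal_eigenvalue_properties:
  assumes v: "v \<in> eigenspace m G \<epsilon> k c p s" "\<And>x. v x > 0" and rad: "radicand k s > 0"
  shows "principal_eigenvalue m G \<epsilon> k c p s"
    and "eigenvalue m G \<epsilon> k c p s' \<Longrightarrow> s \<le> s'"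
    and "principal_eigenvalue m G \<epsilon> k c p s' \<Longrightarrow> s' = s"
    and "one_dimensional (eigenspace m G \<epsilon> k c p s)"
proof -
  show "principal_eigenvalue m G \<epsilon> k c p s" using v unfolding principal_eigenvalue_def by blast
  show "one_dimensional (eigenspace m G \<epsilon> k c p s)" by (rule eigenspace_one_dimensional[OF v rad])
  show min: "s \<le> s'" if "eigenvalue m G \<epsilon> k c p s'" for s'
  proof (rule ccontr)
    assume "\<not> s \<le> s'" hence "s' < s" by simp
    hence "radicand k s < radicand k s'" using \<epsilon> by simp
    then show False using that no_eigenfunction_below[OF _ v \<open>s' < s\<close>] rad unfolding eigenvalue_def by fastforce
  qed
  show "s' = s" if p: "principal_eigenvalue m G \<epsilon> k c p s'"
  proof (rule ccontr)
    assume ne: "s' \<noteq> s"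
    obtain w where w: "w \<in> eigenspace m G \<epsilon> k c p s'" "\<And>x. w x > 0" using p unfolding principal_eigenvalue_def by blast
    have "w \<noteq> (\<lambda>_. 0)" using w(2)[of 0] by force
    hence "s \<le> s'" using min w(1) unfolding eigenvalue_def by blast
    hence "s < s'" using ne by simp
    from no_eigenfunction_below[OF v(1) w this rad] show False using v(2)[of 0] by (simp add: fun_eq_iff)
  qed
qed

section \<open>Solutions with maximal decay\<close>

text \<open>Near -\<infinity> the wave equation gives (c / 2) p' \<le> p p'' \<le> p'', and
  integrating this yields both estimates. The true rate is c / \<epsilon>; the cruder c / 2 comes
  from p \<le> 1.\<close>

lemma tail_estimates:
  "\<exists>x0 C. x0 \<le> 0 \<and> C > 0 \<and> (\<forall>x\<le>x0. p x < \<theta> \<and> p x - \<epsilon> \<le> 2 / c * p1 x \<and> p1 x \<le> C * exp (c / 2 * x))"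
proof -
  obtain a where a: "\<And>x. x \<le> a \<Longrightarrow> p x < \<theta>" using p_le_\<theta>_at_bot by blast
  have "eventually (\<lambda>x. p1 x < c * (m - 2) / 2) at_bot"
    by (rule order_tendstoD[OF p1_at_bot]) (use c_pos m in simp)
  then obtain b where b: "\<And>x. x \<le> b \<Longrightarrow> p1 x < c * (m - 2) / 2" unfolding eventually_at_bot_linorder by blast
  define x0 where "x0 = min 0 (min a b)"
  have p2_ge: "p2 x \<ge> c / 2 * p1 x" if "x \<le> x0" for x
  proof -
    have x: "p x < \<theta>" "p1 x < c * (m - 2) / 2" using that a b by (auto simp: x0_def)
    have "p1 x / (m - 2) \<le> c / 2" using x(2) m by (simp add: field_simps)
    hence "c / 2 * p1 x \<le> (c - p1 x / (m - 2)) * p1 x" using p1_pos[of x] by (intro mult_right_mono) auto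
    also have "\<dots> = p x * p2 x" using ode[of x] G_eq_0[of "p x"] x(1) p_pos[of x] by simp
    finally have *: "c / 2 * p1 x \<le> p x * p2 x" .
    hence "p2 x \<ge> 0" using p_pos[of x] p1_pos[of x] c_pos by (smt (verit) divide_pos_pos mult_pos_neg mult_pos_pos)
    hence "p x * p2 x \<le> 1 * p2 x" using p_less_1[of x] by (intro mult_right_mono) auto
    thus ?thesis using * by simp
  qed
  have "p x - \<epsilon> \<le> 2 / c * p1 x" if x: "x \<le> x0" for x
  proof -
    have mono: "p x - 2 / c * p1 x \<le> p y - 2 / c * p1 y" if "y \<le> x" for y
    proof (rule DERIV_nonpos_imp_nonincreasing[OF that, where f = "\<lambda>t. p t - 2 / c * p1 t"])
      fix t assume "y \<le> t" "t \<le> x"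
      hence "c / 2 * p1 t \<le> p2 t" using p2_ge x by simp
      hence "p1 t - 2 / c * p2 t \<le> 0" using c_pos by (simp add: field_simps)
      thus "\<exists>d. ((\<lambda>t. p t - 2 / c * p1 t) has_real_derivative d) (at t) \<and> d \<le> 0"
        by (intro exI[of _ "p1 t - 2 / c * p2 t"] conjI DERIV_diff DERIV_cmult p_der p1_der)
    qed
    have "((\<lambda>y. p y - 2 / c * p1 y) \<longlongrightarrow> \<epsilon> - 2 / c * 0) at_bot"
      by (intro tendsto_intros p_at_bot p1_at_bot)
    hence "p x - 2 / c * p1 x \<le> \<epsilon> - 2 / c * 0"
      by (rule tendsto_lowerbound[OF _ eventually_mono[OF eventually_le_at_bot[of x] mono]]) auto
    thus ?thesis by simp
  qed
  moreover have "p1 x \<le> p1 x0 * exp (- (c / 2) * x0) * exp (c / 2 * x)" if x: "x \<le> x0" for x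
  proof -
    have "p1 x * exp (- (c / 2) * x) \<le> p1 x0 * exp (- (c / 2) * x0)"
    proof (rule DERIV_nonneg_imp_nondecreasing[OF x, where f = "\<lambda>t. p1 t * exp (- (c / 2) * t)"])
      fix t assume t: "x \<le> t" "t \<le> x0"
      have "((\<lambda>t. p1 t * exp (- (c / 2) * t)) has_real_derivative (p2 t - c / 2 * p1 t) * exp (- (c / 2) * t)) (at t)"
        using p1_der[of t] by (auto intro!: derivative_eq_intros simp: algebra_simps)
      moreover have "(p2 t - c / 2 * p1 t) * exp (- (c / 2) * t) \<ge> 0" using p2_ge[OF t(2)] by simp
      ultimately show "\<exists>y. ((\<lambda>t. p1 t * exp (- (c / 2) * t)) has_real_derivative y) (at t) \<and> 0 \<le> y" by blast
    qed
    hence "p1 x * exp (- (c / 2) * x) * exp (c / 2 * x) \<le> p1 x0 * exp (- (c / 2) * x0) * exp (c / 2 * x)"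
      by (intro mult_right_mono) auto
    thus ?thesis by (simp add: mult.assoc exp_add[symmetric])
  qed
  moreover have "p1 x0 * exp (- (c / 2) * x0) > 0" using p1_pos by simp
  moreover have "x0 \<le> 0" "\<And>x. x \<le> x0 \<Longrightarrow> p x < \<theta>" using a by (auto simp: x0_def)
  ultimately show ?thesis by blast
qed

section \<open>Removal of the drift, and the equation in the variable exp (c x / 4)\<close>

definition "drift' x = - (2 * p2 x / (m - 2)) / p x - drift x * p1 x / p x"

lemma drift_der: "(drift has_real_derivative drift' x) (at x)"
proof -
  have "((\<lambda>x. c - 2 * p1 x / (m - 2)) has_real_derivative - (2 * p2 x / (m - 2))) (at x)"
    using p1_der[of x] m by (auto intro!: derivative_eq_intros)
  from DERIV_divide[OF this p_der[of x]]
  have d: "(drift has_real_derivative (- (2 * p2 x / (m - 2)) * p x - (c - 2 * p1 x / (m - 2)) * p1 x) / (p x * p x)) (at x)"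
    unfolding drift_def[abs_def] using p_pos[of x] by simp
  have quot: "(a * y - b * q) / (y * y) = a / y - b / y * q / y" if "y \<noteq> 0" for a b q y :: real
    using that by (simp add: field_simps)
  have "p x \<noteq> 0" using p_pos[of x] by simp
  from DERIV_cong[OF d quot[OF this]] show ?thesis by (simp only: drift'_def drift_def)
qed

text \<open>
  Writing a solution as \<open>exp (drift_int x / 2 + \<kappa> x) H x\<close> turns the equation into
  \<open>H'' + 2 \<kappa> H' = defect H\<close>, where the defect decays exponentially at \<open>-\<infinity>\<close>.
\<close>

definition "defect0 k x = (drift x)\<^sup>2 / 4 - drift' x / 2 + (k\<^sup>2 * p x powr (m / (m - 2)) - p2 x - deriv01 G (p x)) / p x
  - (c\<^sup>2 / (4 * \<epsilon>\<^sup>2) + k\<^sup>2 * \<epsilon> powr (m / (m - 2)) / \<epsilon>)"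
definition "defect k s x = defect0 k x - s * (1 / p x - 1 / \<epsilon>)"

text \<open>Half the difference of the exponents r^+ and r^-, so that r^+ = c / (2 \<epsilon>) +
  \<kappa>.\<close>

definition "\<kappa> k s = sqrt (radicand k s) / (2 * \<epsilon>)"

lemma \<kappa>_square:
  assumes "radicand k s \<ge> 0"
  shows "(\<kappa> k s)\<^sup>2 = c\<^sup>2 / (4 * \<epsilon>\<^sup>2) + (k\<^sup>2 * \<epsilon> powr (m / (m - 2)) - s) / \<epsilon>"
  unfolding \<kappa>_def power_divide real_sqrt_pow2[OF assms] using \<epsilon> by (simp add: field_simps power2_eq_square)

lemma defect_eq:
  assumes "radicand k s \<ge> 0"
  shows "defect k s x = (drift x)\<^sup>2 / 4 - drift' x / 2 + pot k s x - (\<kappa> k s)\<^sup>2"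
  unfolding defect_def defect0_def pot_def \<kappa>_square[OF assms] by (simp add: diff_divide_distrib right_diff_distrib)

lemma defect0_cont: "continuous_on UNIV (defect0 k)"
  unfolding defect0_def[abs_def] drift'_def using p_pos m
  by (intro continuous_intros p_cont p1_cont p2_cont G'_cont drift_cont continuous_on_powr)
     (auto simp: less_imp_neq[THEN not_sym])

text \<open>The known rate is c / 2; dividing by only half of it leaves a quotient that tends to 0
  and so has a continuous value at T = 0.\<close>

lemma tail_decay: "((\<lambda>x. (p x - \<epsilon>) / exp (c / 4 * x)) \<longlongrightarrow> 0) at_bot"
proof -
  obtain x0 C where x0: "C > 0" "\<And>x. x \<le> x0 \<Longrightarrow> p x - \<epsilon> \<le> 2 / c * p1 x"
    "\<And>x. x \<le> x0 \<Longrightarrow> p1 x \<le> C * exp (c / 2 * x)" using tail_estimates by blast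
  have "((\<lambda>x. exp (c / 4 * x)) \<longlongrightarrow> 0) at_bot"
    using c_pos by (intro filterlim_compose[OF exp_at_bot] filterlim_tendsto_pos_mult_at_bot[OF tendsto_const]) (auto simp: filterlim_ident)
  hence "((\<lambda>x. 2 / c * C * exp (c / 4 * x)) \<longlongrightarrow> 0) at_bot" by (rule tendsto_mult_right_zero)
  thus ?thesis
  proof (rule Lim_null_comparison[rotated])
    show "eventually (\<lambda>x. norm ((p x - \<epsilon>) / exp (c / 4 * x)) \<le> 2 / c * C * exp (c / 4 * x)) at_bot"
      using eventually_le_at_bot[of x0]
    proof eventually_elim
      case (elim x)
      have "p x - \<epsilon> \<le> 2 / c * (C * exp (c / 2 * x))"
        using x0(2)[OF elim] x0(3)[OF elim] c_pos mult_left_mono[of "p1 x" "C * exp (c / 2 * x)" "2 / c"] by simp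
      also have "exp (c / 2 * x) = exp (c / 4 * x) * exp (c / 4 * x)" unfolding exp_add[symmetric] by simp
      finally show ?case using p_gt[of x] by (simp add: divide_le_eq mult.assoc)
    qed
  qed
qed

text \<open>A differentiable function of p that vanishes at \<epsilon> decays like p - \<epsilon>.
  In the tail every coefficient is such a function up to a constant, because p' and p'' are
  functions of p there.\<close>

lemma differentiable_at_tail_limit:
  fixes \<Psi> :: "real \<Rightarrow> real"
  assumes "(\<Psi> has_real_derivative D) (at \<epsilon>)" "\<Psi> \<epsilon> = 0" "\<And>x. p x < \<theta> \<Longrightarrow> f x = \<Psi> (p x)"
  shows "((\<lambda>x. f x / exp (c / 4 * x)) \<longlongrightarrow> 0) at_bot"
proof -
  obtain x0 where x0: "\<And>x. x \<le> x0 \<Longrightarrow> p x < \<theta>" using p_le_\<theta>_at_bot by blast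
  have "((\<lambda>r. (\<Psi> r - \<Psi> \<epsilon>) / (r - \<epsilon>)) \<longlongrightarrow> D) (at \<epsilon>)"
    using assms(1) unfolding has_field_derivative_iff .
  moreover have "filterlim p (at \<epsilon>) at_bot"
    unfolding filterlim_at using p_at_bot p_gt by (auto simp: less_imp_neq[THEN not_sym])
  ultimately have "((\<lambda>x. \<Psi> (p x) / (p x - \<epsilon>)) \<longlongrightarrow> D) at_bot"
    using assms(2) by (auto dest: filterlim_compose)
  from tendsto_mult[OF this tail_decay]
  have "((\<lambda>x. \<Psi> (p x) / (p x - \<epsilon>) * ((p x - \<epsilon>) / exp (c / 4 * x))) \<longlongrightarrow> 0) at_bot" by simp
  moreover have "eventually (\<lambda>x. \<Psi> (p x) / (p x - \<epsilon>) * ((p x - \<epsilon>) / exp (c / 4 * x)) = f x / exp (c / 4 * x)) at_bot"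
    using eventually_le_at_bot[of x0]
  proof eventually_elim
    case (elim x)
    have "p x - \<epsilon> \<noteq> 0" using p_gt[of x] by simp
    thus ?case using assms(3)[OF x0[OF elim]] by simp
  qed
  ultimately show ?thesis by (rule Lim_transform_eventually)
qed

lemma defect0_at_bot: "((\<lambda>x. defect0 k x / exp (c / 4 * x)) \<longlongrightarrow> 0) at_bot"
proof -
  \<comment> \<open>\<open>q\<close>, \<open>q2\<close> and \<open>D\<close> are p', p'' and the
    drift as functions of the temperature r, valid below \<theta>. The constant subtracted in
    \<open>defect0\<close> is the one that makes \<open>\<Psi> \<epsilon> = 0\<close>.\<close>
  define q where "q = (\<lambda>r. c * (m - 2) * (1 - e / r powr n))"
  define q2 where "q2 = (\<lambda>r. (c - q r / (m - 2)) * q r / r)"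
  define D where "D = (\<lambda>r. (c - 2 * q r / (m - 2)) / r)"
  define \<Psi> where "\<Psi> = (\<lambda>r. (D r)\<^sup>2 / 4 - (- (2 * q2 r / (m - 2)) / r - D r * q r / r) / 2 
     + (k\<^sup>2 * r powr (m / (m - 2)) - q2 r) / r - (c\<^sup>2 / (4 * \<epsilon>\<^sup>2) + k\<^sup>2 * \<epsilon> powr (m / (m - 2)) / \<epsilon>))"
  have diff_powr: "(\<lambda>r. r powr a) differentiable (at \<epsilon>)" for a :: real
    using has_real_derivative_powr[of \<epsilon> a] \<epsilon> real_differentiable_def by blast
  have q: "q differentiable (at \<epsilon>)" unfolding q_def using \<epsilon> diff_powr[of n] by (intro derivative_intros) auto
  have q2: "q2 differentiable (at \<epsilon>)" unfolding q2_def using \<epsilon> m q by (intro derivative_intros) auto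
  have D: "D differentiable (at \<epsilon>)" unfolding D_def using \<epsilon> m q by (intro derivative_intros) auto
  have "\<Psi> differentiable (at \<epsilon>)"
    unfolding \<Psi>_def using \<epsilon> m diff_powr q q2 D by (intro derivative_intros) auto
  then obtain d where d: "(\<Psi> has_real_derivative d) (at \<epsilon>)" using real_differentiable_def by blast
  have "q \<epsilon> = 0" using \<epsilon> by (simp add: q_def)
  hence "\<Psi> \<epsilon> = 0" unfolding \<Psi>_def D_def q2_def using \<epsilon> by (simp add: power_divide)
  show ?thesis
  proof (rule differentiable_at_tail_limit[OF d \<open>\<Psi> \<epsilon> = 0\<close>])
    fix x assume x: "p x < \<theta>"
    have p1: "p1 x = q (p x)" using p1_eq[of x] x p_pos[of x] unfolding q_def by (simp add: field_simps)
    have "p x * p2 x = (c - p1 x / (m - 2)) * p1 x" using ode[of x] G_eq_0[of "p x"] x p_pos[of x] by simp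
    hence p2: "p2 x = q2 (p x)" unfolding q2_def p1[symmetric] using p_pos[of x] by (simp add: field_simps)
    have "drift x = D (p x)" unfolding drift_def D_def p1 ..
    moreover have "deriv01 G (p x) = 0" by (rule deriv01_ignition_eq_0[OF ign p_pos x])
    ultimately show "defect0 k x = \<Psi> (p x)" unfolding defect0_def drift'_def \<Psi>_def p1 p2 by simp
  qed
qed

lemma inverse_tail_at_bot: "((\<lambda>x. (1 / p x - 1 / \<epsilon>) / exp (c / 4 * x)) \<longlongrightarrow> 0) at_bot"
proof (rule differentiable_at_tail_limit)
  show "((\<lambda>r. 1 / r - 1 / \<epsilon>) has_real_derivative - (1 / \<epsilon>\<^sup>2)) (at \<epsilon>)"
    using \<epsilon> by (auto intro!: derivative_eq_intros simp: power2_eq_square)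
qed auto

text \<open>With \<tau> = exp (c x / 4), the value 0 assigned at \<tau> = 0 is the limit at x =
  -\<infinity>.\<close>

lemma continuous_on_log_coordinate:
  fixes f :: "real \<Rightarrow> real"
  assumes f: "continuous_on UNIV f" and lim: "((\<lambda>x. f x / exp (c / 4 * x)) \<longlongrightarrow> 0) at_bot"
  shows "continuous_on {0..} (\<lambda>\<tau>. if \<tau> = 0 then 0 else f (4 / c * ln \<tau>) / \<tau>)" (is "continuous_on _ ?F")
  unfolding continuous_on_eq_continuous_within
proof
  fix \<tau> :: real assume \<tau>: "\<tau> \<in> {0..}"
  show "continuous (at \<tau> within {0..}) ?F"
  proof (cases "\<tau> = 0")
    case False
    have "isCont f y" for y using f continuous_on_eq_continuous_at[OF open_UNIV] by blast
    moreover have "isCont (\<lambda>\<tau>. 4 / c * ln \<tau>) \<tau>" using \<tau> False by (intro continuous_intros) auto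
    ultimately have "isCont (\<lambda>\<tau>. f (4 / c * ln \<tau>)) \<tau>" by (rule isCont_o2[rotated])
    hence "isCont (\<lambda>\<tau>. f (4 / c * ln \<tau>) / \<tau>) \<tau>" using \<tau> False by (intro continuous_intros) auto
    moreover have "eventually (\<lambda>t. ?F t = f (4 / c * ln t) / t) (nhds \<tau>)"
      using eventually_nhds_in_open[of "{0<..}" \<tau>] \<tau> False by (auto elim!: eventually_mono)
    ultimately have "isCont ?F \<tau>" using isCont_cong by fastforce
    thus ?thesis by (rule continuous_at_imp_continuous_at_within)
  next
    case True
    have ln: "filterlim (\<lambda>\<tau>. 4 / c * ln \<tau>) at_bot (at_right 0)"
      using c_pos by (intro filterlim_tendsto_pos_mult_at_bot[OF tendsto_const] ln_at_0) auto
    have "((\<lambda>\<tau>. f (4 / c * ln \<tau>) / exp (c / 4 * (4 / c * ln \<tau>))) \<longlongrightarrow> 0) (at_right 0)"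
      by (rule filterlim_compose[OF lim ln])
    moreover have "eventually (\<lambda>\<tau>. f (4 / c * ln \<tau>) / exp (c / 4 * (4 / c * ln \<tau>)) = ?F \<tau>) (at_right 0)"
      using eventually_at_right_less[of 0] by eventually_elim (use c_pos in simp)
    ultimately have "(?F \<longlongrightarrow> 0) (at_right 0)" by (rule Lim_transform_eventually)
    moreover have "at (0::real) within {0..} = at_right 0"
      by (rule at_within_nhd[of _ UNIV]) auto
    ultimately show ?thesis using True by (simp add: continuous_within)
  qed
qed

text \<open>The drift falls below its limit c / \<epsilon> by at most K p', whose primitive K p is
  bounded. Hence exp (drift_int / 2) decays at least like exp (c x / (2 \<epsilon>)), as maximal
  decay requires.\<close>

lemma drift_int_upper: obtains C x0 where "\<And>x. x \<le> x0 \<Longrightarrow> drift_int x \<le> c / \<epsilon> * x + C"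
proof -
  obtain x0 where x0: "\<And>x. x \<le> x0 \<Longrightarrow> p x - \<epsilon> \<le> 2 / c * p1 x" using tail_estimates by blast
  define K where "K = 2 / \<epsilon>\<^sup>2 + 2 / (m - 2) / \<epsilon>"
  have lower: "drift x - c / \<epsilon> + K * p1 x \<ge> 0" if "x \<le> x0" for x
  proof -
    have "c / \<epsilon> - c / p x = c * (p x - \<epsilon>) / (p x * \<epsilon>)" using p_pos[of x] \<epsilon> by (simp add: field_simps)
    also have "\<dots> \<le> c * (2 / c * p1 x) / (\<epsilon> * \<epsilon>)"
      using x0[OF that] c_pos p_gt[of x] \<epsilon> p1_pos[of x] by (intro frac_le mult_left_mono mult_right_mono mult_nonneg_nonneg) auto
    also have "\<dots> = 2 / \<epsilon>\<^sup>2 * p1 x" using c_pos by (simp add: power2_eq_square)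
    finally have 1: "c / \<epsilon> - c / p x \<le> 2 / \<epsilon>\<^sup>2 * p1 x" .
    have "2 * p1 x / (m - 2) / p x \<le> 2 * p1 x / (m - 2) / \<epsilon>"
      using p_gt[of x] \<epsilon> p1_pos[of x] m by (intro divide_left_mono) auto
    also have "\<dots> = 2 / (m - 2) / \<epsilon> * p1 x" by simp
    finally have 2: "2 * p1 x / (m - 2) / p x \<le> 2 / (m - 2) / \<epsilon> * p1 x" .
    have "drift x = c / p x - 2 * p1 x / (m - 2) / p x" unfolding drift_def by (simp add: diff_divide_distrib)
    moreover have "K * p1 x = 2 / \<epsilon>\<^sup>2 * p1 x + 2 / (m - 2) / \<epsilon> * p1 x" unfolding K_def by (simp add: distrib_right)
    ultimately show ?thesis using 1 2 by linarith
  qed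
  have "drift_int x \<le> c / \<epsilon> * x + (drift_int x0 - c / \<epsilon> * x0 + K * p x0)" if x: "x \<le> x0" for x
  proof -
    have "drift_int x - c / \<epsilon> * x + K * p x \<le> drift_int x0 - c / \<epsilon> * x0 + K * p x0"
    proof (rule DERIV_nonneg_imp_nondecreasing[OF x, where f = "\<lambda>x. drift_int x - c / \<epsilon> * x + K * p x"])
      fix t assume "x \<le> t" "t \<le> x0"
      hence "drift t - c / \<epsilon> * 1 + K * p1 t \<ge> 0" using lower by simp
      thus "\<exists>y. ((\<lambda>x. drift_int x - c / \<epsilon> * x + K * p x) has_real_derivative y) (at t) \<and> 0 \<le> y"
        by (intro exI[of _ "drift t - c / \<epsilon> * 1 + K * p1 t"] conjI DERIV_add DERIV_diff drift_int_der DERIV_cmult DERIV_ident p_der)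
    qed
    moreover have "K * p x \<ge> 0" unfolding K_def using p_pos[of x] m \<epsilon> by simp
    ultimately show ?thesis by simp
  qed
  thus thesis using that by blast
qed

text \<open>In T = exp (\<delta> x) the equation H'' + 2 \<kappa> H' = defect H becomes (T^(b+1)
  h')' = T^b F h. It is solved from h = 1 at T = 0, that is from -\<infinity>. The formula for
  \<open>u\<close> is exposed because joint continuity of \<open>h\<close> up to T = 0 is what later
  makes positivity on a half line stable under changes of s.\<close>

lemma maximal_decay_family:
  assumes rad: "radicand k s2 > 0"
  obtains u h where
    "\<And>s. s \<in> {s1..s2} \<Longrightarrow> solves k s (u s)"
    "continuous_on ({s1..s2} \<times> {0..}) (\<lambda>(s, T). h s T)"
    "\<And>s. s \<in> {s1..s2} \<Longrightarrow> h s 0 = (1 :: real)"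
    "\<And>s x. u s x = exp (drift_int x / 2 + \<kappa> k s * x) * h s (exp (c / 4 * x))"
    "\<And>x. continuous_on {s1..s2} (\<lambda>s. deriv (u s) x)"
    "\<And>s. s \<in> {s1..s2} \<Longrightarrow> ((\<lambda>x. deriv (u s) x / u s x) \<longlongrightarrow> c / (2 * \<epsilon>) + \<kappa> k s) at_bot"
proof -
  define S where "S = {s1..s2}"
  define \<delta> where "\<delta> = c / 4"
  have \<delta>: "\<delta> > 0" using c_pos by (simp add: \<delta>_def)
  have radS: "radicand k s > 0" if "s \<in> S" for s
  proof -
    have "4 * \<epsilon> * (k\<^sup>2 * \<epsilon> powr (m / (m - 2)) - s) \<ge> 4 * \<epsilon> * (k\<^sup>2 * \<epsilon> powr (m / (m - 2)) - s2)"
      using that \<epsilon> unfolding S_def by (intro mult_left_mono) auto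
    thus ?thesis using rad by linarith
  qed
  define b where "b = (\<lambda>s. 2 * \<kappa> k s / \<delta>)"
  have b: "b s > 0" if "s \<in> S" for s using radS[OF that] \<epsilon> \<delta> by (simp add: b_def \<kappa>_def)
  have b_cont: "continuous_on S b" unfolding b_def \<kappa>_def using \<epsilon> \<delta> by (intro continuous_intros) auto
  have \<kappa>_cont: "continuous_on S (\<kappa> k)" unfolding \<kappa>_def using \<epsilon> by (intro continuous_intros) auto
  define F0 where "F0 = (\<lambda>\<tau>. if \<tau> = 0 then 0 else defect0 k (4 / c * ln \<tau>) / \<tau>)"
  define F1 where "F1 = (\<lambda>\<tau>. if \<tau> = 0 then 0 else (1 / p (4 / c * ln \<tau>) - 1 / \<epsilon>) / \<tau>)"
  have F0: "continuous_on {0..} F0" unfolding F0_def by (rule continuous_on_log_coordinate[OF defect0_cont defect0_at_bot])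
  have F1: "continuous_on {0..} F1" unfolding F1_def
    by (rule continuous_on_log_coordinate[OF _ inverse_tail_at_bot]) (use p_pos \<epsilon> in \<open>auto intro!: continuous_intros p_cont simp: less_imp_neq[THEN not_sym]\<close>)
  define F where "F = (\<lambda>s \<tau>. (F0 \<tau> - s * F1 \<tau>) / \<delta>\<^sup>2)"
  have F_defect: "F s (exp (\<delta> * x)) * exp (\<delta> * x) * \<delta>\<^sup>2 = defect k s x" for s x
    unfolding F_def F0_def F1_def defect_def using \<delta> by (simp add: \<delta>_def field_simps)
  have F: "continuous_on (S \<times> {0..}) (\<lambda>(s, \<tau>). F s \<tau>)"
    unfolding F_def case_prod_unfold using \<delta>
    by (intro continuous_intros continuous_on_compose2[OF F0] continuous_on_compose2[OF F1]) auto
  define A where "A = (\<lambda>s \<tau>. \<tau> powr b s * F s \<tau>)"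
  have A: "continuous_on (S \<times> {0..}) (\<lambda>(s, \<tau>). A s \<tau>)"
    unfolding A_def case_prod_unfold
    by (intro continuous_on_mult F[unfolded case_prod_unfold] continuous_on_powr' continuous_on_compose2[OF b_cont] continuous_intros)
       (use b in auto)
  \<comment> \<open>The primitive -T^(-b) / b blows up at 0, but multiplied by A = T^b F it leaves
    this continuous kernel. Positivity of the radicand enters as b > 0.\<close>
  define kk where "kk = (\<lambda>s T \<theta>. (1 - \<theta> powr b s) / b s * F s (T * \<theta>))"
  have kk: "continuous_on (S \<times> {0..} \<times> {0..1}) (\<lambda>(s, T, \<theta>). kk s T \<theta>)"
    unfolding kk_def case_prod_unfold
    by (intro continuous_on_mult continuous_on_compose_pair[OF F] continuous_on_divide continuous_on_diff continuous_on_powr' continuous_on_compose2[OF b_cont] continuous_intros)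
       (use b in \<open>auto simp: zero_le_mult_iff less_imp_neq[THEN not_sym]\<close>)
  have Cc: "continuous_on (S \<times> {0..}) (\<lambda>(s, T). - (F s T / b s))"
    unfolding case_prod_unfold
    by (intro continuous_on_minus continuous_on_divide F[unfolded case_prod_unfold] continuous_on_compose2[OF b_cont] continuous_intros)
       (use b in \<open>auto simp: less_imp_neq[THEN not_sym]\<close>)
  have "compact S" by (simp add: S_def)
  obtain h r where h: "continuous_on (S \<times> {0..}) (\<lambda>(s, T). h s T)" and r: "continuous_on (S \<times> {0..}) (\<lambda>(s, T). r s T)"
    and h0: "\<And>s. s \<in> S \<Longrightarrow> h s 0 = 1"
    and r_eq: "\<And>s T. s \<in> S \<Longrightarrow> T \<ge> 0 \<Longrightarrow> r s T = integral {0..1} (\<lambda>\<theta>. A s (T * \<theta>) * h s (T * \<theta>))"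
    and dh: "\<And>s T. s \<in> S \<Longrightarrow> T > 0 \<Longrightarrow> (h s has_real_derivative T powr (- b s - 1) * (T * r s T)) (at T)"
    and dr: "\<And>s T. s \<in> S \<Longrightarrow> T > 0 \<Longrightarrow> ((\<lambda>T. T * r s T) has_real_derivative A s T * h s T) (at T)"
  proof (rule singular_initial_value_problem[OF \<open>compact S\<close> kk A Cc, where B = "\<lambda>s T. - (T powr (- b s) / b s)" and B' = "\<lambda>s T. T powr (- b s - 1)"])
    fix s T assume s: "s \<in> S" and T: "(T::real) > 0"
    show "((\<lambda>T. - (T powr (- b s) / b s)) has_real_derivative T powr (- b s - 1)) (at T)"
      using T b[OF s] by (auto intro!: derivative_eq_intros)
    show "- (F s T / b s) = - (T powr (- b s) / b s) * A s T"
      using T by (simp add: A_def powr_minus field_simps)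
    fix \<theta> :: real assume "\<theta> \<in> {0..1}"
    thus "kk s T \<theta> = - (T powr (- b s) / b s) * A s (T * \<theta>) - - (F s (T * \<theta>) / b s)"
      using T b[OF s] by (simp add: kk_def A_def powr_mult powr_minus field_simps)
  qed blast
  define H where "H = (\<lambda>s x. h s (exp (\<delta> * x)))"
  define H1 where "H1 = (\<lambda>s x. \<delta> * exp (- (b s * \<delta>) * x) * (exp (\<delta> * x) * r s (exp (\<delta> * x))))"
  have dH: "(H s has_real_derivative H1 s x) (at x)" if s: "s \<in> S" for s x
  proof -
    have "((\<lambda>x. exp (\<delta> * x)) has_real_derivative exp (\<delta> * x) * \<delta>) (at x)"
      by (auto intro!: derivative_eq_intros)
    from DERIV_chain2[OF dh[OF s, of "exp (\<delta> * x)"] this]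
    have "(H s has_real_derivative exp (\<delta> * x) powr (- b s - 1) * (exp (\<delta> * x) * r s (exp (\<delta> * x))) * (exp (\<delta> * x) * \<delta>)) (at x)"
      unfolding H_def by simp
    moreover have key: "exp (\<delta> * x) powr (- b s - 1) * exp (\<delta> * x) = exp (- (b s * \<delta>) * x)"
    proof -
      have "exp (\<delta> * x) powr (- b s - 1) = exp ((- b s - 1) * (\<delta> * x))" by (simp add: powr_def)
      thus ?thesis unfolding exp_add[symmetric] by (simp add: algebra_simps flip: exp_add)
    qed
    moreover have "exp (\<delta> * x) powr (- b s - 1) * (exp (\<delta> * x) * r s (exp (\<delta> * x))) * (exp (\<delta> * x) * \<delta>) = H1 s x"
    proof -
      have "y * (a * w) * (a * \<delta>) = \<delta> * (y * a) * (a * w)" for y a w :: real by simp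
      thus ?thesis unfolding H1_def key[symmetric] by blast
    qed
    ultimately show ?thesis by simp
  qed
  have dH1: "(H1 s has_real_derivative - (2 * \<kappa> k s) * H1 s x + defect k s x * H s x) (at x)" if s: "s \<in> S" for s x
  proof -
    have e1: "((\<lambda>x. exp (\<delta> * x)) has_real_derivative exp (\<delta> * x) * \<delta>) (at x)"
      by (auto intro!: derivative_eq_intros)
    have e2: "((\<lambda>x. \<delta> * exp (- (b s * \<delta>) * x)) has_real_derivative \<delta> * (exp (- (b s * \<delta>) * x) * (- (b s * \<delta>)))) (at x)"
      by (auto intro!: derivative_eq_intros)
    have e3: "((\<lambda>x. exp (\<delta> * x) * r s (exp (\<delta> * x))) has_real_derivative 
        A s (exp (\<delta> * x)) * h s (exp (\<delta> * x)) * (exp (\<delta> * x) * \<delta>)) (at x)"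
      using DERIV_chain2[OF dr[OF s, of "exp (\<delta> * x)"] e1] by simp
    have eA: "exp (- (b s * \<delta>) * x) * A s (exp (\<delta> * x)) = F s (exp (\<delta> * x))"
    proof -
      have "exp (- (b s * \<delta>) * x) * exp (\<delta> * x) powr b s = 1"
        by (simp add: powr_def flip: exp_add)
      thus ?thesis unfolding A_def by (simp add: mult.assoc[symmetric])
    qed
    have "(H1 s has_real_derivative \<delta> * exp (- (b s * \<delta>) * x) * (A s (exp (\<delta> * x)) * h s (exp (\<delta> * x)) * (exp (\<delta> * x) * \<delta>))
        + \<delta> * (exp (- (b s * \<delta>) * x) * (- (b s * \<delta>))) * (exp (\<delta> * x) * r s (exp (\<delta> * x)))) (at x)"
      unfolding H1_def by (rule DERIV_mult'[OF e2 e3])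
    moreover have "\<delta> * exp (- (b s * \<delta>) * x) * (A s (exp (\<delta> * x)) * h s (exp (\<delta> * x)) * (exp (\<delta> * x) * \<delta>)) = defect k s x * H s x"
      unfolding F_defect[symmetric] H_def eA[symmetric] by (simp add: power2_eq_square mult_ac)
    moreover have "\<delta> * (exp (- (b s * \<delta>) * x) * (- (b s * \<delta>))) * (exp (\<delta> * x) * r s (exp (\<delta> * x))) = - (2 * \<kappa> k s) * H1 s x"
    proof -
      have "b s * \<delta> = 2 * \<kappa> k s" using \<delta> by (simp add: b_def)
      thus ?thesis unfolding H1_def by (simp add: mult_ac)
    qed
    ultimately show ?thesis by (simp add: add.commute)
  qed
  define u where "u = (\<lambda>s x. exp (drift_int x / 2 + \<kappa> k s * x) * H s x)"
  have du: "(u s has_real_derivative exp (drift_int x / 2 + \<kappa> k s * x) * ((drift x / 2 + \<kappa> k s) * H s x + H1 s x)) (at x)" if s: "s \<in> S" for s x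
    unfolding u_def using dH[OF s] drift_int_der by (auto intro!: derivative_eq_intros simp: algebra_simps)
  have deriv_u: "deriv (u s) = (\<lambda>x. exp (drift_int x / 2 + \<kappa> k s * x) * ((drift x / 2 + \<kappa> k s) * H s x + H1 s x))" if "s \<in> S" for s
    using du[OF that] by (intro ext DERIV_imp_deriv)
  have sol: "solves k s (u s)" if s: "s \<in> S" for s
    unfolding solves_def
  proof (intro allI conjI)
    fix x
    show "(u s has_real_derivative deriv (u s) x) (at x)" using du[OF s] deriv_u[OF s] by simp
    define Y where "Y = exp (drift_int x / 2 + \<kappa> k s * x)"
    have eY: "((\<lambda>x. exp (drift_int x / 2 + \<kappa> k s * x)) has_real_derivative Y * (drift x / 2 + \<kappa> k s)) (at x)"
      unfolding Y_def using drift_int_der by (auto intro!: derivative_eq_intros)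
    have eZ: "((\<lambda>x. (drift x / 2 + \<kappa> k s) * H s x + H1 s x) has_real_derivative 
        (drift x / 2 + \<kappa> k s) * H1 s x + drift' x / 2 * H s x + (- (2 * \<kappa> k s) * H1 s x + defect k s x * H s x)) (at x)"
      using dH[OF s, of x] dH1[OF s, of x] drift_der[of x] by (auto intro!: derivative_eq_intros)
    have D: "(deriv (u s) has_real_derivative Y * ((drift x / 2 + \<kappa> k s) * H1 s x + drift' x / 2 * H s x + (- (2 * \<kappa> k s) * H1 s x + defect k s x * H s x))
         + Y * (drift x / 2 + \<kappa> k s) * ((drift x / 2 + \<kappa> k s) * H s x + H1 s x)) (at x)"
      unfolding deriv_u[OF s] using DERIV_mult'[OF eY eZ] by (simp add: Y_def)
    have R: "drift x * deriv (u s) x + pot k s x * u s x = 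
       Y * (drift x * ((drift x / 2 + \<kappa> k s) * H s x + H1 s x) + pot k s x * H s x)"
    proof -
      have "u s x = Y * H s x" "deriv (u s) x = Y * ((drift x / 2 + \<kappa> k s) * H s x + H1 s x)"
        by (simp_all add: u_def[THEN fun_cong, THEN fun_cong] deriv_u[OF s] Y_def)
      thus ?thesis by (simp add: algebra_simps)
    qed
    have P: "pot k s x = defect k s x - (drift x)\<^sup>2 / 4 + drift' x / 2 + (\<kappa> k s)\<^sup>2"
      using defect_eq[of k s x] radS[OF s] by simp
    show "(deriv (u s) has_real_derivative drift x * deriv (u s) x + pot k s x * u s x) (at x)"
      unfolding R by (rule DERIV_cong[OF D]) (simp add: P algebra_simps power2_eq_square)
  qed
  have exp_bot: "((\<lambda>x. exp (\<delta> * x)) \<longlongrightarrow> 0) at_bot"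
    using \<delta> by (intro filterlim_compose[OF exp_at_bot] filterlim_tendsto_pos_mult_at_bot[OF tendsto_const]) (auto simp: filterlim_ident)
  have H_lim: "(H s \<longlongrightarrow> 1) at_bot" if s: "s \<in> S" for s
  proof -
    have "continuous_on {0..} (h s)"
      by (rule continuous_on_compose_pair[OF h, of _ "\<lambda>_. s" "\<lambda>x. x"]) (use s in auto)
    hence "(h s \<longlongrightarrow> h s 0) (at 0 within {0..})" unfolding continuous_on_def by simp
    moreover have "filterlim (\<lambda>x. exp (\<delta> * x)) (at 0 within {0..}) at_bot"
      unfolding filterlim_at using exp_bot by simp
    ultimately have "((\<lambda>x. h s (exp (\<delta> * x))) \<longlongrightarrow> h s 0) at_bot" by (rule filterlim_compose)
    thus ?thesis using h0[OF s] by (simp add: H_def)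
  qed
  have H1_lim: "(H1 s \<longlongrightarrow> 0) at_bot" if s: "s \<in> S" for s
  proof -
    have "continuous_on {0..1} (\<lambda>T. F s T * h s T)"
      by (intro continuous_on_mult continuous_on_compose_pair[OF F, of _ "\<lambda>_. s" "\<lambda>x. x"] continuous_on_compose_pair[OF h, of _ "\<lambda>_. s" "\<lambda>x. x"]) (use s in auto)
    then obtain M where M: "M > 0" "\<And>T. T \<in> {0..1} \<Longrightarrow> \<bar>F s T * h s T\<bar> \<le> M" using continuous_on_Icc_bounded by blast
    \<comment> \<open>The factor T^b inherited from \<open>A\<close> compensates T^(-b) in
      \<open>H1\<close>, so that H1 = O(T).\<close>
    have r_bound: "\<bar>r s T\<bar> \<le> T powr b s * M" if T: "T \<in> {0..1}" for T
    proof -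
      have "norm (integral {0..1} (\<lambda>\<theta>. A s (T * \<theta>) * h s (T * \<theta>))) \<le> T powr b s * M * (1 - 0)"
      proof (rule integral_bound)
        show "continuous_on {0..1} (\<lambda>\<theta>. A s (T * \<theta>) * h s (T * \<theta>))"
          using T s by (intro continuous_on_mult continuous_on_compose_pair[OF A] continuous_on_compose_pair[OF h] continuous_intros) auto
      next
          fix \<theta> :: real assume \<theta>: "\<theta> \<in> {0..1}"
          have T\<theta>: "T * \<theta> \<in> {0..1}" "T * \<theta> \<le> T" using T \<theta> by (auto intro: mult_le_one mult_left_le)
          have "\<bar>A s (T * \<theta>) * h s (T * \<theta>)\<bar> = (T * \<theta>) powr b s * \<bar>F s (T * \<theta>) * h s (T * \<theta>)\<bar>"
            by (simp add: A_def abs_mult)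
          also have "\<dots> \<le> T powr b s * M"
            using T\<theta> b[OF s] M by (intro mult_mono powr_mono2) auto
          finally show "norm (A s (T * \<theta>) * h s (T * \<theta>)) \<le> T powr b s * M" by simp
      qed simp
      thus ?thesis using r_eq[OF s, of T] T by simp
    qed
    have "((\<lambda>x. \<delta> * M * exp (\<delta> * x)) \<longlongrightarrow> 0) at_bot" using exp_bot by (rule tendsto_mult_right_zero)
    thus ?thesis
    proof (rule Lim_null_comparison[rotated])
      show "eventually (\<lambda>x. norm (H1 s x) \<le> \<delta> * M * exp (\<delta> * x)) at_bot"
        using eventually_le_at_bot[of 0]
      proof eventually_elim
        case (elim x)
        have "exp (\<delta> * x) \<in> {0..1}" using elim \<delta> by (auto simp: mult_nonneg_nonpos)
        from r_bound[OF this] have rb: "\<bar>r s (exp (\<delta> * x))\<bar> \<le> exp (b s * \<delta> * x) * M" by (simp add: powr_def mult_ac)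
        have "norm (H1 s x) = \<delta> * exp (- (b s * \<delta>) * x) * (exp (\<delta> * x) * \<bar>r s (exp (\<delta> * x))\<bar>)"
          unfolding H1_def using \<delta> by (simp add: abs_mult)
        also have "\<dots> \<le> \<delta> * exp (- (b s * \<delta>) * x) * (exp (\<delta> * x) * (exp (b s * \<delta> * x) * M))"
          using rb \<delta> by (intro mult_left_mono) auto
        also have "\<dots> = \<delta> * M * exp (\<delta> * x) * (exp (- (b s * \<delta>) * x) * exp (b s * \<delta> * x))" by (simp add: mult_ac)
        also have "exp (- (b s * \<delta>) * x) * exp (b s * \<delta> * x) = 1" unfolding exp_add[symmetric] by simp
        finally show ?case by simp
      qed
    qed
  qed
  show thesis
  proof (rule that[of u h])
    show "u s x = exp (drift_int x / 2 + \<kappa> k s * x) * h s (exp (c / 4 * x))" for s x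
      by (simp add: u_def H_def \<delta>_def)
    show "continuous_on {s1..s2} (\<lambda>s. deriv (u s) x)" for x
    proof -
      have "continuous_on S (\<lambda>s. exp (drift_int x / 2 + \<kappa> k s * x) * ((drift x / 2 + \<kappa> k s) * H s x + H1 s x))"
        unfolding H_def H1_def
        by (intro continuous_intros \<kappa>_cont b_cont continuous_on_compose_pair[OF h] continuous_on_compose_pair[OF r]) auto
      moreover have "continuous_on S (\<lambda>s. deriv (u s) x) \<longleftrightarrow> 
          continuous_on S (\<lambda>s. exp (drift_int x / 2 + \<kappa> k s * x) * ((drift x / 2 + \<kappa> k s) * H s x + H1 s x))"
        by (intro continuous_on_cong) (auto simp: deriv_u)
      ultimately show ?thesis by (simp add: S_def)
    qed
    show "((\<lambda>x. deriv (u s) x / u s x) \<longlongrightarrow> c / (2 * \<epsilon>) + \<kappa> k s) at_bot" if "s \<in> {s1..s2}" for s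
    proof -
      have s: "s \<in> S" using that by (simp add: S_def)
      have "(drift \<longlongrightarrow> (c - 2 * 0 / (m - 2)) / \<epsilon>) at_bot"
        unfolding drift_def[abs_def] using m \<epsilon> by (intro tendsto_intros p_at_bot p1_at_bot) auto
      hence "((\<lambda>x. drift x / 2 + \<kappa> k s + H1 s x / H s x) \<longlongrightarrow> (c - 2 * 0 / (m - 2)) / \<epsilon> / 2 + \<kappa> k s + 0 / 1) at_bot"
        by (intro tendsto_intros H_lim[OF s] H1_lim[OF s]) auto
      moreover have "eventually (\<lambda>x. drift x / 2 + \<kappa> k s + H1 s x / H s x = deriv (u s) x / u s x) at_bot"
      proof -
        have "eventually (\<lambda>x. H s x > 0) at_bot" by (rule order_tendstoD(1)[OF H_lim[OF s]]) simp
        thus ?thesis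
        proof eventually_elim
          case (elim x)
          have "deriv (u s) x / u s x = ((drift x / 2 + \<kappa> k s) * H s x + H1 s x) / H s x"
            unfolding deriv_u[OF s] by (simp add: u_def)
          thus ?case using elim by (simp add: add_divide_distrib)
        qed
      qed
      ultimately have "((\<lambda>x. deriv (u s) x / u s x) \<longlongrightarrow> (c - 2 * 0 / (m - 2)) / \<epsilon> / 2 + \<kappa> k s + 0 / 1) at_bot"
        by (rule Lim_transform_eventually)
      thus ?thesis by (simp add: mult.commute)
    qed
  qed (use sol h h0 in \<open>auto simp: S_def\<close>)
qed

end

section \<open>Shooting in the spectral parameter\<close>

lemma interval_not_covered:
  fixes a b :: real
  assumes "a < b" "P a" "Q b"
    and P: "\<And>s. s \<in> {a..b} \<Longrightarrow> P s \<Longrightarrow> \<exists>d>0. \<forall>t\<in>{a..b}. dist t s < d \<longrightarrow> P t"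
    and Q: "\<And>s. s \<in> {a..b} \<Longrightarrow> Q s \<Longrightarrow> \<exists>d>0. \<forall>t\<in>{a..b}. dist t s < d \<longrightarrow> Q t"
    and disj: "\<And>s. s \<in> {a..b} \<Longrightarrow> P s \<Longrightarrow> \<not> Q s"
  obtains s where "a < s" "s < b" "\<not> P s" "\<not> Q s"
proof -
  have o: "openin (top_of_set {a..b}) {s\<in>{a..b}. P s}" "openin (top_of_set {a..b}) {s\<in>{a..b}. Q s}"
    unfolding openin_euclidean_subtopology_iff using P Q by auto
  have "\<not> {a..b} \<subseteq> {s\<in>{a..b}. P s} \<union> {s\<in>{a..b}. Q s}"
  proof
    assume cover: "{a..b} \<subseteq> {s\<in>{a..b}. P s} \<union> {s\<in>{a..b}. Q s}"
    have "{s\<in>{a..b}. P s} \<inter> {s\<in>{a..b}. Q s} = {}" using disj by auto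
    moreover have "a \<in> {s\<in>{a..b}. P s}" "b \<in> {s\<in>{a..b}. Q s}" using assms(1-3) by auto
    ultimately show False
      using connected_Icc[of a b] o cover unfolding connected_openin by (metis empty_iff)
  qed
  hence "\<exists>s\<in>{a..b}. \<not> P s \<and> \<not> Q s" by blast
  then obtain s where s: "s \<in> {a..b}" "\<not> P s" "\<not> Q s" by blast
  moreover have "s \<noteq> a" "s \<noteq> b" using s assms by auto
  ultimately show thesis using that[of s] by simp
qed

context wave
begin

text \<open>What the barriers need to know of the solution from -\<infinity>: its sign and its
  logarithmic derivative, whose limit is r^+. They thereby do not depend on how it was
  constructed.\<close>

definition "decaying k s u \<longleftrightarrow> solves k s u \<and> eventually (\<lambda>x. u x > 0) at_bot \<and>
  ((\<lambda>x. deriv u x / u x) \<longlongrightarrow> c / (2 * \<epsilon>) + \<kappa> k s) at_bot \<and> (u \<longlongrightarrow> 0) at_bot \<and> maximal_decay m \<epsilon> k c s u"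

text \<open>Equals (p')^2 (u / p')', so its sign tells whether the quotient v = u / p'
  increases.\<close>

definition "flux u x = deriv u x * p1 x - u x * p2 x"

text \<open>The last condition makes turning irreversible: the potential increases with p, so it
  stays positive to the right of \<open>X\<close>.\<close>

definition "turned k s u \<longleftrightarrow> (\<exists>X. (\<forall>x\<le>X. u x > 0) \<and> flux u X > 0 \<and> k\<^sup>2 * p X powr (m / (m - 2)) > s)"

text \<open>A wave is only assumed to be twice differentiable; the wave equation expresses p''
  through p and p', and differentiating that expression provides the third derivative.\<close>

lemma solves_p1: "solves 0 0 p1"
  unfolding solves_def
proof (intro allI conjI)
  fix x
  show "(p1 has_real_derivative p2 x) (at x)" by (rule p1_der)
  have p2_eq: "p2 = (\<lambda>x. ((c - p1 x / (m - 2)) * p1 x - G (p x)) / p x)"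
  proof
    fix x show "p2 x = ((c - p1 x / (m - 2)) * p1 x - G (p x)) / p x"
      using ode[of x] p_pos[of x] by (simp add: eq_divide_eq mult.commute)
  qed
  have dG: "((\<lambda>x. G (p x)) has_real_derivative deriv01 G (p x) * p1 x) (at x)"
    using DERIV_chain2[OF ignition_has_derivative[OF ign p_pos p_less_1] p_der] .
  have dN: "((\<lambda>x. (c - p1 x / (m - 2)) * p1 x - G (p x)) has_real_derivative
      (c - p1 x / (m - 2)) * p2 x + (- (p2 x / (m - 2))) * p1 x - deriv01 G (p x) * p1 x) (at x)"
    using p1_der[of x] dG m by (auto intro!: derivative_eq_intros)
  have "p x \<noteq> 0" using p_pos[of x] by simp
  have "((\<lambda>x. ((c - p1 x / (m - 2)) * p1 x - G (p x)) / p x) has_real_derivative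
     (((c - p1 x / (m - 2)) * p2 x + (- (p2 x / (m - 2))) * p1 x - deriv01 G (p x) * p1 x) * p x
       - (p x * p2 x) * p1 x) / (p x * p x)) (at x)"
    using DERIV_divide[OF dN p_der \<open>p x \<noteq> 0\<close>] unfolding ode .
  moreover have "(((c - p1 x / (m - 2)) * p2 x + (- (p2 x / (m - 2))) * p1 x - deriv01 G (p x) * p1 x) * p x
       - (p x * p2 x) * p1 x) / (p x * p x) = drift x * p2 x + pot 0 0 x * p1 x"
  proof -
    have quot: "(N * p x - (p x * a) * b) / (p x * p x) = (N - a * b) / p x" for N a b
      using \<open>p x \<noteq> 0\<close> by (simp add: field_simps)
    have "(c - p1 x / (m - 2)) * p2 x + (- (p2 x / (m - 2))) * p1 x - deriv01 G (p x) * p1 x - p2 x * p1 x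
        = (c - 2 * p1 x / (m - 2)) * p2 x + (- p2 x - deriv01 G (p x)) * p1 x"
      by (simp add: algebra_simps)
    thus ?thesis unfolding quot drift_def pot_def by (simp add: add_divide_distrib)
  qed
  ultimately show "(p2 has_real_derivative drift x * p2 x + pot 0 0 x * p1 x) (at x)"
    by (subst p2_eq) simp
qed

lemma flux_der:
  assumes "solves k s u"
  shows "(flux u has_real_derivative drift x * flux u x + (k\<^sup>2 * p x powr (m / (m - 2)) - s) / p x * (u x * p1 x)) (at x)"
proof -
  have "(flux u has_real_derivative drift x * flux u x + (pot k s x - pot 0 0 x) * (u x * p1 x)) (at x)"
    unfolding flux_def[abs_def]
    using solvesD[OF assms, of x] solvesD[OF solves_p1, of x]
    by (auto intro!: derivative_eq_intros simp: algebra_simps)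
  moreover have "pot k s x - pot 0 0 x = (k\<^sup>2 * p x powr (m / (m - 2)) - s) / p x"
    unfolding pot_def by (simp add: diff_divide_distrib)
  ultimately show ?thesis by simp
qed

lemma quotient_der:
  assumes "solves k s u"
  shows "((\<lambda>x. u x / p1 x) has_real_derivative flux u x / (p1 x)\<^sup>2) (at x)"
  using DERIV_divide[OF solvesD(1)[OF assms, of x] p1_der] p1_pos[of x]
  by (simp add: flux_def power2_eq_square)

text \<open>A zero of a nonnegative solution is a double zero, and uniqueness would spread it to
  where u is positive.\<close>

lemma nonneg_solution_pos:
  assumes u: "solves k s u" and nonneg: "\<And>x. u x \<ge> 0" and ev: "eventually (\<lambda>x. u x > 0) at_bot"
  shows "u x > 0"
proof (rule ccontr)
  assume "\<not> u x > 0"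
  hence ux: "u x = 0" using nonneg[of x] by simp
  have du: "deriv u x = 0"
    by (rule DERIV_local_min[OF solvesD(1)[OF u, of x], of 1]) (use ux nonneg in auto)
  obtain a where a: "\<And>y. y \<le> a \<Longrightarrow> u y > 0" using ev unfolding eventually_at_bot_linorder by blast
  obtain K where K: "K > 0" "\<And>u x. \<bar>drift x * deriv u x + pot k s x * u x\<bar> \<le> K * (\<bar>u x\<bar> + \<bar>deriv u x\<bar>)"
    using solves_second_derivative_bound by blast
  have "u (min a x) = 0"
    by (rule second_order_uniqueness[of "min a x" x u "deriv u" "\<lambda>x. drift x * deriv u x + pot k s x * u x" K x])
       (use solvesD[OF u] K ux du in auto)
  thus False using a[of "min a x"] by simp
qed

text \<open>To the right of \<open>X\<close>, the quotient u / p' grows while the flux is positive,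
  and the flux stays positive while the quotient is positive.\<close>

lemma turned_pos:
  assumes u: "solves k s u" and "turned k s u"
  shows "u x > 0"
proof -
  obtain X where X: "\<And>x. x \<le> X \<Longrightarrow> u x > 0" "flux u X > 0" "k\<^sup>2 * p X powr (m / (m - 2)) > s"
    using assms(2) unfolding turned_def by blast
  show ?thesis
  proof (cases "x \<le> X")
    case False
    hence le: "X \<le> x" by simp
    have "u x / p1 x > 0"
    proof (rule linear_system_pos(1)[where f = "\<lambda>x. u x / p1 x" and g = "flux u" and \<alpha> = "\<lambda>_. 0" and \<gamma> = drift, OF le])
      show "continuous_on {X..x} drift" by (rule continuous_on_subset[OF drift_cont]) simp
      show "((\<lambda>x. u x / p1 x) has_real_derivative flux u y / (p1 y)\<^sup>2) (at y)" for y by (rule quotient_der[OF u])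
      show "(flux u has_real_derivative drift y * flux u y + (k\<^sup>2 * p y powr (m / (m - 2)) - s) / p y * (u y * p1 y)) (at y)" for y
        by (rule flux_der[OF u])
      show "0 < u X / p1 X" using X(1)[of X] p1_pos by simp
      fix y assume y: "y \<in> {X..x}" "0 < u y / p1 y" "0 < flux u y"
      show "0 * (u y / p1 y) \<le> flux u y / (p1 y)\<^sup>2" using y by simp
      have "p X powr (m / (m - 2)) \<le> p y powr (m / (m - 2))"
        using p_mono[of X y] p_pos[of X] m y by (intro powr_mono2) auto
      hence "k\<^sup>2 * p X powr (m / (m - 2)) \<le> k\<^sup>2 * p y powr (m / (m - 2))" by (intro mult_left_mono) auto
      moreover have "u y > 0" using y(2) p1_pos[of y] by (simp add: zero_less_divide_iff)
      ultimately show "drift y * flux u y \<le> drift y * flux u y + (k\<^sup>2 * p y powr (m / (m - 2)) - s) / p y * (u y * p1 y)"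
        using X(3) p_pos[of y] p1_pos[of y] by simp
    qed (use X in auto)
    thus ?thesis using p1_pos[of x] by (simp add: zero_less_divide_iff)
  qed (use X in simp)
qed

text \<open>As s < k^2, the potential is eventually positive. There a solution that has not turned
  has nonpositive flux, so it is dominated by a multiple of p', which tends to 0.\<close>

lemma ground_state_tail:
  assumes u: "solves k s u" "\<And>x. u x > 0" "\<not> turned k s u" and s: "s < k\<^sup>2"
  shows "(u \<longlongrightarrow> 0) at_top"
proof -
  have "((\<lambda>x. k\<^sup>2 * p x powr (m / (m - 2))) \<longlongrightarrow> k\<^sup>2 * 1 powr (m / (m - 2))) at_top"
    by (intro tendsto_intros p_at_top) auto
  hence "eventually (\<lambda>x. k\<^sup>2 * p x powr (m / (m - 2)) > s) at_top" by (rule order_tendstoD) (use s in simp)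
  then obtain a where a: "\<And>x. x \<ge> a \<Longrightarrow> k\<^sup>2 * p x powr (m / (m - 2)) > s" unfolding eventually_at_top_linorder by blast
  have neg: "flux u x \<le> 0" if "x \<ge> a" for x
    using u(2,3) a[OF that] unfolding turned_def by (meson not_le)
  have le: "u x \<le> u a / p1 a * p1 x" if x: "x \<ge> a" for x
  proof -
    have "u x / p1 x \<le> u a / p1 a"
    proof (rule DERIV_nonpos_imp_nonincreasing[OF x, where f = "\<lambda>x. u x / p1 x"])
      fix t assume "a \<le> t"
      hence "flux u t / (p1 t)\<^sup>2 \<le> 0" using neg[of t] by (simp add: divide_nonpos_nonneg)
      thus "\<exists>y. ((\<lambda>x. u x / p1 x) has_real_derivative y) (at t) \<and> y \<le> 0" using quotient_der[OF u(1)] by blast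
    qed
    thus ?thesis using p1_pos[of x] by (simp add: divide_le_eq)
  qed
  have "((\<lambda>x. u a / p1 a * p1 x) \<longlongrightarrow> 0) at_top" using p1_at_top by (rule tendsto_mult_right_zero)
  thus ?thesis
    by (rule Lim_null_comparison[OF eventually_mono[OF eventually_ge_at_top[of a]], rotated])
       (use le u(2) in \<open>auto simp: less_imp_le\<close>)
qed

lemma exponent_plus_Re:
  assumes "radicand k s \<ge> 0"
  shows "Re (exponent_plus m \<epsilon> k c s) = c / (2 * \<epsilon>) + \<kappa> k s"
proof -
  have "csqrt (of_real (radicand k s)) = of_real (sqrt (radicand k s))" using assms by (intro of_real_sqrt[symmetric])
  hence "Re (exponent_plus m \<epsilon> k c s) = (c + sqrt (radicand k s)) / (2 * \<epsilon>)"
    unfolding exponent_plus_def by (simp only: Re_divide_of_real plus_complex.simps Re_complex_of_real)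
  thus ?thesis by (simp add: \<kappa>_def add_divide_distrib)
qed

lemma family_decaying:
  assumes rad: "radicand k s > 0" and sol: "solves k s u"
    and h: "continuous_on {0..} h" "h 0 = (1 :: real)"
    and u: "\<And>x. u x = exp (drift_int x / 2 + \<kappa> k s * x) * h (exp (c / 4 * x))"
    and lim: "((\<lambda>x. deriv u x / u x) \<longlongrightarrow> c / (2 * \<epsilon>) + \<kappa> k s) at_bot"
  shows "decaying k s u"
proof -
  have exp_bot: "((\<lambda>x. exp (d * x)) \<longlongrightarrow> 0) at_bot" if "d > 0" for d :: real
    using that by (intro filterlim_compose[OF exp_at_bot] filterlim_tendsto_pos_mult_at_bot[OF tendsto_const]) (auto simp: filterlim_ident)
  have \<kappa>: "\<kappa> k s > 0" using rad \<epsilon> by (simp add: \<kappa>_def)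
  have "(h \<longlongrightarrow> h 0) (at 0 within {0..})" using h(1) unfolding continuous_on_def by simp
  moreover have "filterlim (\<lambda>x. exp (c / 4 * x)) (at 0 within {0..}) at_bot"
    unfolding filterlim_at using exp_bot[of "c / 4"] c_pos by simp
  ultimately have h_lim: "((\<lambda>x. h (exp (c / 4 * x))) \<longlongrightarrow> 1) at_bot"
    using filterlim_compose h(2) by metis
  obtain C x0 where C: "\<And>x. x \<le> x0 \<Longrightarrow> drift_int x \<le> c / \<epsilon> * x + C" using drift_int_upper by blast
  have "eventually (\<lambda>x. h (exp (c / 4 * x)) > 0) at_bot" by (rule order_tendstoD(1)[OF h_lim]) simp
  hence pos: "eventually (\<lambda>x. u x > 0) at_bot" by eventually_elim (simp add: u)
  have "eventually (\<lambda>x. h (exp (c / 4 * x)) < 2) at_bot" by (rule order_tendstoD(2)[OF h_lim]) simp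
  with pos have bound: "eventually (\<lambda>x. norm (u x) \<le> 2 * exp (C / 2) * norm (exp ((c / (2 * \<epsilon>) + \<kappa> k s) * x))) at_bot"
    using eventually_le_at_bot[of x0]
  proof eventually_elim
    case (elim x)
    have "u x \<le> exp (drift_int x / 2 + \<kappa> k s * x) * 2" unfolding u using elim by (intro mult_left_mono) auto
    also have "\<dots> \<le> exp (C / 2 + (c / (2 * \<epsilon>) + \<kappa> k s) * x) * 2"
      using C[OF elim(3)] by (intro mult_right_mono) (auto simp: algebra_simps)
    finally show ?case using elim(1) by (simp add: exp_add)
  qed
  have "maximal_decay m \<epsilon> k c s u"
    unfolding maximal_decay_def exponent_plus_Re[OF less_imp_le[OF rad]] by (rule bigoI[OF bound])
  moreover have "(u \<longlongrightarrow> 0) at_bot"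
  proof (rule Lim_null_comparison[OF bound])
    have "c / (2 * \<epsilon>) + \<kappa> k s > 0" using c_pos \<epsilon> \<kappa> by (simp add: add_pos_pos)
    hence "((\<lambda>x. 2 * exp (C / 2) * exp ((c / (2 * \<epsilon>) + \<kappa> k s) * x)) \<longlongrightarrow> 0) at_bot"
      by (intro tendsto_mult_right_zero exp_bot)
    thus "((\<lambda>x. 2 * exp (C / 2) * norm (exp ((c / (2 * \<epsilon>) + \<kappa> k s) * x))) \<longlongrightarrow> 0) at_bot" by simp
  qed
  ultimately show ?thesis unfolding decaying_def using sol pos lim by blast
qed

text \<open>Shooting in s with the conditions "turned" and "negative somewhere". The parameter
  satisfying neither gives a nonnegative, hence positive, solution that never turns, and so decays
  at +\<infinity>.\<close>

lemma ground_state_exists: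
  assumes s12: "s1 < s2" "s2 < k\<^sup>2" and rad: "radicand k s2 > 0"
    and low: "\<And>u. decaying k s1 u \<Longrightarrow> turned k s1 u"
    and high: "\<And>u. decaying k s2 u \<Longrightarrow> \<exists>x. u x \<le> 0"
  obtains s v where "s1 < s" "s < s2" "v \<in> eigenspace m G \<epsilon> k c p s" "\<And>x. v x > 0"
proof -
  obtain u h where sol: "\<And>s. s \<in> {s1..s2} \<Longrightarrow> solves k s (u s)"
    and h: "continuous_on ({s1..s2} \<times> {0..}) (\<lambda>(s, T). h s T)"
    and h0: "\<And>s. s \<in> {s1..s2} \<Longrightarrow> h s 0 = (1 :: real)"
    and u_eq: "\<And>s x. u s x = exp (drift_int x / 2 + \<kappa> k s * x) * h s (exp (c / 4 * x))"
    and du: "\<And>x. continuous_on {s1..s2} (\<lambda>s. deriv (u s) x)"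
    and lim: "\<And>s. s \<in> {s1..s2} \<Longrightarrow> ((\<lambda>x. deriv (u s) x / u s x) \<longlongrightarrow> c / (2 * \<epsilon>) + \<kappa> k s) at_bot"
    using maximal_decay_family[OF rad] by blast
  have rad': "radicand k s > 0" if "s \<in> {s1..s2}" for s
  proof -
    have "4 * \<epsilon> * (k\<^sup>2 * \<epsilon> powr (m / (m - 2)) - s) \<ge> 4 * \<epsilon> * (k\<^sup>2 * \<epsilon> powr (m / (m - 2)) - s2)"
      using that \<epsilon> by (intro mult_left_mono) auto
    thus ?thesis using rad by linarith
  qed
  have dec: "decaying k s (u s)" if s: "s \<in> {s1..s2}" for s
    by (rule family_decaying[OF rad'[OF s] sol[OF s] _ h0[OF s] u_eq lim[OF s]], rule continuous_on_compose_pair[OF h, of _ "\<lambda>_. s" "\<lambda>x. x"])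
       (use s in auto)
  have cont_u: "continuous_on {s1..s2} (\<lambda>s. u s x)" for x
    unfolding u_eq \<kappa>_def using \<epsilon>
    by (intro continuous_intros continuous_on_compose_pair[OF h]) auto
  have cont_flux: "continuous_on {s1..s2} (\<lambda>s. flux (u s) x)" for x
    unfolding flux_def by (intro continuous_intros du cont_u)
  have nbhd: "\<exists>d>0. \<forall>t\<in>{s1..s2}. dist t s < d \<longrightarrow> f t > y"
    if f: "continuous_on {s1..s2} f" "s \<in> {s1..s2}" "f s > y" for f :: "real \<Rightarrow> real" and y s
  proof -
    have "(f \<longlongrightarrow> f s) (at s within {s1..s2})" using f unfolding continuous_on_def by simp
    hence "eventually (\<lambda>t. f t > y) (at s within {s1..s2})" using f(3) by (rule order_tendstoD)
    then obtain d where "d > 0" "\<forall>t\<in>{s1..s2}. t \<noteq> s \<and> dist t s < d \<longrightarrow> f t > y"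
      unfolding eventually_at by blast
    thus ?thesis using f(3) by metis
  qed
  obtain s where s: "s1 < s" "s < s2" "\<not> turned k s (u s)" "\<not> (\<exists>x. u s x < 0)"
  proof (rule interval_not_covered[OF s12(1), where P = "\<lambda>s. turned k s (u s)" and Q = "\<lambda>s. \<exists>x. u s x < 0"])
    show "turned k s1 (u s1)" using low dec s12 by simp
    show "\<exists>x. u s2 x < 0"
    proof (rule ccontr)
      assume "\<not> (\<exists>x. u s2 x < 0)"
      hence nonneg: "u s2 x \<ge> 0" for x by (simp add: not_less)
      \<comment> \<open>\<open>high\<close> provides only a point with u \<le> 0, whereas openness
        in s needs a strict sign; a nonnegative solution cannot touch zero.\<close>
      have "u s2 x > 0" for x
        using nonneg_solution_pos[OF sol nonneg] dec[of s2] s12 unfolding decaying_def by simp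
      thus False using high[OF dec[of s2]] s12 by (fastforce simp: not_less[symmetric])
    qed
    fix s assume s: "s \<in> {s1..s2}"
    show "\<not> (\<exists>x. u s x < 0)" if "turned k s (u s)"
      using turned_pos[OF sol[OF s] that] by (meson not_less_iff_gr_or_eq)
    show "\<exists>d>0. \<forall>t\<in>{s1..s2}. dist t s < d \<longrightarrow> (\<exists>x. u t x < 0)" if neg: "\<exists>x. u s x < 0"
    proof -
      obtain x where "u s x < 0" using neg by blast
      then obtain d where "d > 0" "\<forall>t\<in>{s1..s2}. dist t s < d \<longrightarrow> - u t x > 0"
        using nbhd[OF continuous_on_minus[OF cont_u[of x]] s, of 0] by auto
      thus ?thesis by (intro exI[of _ d]) auto
    qed
    show "\<exists>d>0. \<forall>t\<in>{s1..s2}. dist t s < d \<longrightarrow> turned k t (u t)" if tu: "turned k s (u s)"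
    proof -
      obtain X where X: "\<And>x. x \<le> X \<Longrightarrow> u s x > 0" "flux (u s) X > 0" "k\<^sup>2 * p X powr (m / (m - 2)) > s"
        using tu unfolding turned_def by blast
      \<comment> \<open>In T the half line x \<le> X together with -\<infinity> is the compact
        interval {0..E}. There \<open>h s\<close> has a positive minimum, so by uniform continuity
        positivity persists for nearby parameters.\<close>
      define E where "E = exp (c / 4 * X)"
      have h_pos: "h s T > 0" if T: "T \<in> {0..E}" for T
      proof (cases "T = 0")
        case False
        define x where "x = 4 / c * ln T"
        have x: "exp (c / 4 * x) = T" unfolding x_def using False T c_pos by simp
        have "exp (c / 4 * x) \<le> exp (c / 4 * X)" unfolding x using T by (simp add: E_def)
        hence "x \<le> X" using c_pos by simp
        from X(1)[OF this] show ?thesis unfolding u_eq x by (simp add: zero_less_mult_iff)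
      qed (use h0[OF s] in simp)
      have hs_cont: "continuous_on {0..E} (h s)"
        by (rule continuous_on_compose_pair[OF h, of _ "\<lambda>_. s" "\<lambda>x. x"]) (use s in auto)
      have "E > 0" by (simp add: E_def)
      obtain T0 where T0: "T0 \<in> {0..E}" "\<And>T. T \<in> {0..E} \<Longrightarrow> h s T0 \<le> h s T"
        using continuous_attains_inf[OF compact_Icc _ hs_cont] \<open>E > 0\<close> by auto
      have "compact ({s1..s2} \<times> {0..E})" by (intro compact_Times) auto
      moreover have "continuous_on ({s1..s2} \<times> {0..E}) (\<lambda>(s, T). h s T)" by (rule continuous_on_subset[OF h]) auto
      ultimately have "uniformly_continuous_on ({s1..s2} \<times> {0..E}) (\<lambda>(s, T). h s T)"
        by (intro compact_uniformly_continuous)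
      then obtain d1 where d1: "d1 > 0" "\<And>x y. x \<in> {s1..s2} \<times> {0..E} \<Longrightarrow> y \<in> {s1..s2} \<times> {0..E} \<Longrightarrow> dist y x < d1 \<Longrightarrow> 
          dist (case y of (s, T) \<Rightarrow> h s T) (case x of (s, T) \<Rightarrow> h s T) < h s T0"
        unfolding uniformly_continuous_on_def using h_pos[OF T0(1)] by meson
      have h_near: "h t T > 0" if t: "t \<in> {s1..s2}" "dist t s < d1" and T: "T \<in> {0..E}" for t T
      proof -
        have "dist (t, T) (s, T) < d1" using t by (simp add: dist_Pair_Pair)
        hence "dist (h t T) (h s T) < h s T0" using d1(2)[of "(s, T)" "(t, T)"] t s T by simp
        thus ?thesis using T0(2)[OF T] by (simp add: dist_real_def)
      qed
      obtain d2 where d2: "d2 > 0" "\<forall>t\<in>{s1..s2}. dist t s < d2 \<longrightarrow> flux (u t) X > 0"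
        using nbhd[OF cont_flux[of X] s X(2)] by blast
      define d3 where "d3 = k\<^sup>2 * p X powr (m / (m - 2)) - s"
      have d3: "d3 > 0" using X(3) by (simp add: d3_def)
      have "turned k t (u t)" if t: "t \<in> {s1..s2}" "dist t s < min d1 (min d2 d3)" for t
        unfolding turned_def
      proof (intro exI[of _ X] conjI allI impI)
        fix x assume "x \<le> X"
        hence "exp (c / 4 * x) \<in> {0..E}" using c_pos by (simp add: E_def)
        thus "u t x > 0" unfolding u_eq using h_near t by simp
      qed (use t d2 in \<open>auto simp: dist_real_def d3_def\<close>)
      thus ?thesis using d1(1) d2(1) d3 by (intro exI[of _ "min d1 (min d2 d3)"]) auto
    qed
  qed (use s12 in auto)
  have sS: "s \<in> {s1..s2}" using s by simp
  have pos: "u s x > 0" for x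
    using nonneg_solution_pos[OF sol[OF sS]] s(4) dec[OF sS] unfolding decaying_def by (simp add: not_less)
  have "(u s \<longlongrightarrow> 0) at_top" by (rule ground_state_tail[OF sol[OF sS] pos s(3)]) (use s s12 in simp)
  hence "u s \<in> eigenspace m G \<epsilon> k c p s" unfolding eigenspace_iff using dec[OF sS] unfolding decaying_def by blast
  thus thesis using that s pos by blast
qed

end

section \<open>Comparison with the limit problem\<close>

text \<open>\<open>c_eq\<close> means \<Lambda>^(m-1) = c / k. With p^(1/(m-2)) measured in units of
  \<Lambda> and s in units of \<open>M\<close>, this balance removes c, k and \<open>M\<close> from
  the equation below \<theta>.\<close>

locale scaled_wave = wave +
  fixes k \<Lambda> M :: real
  assumes \<Lambda>: "\<Lambda> > 0" and k: "k > 0" and M_eq: "M = k\<^sup>2 * \<Lambda> powr m" and c_eq: "c\<^sup>2 = M * \<Lambda> powr (m - 2)"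
begin

text \<open>The only parameter, besides s / M, left in the rescaled equation; setting it to 0 gives
  the limit problem.\<close>

definition "e1 = e / \<Lambda>"
definition "\<tau> x = (p x powr n - e) / \<Lambda>"
definition "g1 = e1 powr (m - 2)"

lemma M_pos: "M > 0" unfolding M_eq using k \<Lambda> by simp

lemma e1_pos: "e1 > 0" using e_pos \<Lambda> by (simp add: e1_def)

lemma \<tau>_pos: "\<tau> x > 0" using z_gt[of x] \<Lambda> by (simp add: \<tau>_def)

lemma z_eq: "p x powr n = \<Lambda> * (e1 + \<tau> x)"
  using \<Lambda> by (simp add: e1_def \<tau>_def field_simps)

lemma p_eq: "p x = \<Lambda> powr (m - 2) * (e1 + \<tau> x) powr (m - 2)"
proof -
  have "p x = (p x powr n) powr (m - 2)" unfolding powr_powr n_mult using p_pos[of x] by simp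
  thus ?thesis unfolding z_eq using \<Lambda> e1_pos \<tau>_pos[of x] by (simp add: powr_mult)
qed

lemma \<epsilon>_eq: "\<epsilon> = \<Lambda> powr (m - 2) * g1"
proof -
  have "\<epsilon> = e powr (m - 2)" unfolding powr_powr n_mult using \<epsilon> by simp
  moreover have "e = \<Lambda> * e1" using \<Lambda> by (simp add: e1_def)
  ultimately show ?thesis unfolding g1_def using \<Lambda> e1_pos by (simp add: powr_mult)
qed

lemma potential_eq: "k\<^sup>2 * p x powr (m / (m - 2)) = M * (e1 + \<tau> x) powr m"
proof -
  have "p x powr (m / (m - 2)) = (p x powr n) powr m" unfolding powr_powr by simp
  thus ?thesis unfolding z_eq M_eq using \<Lambda> e1_pos \<tau>_pos[of x] by (simp add: powr_mult)
qed

lemma potential_\<epsilon>_eq: "k\<^sup>2 * \<epsilon> powr (m / (m - 2)) = M * e1 powr m"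
proof -
  have "\<epsilon> powr (m / (m - 2)) = e powr m" unfolding powr_powr by simp
  moreover have "e = \<Lambda> * e1" using \<Lambda> by (simp add: e1_def)
  ultimately show ?thesis unfolding M_eq using \<Lambda> e1_pos by (simp add: powr_mult)
qed

lemma c2_p: "c\<^sup>2 * (e1 + \<tau> x) powr (m - 2) = M * p x"
  unfolding c_eq by (subst p_eq[of x]) simp

lemma radicand_eq: "radicand k (y * M) = c\<^sup>2 * (1 + 4 * g1 * (e1 powr m - y))"
proof -
  have "\<epsilon> * M = c\<^sup>2 * g1" unfolding c_eq by (subst \<epsilon>_eq) simp
  hence "4 * \<epsilon> * (M * e1 powr m - y * M) = 4 * (c\<^sup>2 * g1) * (e1 powr m - y)" by (metis (no_types, opaque_lifting) mult.assoc mult.commute right_diff_distrib)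
  thus ?thesis unfolding potential_\<epsilon>_eq by (simp add: algebra_simps)
qed

text \<open>With a = e1^m - s / M the right-hand side is (sqrt (1 + 4 g1 a) - 1) / (2 g1), which
  tends to a as g1 -> 0. It is the initial slope of the rescaled problem, to be compared with r(0) /
  v(0) = -\<sigma>.\<close>

lemma \<kappa>_M: "c / M * (\<kappa> k s - c / (2 * \<epsilon>)) = (sqrt (radicand k s) / c - 1) / (2 * g1)"
proof -
  have eM: "\<epsilon> * M = c\<^sup>2 * g1" unfolding c_eq by (subst \<epsilon>_eq) simp
  have "g1 > 0" unfolding g1_def using e1_pos by simp
  have "c / M * (\<kappa> k s - c / (2 * \<epsilon>)) = c * (sqrt (radicand k s) - c) / (2 * (\<epsilon> * M))"
  proof -
    have "c / M * (S / (2 * \<epsilon>) - c / (2 * \<epsilon>)) = c * (S - c) / (2 * (\<epsilon> * M))" for S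
      using M_pos \<epsilon> by (simp add: field_simps)
    thus ?thesis unfolding \<kappa>_def .
  qed
  also have "\<dots> = (sqrt (radicand k s) / c - 1) / (2 * g1)"
    unfolding eM using c_pos \<open>g1 > 0\<close> by (simp add: field_simps power2_eq_square)
  finally show ?thesis .
qed

text \<open>Lowering the parameter by \<delta> raises the slope to about -\<sigma> + \<delta>.
  Squaring 1 - 2 g1 \<sigma> < sqrt (1 + 4 g1 a) shows that g1 \<sigma>^2 < \<delta> makes this
  rigorous.\<close>

lemma initial_slope_low:
  assumes "g1 * \<sigma>\<^sup>2 < \<delta>"
  shows "c / M * (\<kappa> k ((\<sigma> - \<delta>) * M) - c / (2 * \<epsilon>)) > - \<sigma>"
proof -
  have g: "g1 > 0" unfolding g1_def using e1_pos by simp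
  have "e1 powr m > 0" using e1_pos by simp
  hence "g1 * \<sigma>\<^sup>2 < e1 powr m + \<delta>" using assms by linarith
  hence "4 * g1 * (g1 * \<sigma>\<^sup>2) < 4 * g1 * (e1 powr m + \<delta>)" using g by simp
  hence "(1 - 2 * g1 * \<sigma>)\<^sup>2 < 1 + 4 * g1 * (e1 powr m - (\<sigma> - \<delta>))"
    by (simp add: power2_eq_square algebra_simps)
  hence "(c * (1 - 2 * g1 * \<sigma>))\<^sup>2 < radicand k ((\<sigma> - \<delta>) * M)"
    unfolding radicand_eq power_mult_distrib using c_pos by simp
  hence "c * (1 - 2 * g1 * \<sigma>) < sqrt (radicand k ((\<sigma> - \<delta>) * M))" by (rule real_less_rsqrt)
  thus ?thesis unfolding \<kappa>_M using g c_pos by (simp add: field_simps)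
qed

lemma initial_slope_high:
  assumes "e1 powr m < \<delta>" "2 * g1 * \<sigma> < 1"
  shows "c / M * (\<kappa> k ((\<sigma> + \<delta>) * M) - c / (2 * \<epsilon>)) < - \<sigma>"
proof -
  have g: "g1 > 0" unfolding g1_def using e1_pos by simp
  have "4 * g1 * (e1 powr m - \<delta>) < 0" using assms(1) g by (simp add: mult_pos_neg)
  also have "0 \<le> 4 * (g1 * \<sigma>)\<^sup>2" by simp
  finally have "1 + 4 * g1 * (e1 powr m - (\<sigma> + \<delta>)) < (1 - 2 * g1 * \<sigma>)\<^sup>2"
    by (simp add: power2_eq_square algebra_simps)
  hence "radicand k ((\<sigma> + \<delta>) * M) < (c * (1 - 2 * g1 * \<sigma>))\<^sup>2"
    unfolding radicand_eq power_mult_distrib using c_pos by simp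
  moreover have "c * (1 - 2 * g1 * \<sigma>) > 0" using assms(2) c_pos by simp
  ultimately have "sqrt (radicand k ((\<sigma> + \<delta>) * M)) < c * (1 - 2 * g1 * \<sigma>)" by (intro real_less_lsqrt) auto
  thus ?thesis unfolding \<kappa>_M using g c_pos by (simp add: field_simps)
qed

section \<open>The scaled variable and the scaled flux\<close>

lemma \<tau>_der:
  assumes "p x \<le> \<theta>"
  shows "(\<tau> has_real_derivative c * \<tau> x / p x) (at x)"
proof -
  have "(\<tau> has_real_derivative (p x powr n * (p1 x * n / p x) - 0) / \<Lambda>) (at x)"
    unfolding \<tau>_def[abs_def] by (intro DERIV_cdivide DERIV_diff z_der DERIV_const)
  moreover have "(p x powr n * (p1 x * n / p x) - 0) / \<Lambda> = c * \<tau> x / p x"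
  proof -
    have key: "n * (p x powr n * p1 x) = c * (p x powr n - e)" unfolding p1_eq[OF assms] using m by simp
    have "(a * (b * d / w) - 0) / l = d * (a * b) / (l * w)" for a b d w l :: real by (simp add: mult_ac)
    hence "(p x powr n * (p1 x * n / p x) - 0) / \<Lambda> = c * (p x powr n - e) / (\<Lambda> * p x)" unfolding key[symmetric] by blast
    thus ?thesis by (simp add: \<tau>_def)
  qed
  ultimately show ?thesis by (rule DERIV_cong)
qed

lemma \<tau>_strict_mono: "x < y \<Longrightarrow> \<tau> x < \<tau> y"
  unfolding \<tau>_def using p_strict_mono[of x y] p_pos[of x] n_pos \<Lambda>
  by (intro divide_strict_right_mono diff_strict_right_mono powr_less_mono2) auto

lemma \<tau>_at_bot: "filterlim \<tau> (at 0 within {0..}) at_bot"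
proof -
  have "(\<tau> \<longlongrightarrow> (e - e) / \<Lambda>) at_bot"
    unfolding \<tau>_def[abs_def] using \<epsilon> \<Lambda> by (intro tendsto_intros p_at_bot) auto
  thus ?thesis unfolding filterlim_at using \<tau>_pos
    by (auto simp: less_imp_le less_imp_neq[THEN not_sym])
qed

lemma \<tau>_cont: "continuous_on A \<tau>"
  unfolding \<tau>_def[abs_def] using p_pos \<Lambda> by (intro continuous_intros p_cont continuous_on_powr) (auto simp: less_imp_neq[THEN not_sym])

lemma \<tau>_compose_cont: "continuous_on {0..} f \<Longrightarrow> continuous_on A (\<lambda>x. f (\<tau> x))"
  by (rule continuous_on_compose2[OF _ \<tau>_cont]) (auto intro: less_imp_le[OF \<tau>_pos])

lemma \<tau>_surj:
  assumes "Z > 0" "e + \<Lambda> * Z < \<theta> powr n"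
  obtains x where "\<tau> x = Z" "p x < \<theta>"
proof -
  define r where "r = (e + \<Lambda> * Z) powr (m - 2)"
  have pos: "e + \<Lambda> * Z > 0" using e_pos \<Lambda> assms(1) by (simp add: add_pos_pos)
  have rn: "r powr n = e + \<Lambda> * Z" unfolding r_def powr_powr using n_mult pos by (simp add: mult.commute)
  have "r < \<theta>"
  proof (rule ccontr)
    assume "\<not> r < \<theta>"
    hence "\<theta> powr n \<le> r powr n" using \<theta> n_pos by (intro powr_mono2) auto
    thus False using assms(2) rn by simp
  qed
  have "r > \<epsilon>"
  proof (rule ccontr)
    assume "\<not> r > \<epsilon>"
    moreover have "r > 0" unfolding r_def using pos by simp
    ultimately have "r powr n \<le> e" using n_pos by (intro powr_mono2) auto
    thus False using rn mult_pos_pos[OF \<Lambda> assms(1)] by linarith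
  qed
  have "eventually (\<lambda>x. p x < r) at_bot" by (rule order_tendstoD(2)[OF p_at_bot \<open>r > \<epsilon>\<close>])
  then obtain a where a: "p a < r" unfolding eventually_at_bot_linorder by blast
  have "eventually (\<lambda>x. p x > r) at_top" by (rule order_tendstoD[OF p_at_top]) (use \<open>r < \<theta>\<close> \<theta> in simp)
  then obtain b where b: "p b > r" unfolding eventually_at_top_linorder by blast
  have "a \<le> b" using a b p_mono[of b a] by linarith
  then obtain x where "p x = r" using IVT'[of p a r b] a b p_cont by force
  thus thesis using that[of x] rn \<open>r < \<theta>\<close> \<Lambda> by (simp add: \<tau>_def)
qed

text \<open>For v = u / p' and p \<le> \<theta> this is \<tau>^2 (e1 + \<tau>)^(2-m) dv/d\<tau>, the
  counterpart of \<open>t * r t\<close>, to which it reduces at e1 = 0.\<close>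

definition "scaled_flux u x = c / M * (\<tau> x * (flux u x / (p1 x)\<^sup>2))"

lemma scaled_flux_der:
  assumes u: "solves k s u" and x: "p x \<le> \<theta>"
  shows "(scaled_flux u has_real_derivative c * \<tau> x / p x * ((e1 + \<tau> x) powr m - s / M) * (u x / p1 x)) (at x)"
proof -
  have ne: "p1 x \<noteq> 0" "p x \<noteq> 0" using p1_pos[of x] p_pos[of x] by auto
  have p2: "p x * p2 x = (c - p1 x / (m - 2)) * p1 x" using ode[of x] G_eq_0[of "p x"] x p_pos[of x] by simp
  have "((\<lambda>x. (p1 x)\<^sup>2) has_real_derivative 2 * p1 x * p2 x) (at x)"
    using p1_der[of x] by (auto intro!: derivative_eq_intros)
  from DERIV_divide[OF flux_der[OF u, of x] this] ne
  have "((\<lambda>x. flux u x / (p1 x)\<^sup>2) has_real_derivative 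
      ((drift x * flux u x + (k\<^sup>2 * p x powr (m / (m - 2)) - s) / p x * (u x * p1 x)) * (p1 x)\<^sup>2 - flux u x * (2 * p1 x * p2 x)) / ((p1 x)\<^sup>2 * (p1 x)\<^sup>2)) (at x)"
    by simp
  from DERIV_cmult[OF DERIV_mult'[OF \<tau>_der[OF x] this], of "c / M"]
  have D: "(scaled_flux u has_real_derivative c / M * (\<tau> x * (((drift x * flux u x + (k\<^sup>2 * p x powr (m / (m - 2)) - s) / p x * (u x * p1 x)) * (p1 x)\<^sup>2 - flux u x * (2 * p1 x * p2 x)) / ((p1 x)\<^sup>2 * (p1 x)\<^sup>2)) + c * \<tau> x / p x * (flux u x / (p1 x)\<^sup>2))) (at x)"
    unfolding scaled_flux_def[abs_def] .
  have "drift x * p x = c - 2 * p1 x / (m - 2)" unfolding drift_def using ne by simp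
  hence "p1 x * (drift x * p x + c) = 2 * (p x * p2 x)" by (simp only: p2) (simp add: algebra_simps)
  \<comment> \<open>The wave equation without reaction term turns the damping coefficient of flux /
    (p')^2 into exactly -c / p, and the factor \<tau> with \<tau>' / \<tau> = c / p cancels
    it.\<close>
  hence key: "p x * (drift x * p1 x - 2 * p2 x) = - c * p1 x" by (simp add: algebra_simps)
  define Q where "Q = k\<^sup>2 * p x powr (m / (m - 2)) - s"
  have "((drift x * flux u x + Q / p x * (u x * p1 x)) * (p1 x)\<^sup>2 - flux u x * (2 * p1 x * p2 x)) / ((p1 x)\<^sup>2 * (p1 x)\<^sup>2)
     = (p x * (drift x * p1 x - 2 * p2 x)) * flux u x / (p x * (p1 x)^3) + Q / p x * (u x / p1 x)"
    using ne by (simp add: field_simps power2_eq_square power3_eq_cube)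
  also have "\<dots> = - (c / p x * (flux u x / (p1 x)\<^sup>2)) + Q / p x * (u x / p1 x)"
    unfolding key using ne by (simp add: field_simps power2_eq_square power3_eq_cube)
  finally have E: "((drift x * flux u x + Q / p x * (u x * p1 x)) * (p1 x)\<^sup>2 - flux u x * (2 * p1 x * p2 x)) / ((p1 x)\<^sup>2 * (p1 x)\<^sup>2)
     = - (c / p x * (flux u x / (p1 x)\<^sup>2)) + Q / p x * (u x / p1 x)" .
  have Q: "Q / M = (e1 + \<tau> x) powr m - s / M" unfolding Q_def potential_eq using M_pos by (simp add: diff_divide_distrib)
  show ?thesis
    by (rule DERIV_cong[OF D]) (unfold Q_def[symmetric] E Q[symmetric], simp add: algebra_simps)
qed

text \<open>At -\<infinity> the logarithmic derivative of u / p' is that of u, with limit r^+, minus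
  that of p', with limit c / \<epsilon>.\<close>

lemma initial_ratio:
  assumes "decaying k s u"
  shows "((\<lambda>x. scaled_flux u x / (\<tau> x * (u x / p1 x))) \<longlongrightarrow> c / M * (\<kappa> k s - c / (2 * \<epsilon>))) at_bot"
proof -
  have u: "eventually (\<lambda>x. u x > 0) at_bot" "((\<lambda>x. deriv u x / u x) \<longlongrightarrow> c / (2 * \<epsilon>) + \<kappa> k s) at_bot"
    using assms unfolding decaying_def by auto
  obtain x0 where x0: "\<And>x. x \<le> x0 \<Longrightarrow> p x < \<theta>" using p_le_\<theta>_at_bot by blast
  have "((\<lambda>x. c / M * (deriv u x / u x - (c - p1 x / (m - 2)) / p x)) \<longlongrightarrow> 
      c / M * (c / (2 * \<epsilon>) + \<kappa> k s - (c - 0 / (m - 2)) / \<epsilon>)) at_bot"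
    using m \<epsilon> by (intro tendsto_intros u p1_at_bot p_at_bot) auto
  moreover have "c / (2 * \<epsilon>) + \<kappa> k s - (c - 0 / (m - 2)) / \<epsilon> = \<kappa> k s - c / (2 * \<epsilon>)"
    using \<epsilon> by (simp add: field_simps)
  moreover have "eventually (\<lambda>x. c / M * (deriv u x / u x - (c - p1 x / (m - 2)) / p x) = scaled_flux u x / (\<tau> x * (u x / p1 x))) at_bot"
    using u(1) eventually_le_at_bot[of x0]
  proof eventually_elim
    case (elim x)
    have ne: "p1 x \<noteq> 0" "p x \<noteq> 0" "u x \<noteq> 0" "\<tau> x \<noteq> 0" using p1_pos[of x] p_pos[of x] \<tau>_pos[of x] elim by auto
    have "p x * p2 x = (c - p1 x / (m - 2)) * p1 x" using ode[of x] G_eq_0[of "p x"] x0[OF elim(2)] p_pos[of x] by simp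
    hence p2: "(c - p1 x / (m - 2)) / p x = p2 x / p1 x" using ne by (simp add: frac_eq_eq mult.commute)
    have "flux u x / (p1 x)\<^sup>2 / (u x / p1 x) = deriv u x / u x - p2 x / p1 x"
      unfolding flux_def using ne by (simp add: field_simps power2_eq_square)
    moreover have "scaled_flux u x / (\<tau> x * (u x / p1 x)) = c / M * (flux u x / (p1 x)\<^sup>2 / (u x / p1 x))"
      unfolding scaled_flux_def using ne by simp
    ultimately show ?case unfolding p2 by simp
  qed
  ultimately show ?thesis using Lim_transform_eventually by fastforce
qed

text \<open>F > 0 means that the logarithmic slope of u / p' exceeds that of the limit solution.
  This holds at -\<infinity> by the initial slopes and persists up to \<tau> = Z, since lowering
  \<sigma> by \<delta> pays for the error caused by e1. At Z the limit solution has turned, so u has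
  turned as well.\<close>

lemma low_barrier:
  assumes vr: "limit_solution m \<sigma> v r" and Z: "Z > 0" "\<And>t. t \<in> {0..Z} \<Longrightarrow> v t > 0" "r Z > 0"
    and \<delta>: "\<delta> > 0" "g1 * \<sigma>\<^sup>2 < \<delta>"
      "\<And>t. t \<in> {0..Z} \<Longrightarrow> (r t / v t)\<^sup>2 * ((e1 + t) powr (m - 2) - t powr (m - 2)) \<le> \<delta>"
    and small: "e + \<Lambda> * Z < \<theta> powr n"
    and u: "decaying k ((\<sigma> - \<delta>) * M) u"
  shows "turned k ((\<sigma> - \<delta>) * M) u"
proof -
  define s where "s = (\<sigma> - \<delta>) * M"
  note L = limit_solutionD[OF vr]
  have sol: "solves k s u" and u_ev: "eventually (\<lambda>x. u x > 0) at_bot" using u unfolding decaying_def s_def by auto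
  have sM: "s / M = \<sigma> - \<delta>" using M_pos by (simp add: s_def)
  obtain xZ where xZ: "\<tau> xZ = Z" "p xZ < \<theta>" using \<tau>_surj[OF Z(1) small] .
  have dom: "\<tau> x \<in> {0..Z}" "p x \<le> \<theta>" if "x \<le> xZ" for x
    using that xZ \<tau>_pos[of x] \<tau>_strict_mono[of x xZ] p_mono[of x xZ] by (cases "x = xZ"; simp)+
  define \<Gamma> where "\<Gamma> = (\<lambda>t. - (t * r t) / v t)"
  define F where "F = (\<lambda>x. scaled_flux u x + \<Gamma> (\<tau> x) * (u x / p1 x))"
  define \<alpha> where "\<alpha> = (\<lambda>x. M * \<Gamma> (\<tau> x) / (c * \<tau> x))"
  have lim: "((\<lambda>x. scaled_flux u x / (\<tau> x * (u x / p1 x)) - r (\<tau> x) / v (\<tau> x)) \<longlongrightarrow> c / M * (\<kappa> k s - c / (2 * \<epsilon>)) - r 0 / v 0) at_bot"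
  proof (intro tendsto_diff tendsto_divide filterlim_compose[OF _ \<tau>_at_bot])
    show "((\<lambda>x. scaled_flux u x / (\<tau> x * (u x / p1 x))) \<longlongrightarrow> c / M * (\<kappa> k s - c / (2 * \<epsilon>))) at_bot"
      using initial_ratio[OF u] unfolding s_def .
    show "(r \<longlongrightarrow> r 0) (at 0 within {0..})" "(v \<longlongrightarrow> v 0) (at 0 within {0..})"
      using L(1,2) unfolding continuous_on_def by auto
  qed (use L(3) in simp)
  have "c / M * (\<kappa> k s - c / (2 * \<epsilon>)) - r 0 / v 0 > 0"
    using initial_slope_low[OF \<delta>(2)] L(3,4) unfolding s_def by simp
  from order_tendstoD(1)[OF lim this] u_ev
  have "eventually (\<lambda>x. scaled_flux u x / (\<tau> x * (u x / p1 x)) - r (\<tau> x) / v (\<tau> x) > 0 \<and> u x > 0) at_bot"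
    by eventually_elim simp
  then obtain a0 where a0: "\<And>x. x \<le> a0 \<Longrightarrow> scaled_flux u x / (\<tau> x * (u x / p1 x)) - r (\<tau> x) / v (\<tau> x) > 0 \<and> u x > 0"
    unfolding eventually_at_bot_linorder by blast
  define a where "a = min a0 xZ"
  have ua: "u x > 0" if "x \<le> a" for x using a0[of x] that by (simp add: a_def)
  have Fa: "F a > 0"
  proof -
    have pos: "\<tau> a * (u a / p1 a) > 0" using \<tau>_pos[of a] ua[of a] p1_pos[of a] by simp
    have cancel: "(X / w - y) * w = X - y * w" if "w > 0" for X w y :: real using that by (simp add: left_diff_distrib)
    have eq: "F a = (scaled_flux u a / (\<tau> a * (u a / p1 a)) - r (\<tau> a) / v (\<tau> a)) * (\<tau> a * (u a / p1 a))"
      unfolding cancel[OF pos] F_def \<Gamma>_def by (simp add: mult_ac)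
    have "a \<le> a0" by (simp add: a_def)
    from mult_pos_pos[OF conjunct1[OF a0[OF this]] pos] show ?thesis unfolding eq .
  qed
  have v_pos: "v (\<tau> x) > 0" if "x \<le> xZ" for x using Z(2) dom[OF that] by simp
  have flux_eq: "flux u x / (p1 x)\<^sup>2 = M / (c * \<tau> x) * (F x - \<Gamma> (\<tau> x) * (u x / p1 x))" for x
    unfolding F_def scaled_flux_def using M_pos c_pos \<tau>_pos[of x] by simp
  have pos: "u b > 0 \<and> F b > 0" if b: "b \<in> {a..xZ}" for b
  proof -
    have cont_\<alpha>: "continuous_on {a..b} \<alpha>"
    proof -
      have "continuous_on {a..b} (\<lambda>x. v (\<tau> x))" "continuous_on {a..b} (\<lambda>x. r (\<tau> x))"
        by (rule \<tau>_compose_cont[OF L(1)], rule \<tau>_compose_cont[OF L(2)])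
      thus ?thesis unfolding \<alpha>_def \<Gamma>_def using c_pos \<tau>_pos v_pos b
        by (intro continuous_intros \<tau>_cont) (auto simp: less_imp_neq[THEN not_sym])
    qed
    \<comment> \<open>\<Gamma> satisfies the Riccati equation of the limit problem, so the terms
      free of e1 cancel. Besides \<alpha> F there remain the gain \<delta>, the favourable increment
      of t^m, and the error from e1 + t in place of t in the flux coefficient.\<close>
    define F' where "F' = (\<lambda>x. \<alpha> x * F x + c * \<tau> x / p x * ((e1 + \<tau> x) powr m - \<tau> x powr m + \<delta> 
      - (r (\<tau> x) / v (\<tau> x))\<^sup>2 * ((e1 + \<tau> x) powr (m - 2) - \<tau> x powr (m - 2))) * (u x / p1 x))"
    have dF: "(F has_real_derivative F' x) (at x)" if x: "x \<in> {a..b}" for x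
    proof -
      define t where "t = \<tau> x"
      have t: "t > 0" "v t > 0" using \<tau>_pos v_pos x b by (auto simp: t_def)
      have px: "p x \<le> \<theta>" using dom x b by simp
      have "(\<Gamma> has_real_derivative - (((t powr m - \<sigma>) * v t) * v t - (t * r t) * (t powr (m - 3) * r t)) / (v t * v t)) (at t)"
        unfolding \<Gamma>_def minus_divide_left[symmetric] using DERIV_minus[OF DERIV_divide[OF L(6)[OF t(1)] L(5)[OF t(1)]]] t by simp
      moreover have "- (((t powr m - \<sigma>) * v t) * v t - (t * r t) * (t powr (m - 3) * r t)) / (v t * v t) = \<sigma> - t powr m + t powr (m - 2) * (r t / v t)\<^sup>2"
      proof -
        have "t powr (m - 2) = t powr (m - 3) * t" using t powr_add[of t "m - 3" 1] by simp
        thus ?thesis using t by (simp add: field_simps power2_eq_square)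
      qed
      ultimately have d\<Gamma>: "(\<Gamma> has_real_derivative \<sigma> - t powr m + t powr (m - 2) * (r t / v t)\<^sup>2) (at (\<tau> x))" by (simp add: t_def)
      define B where "B = c * t / p x"
      define w where "w = u x / p1 x"
      have D: "(F has_real_derivative B * ((e1 + t) powr m - (\<sigma> - \<delta>)) * w 
          + (\<Gamma> t * (M / (c * t) * (F x - \<Gamma> t * w)) + (\<sigma> - t powr m + t powr (m - 2) * (r t / v t)\<^sup>2) * B * w)) (at x)"
        using DERIV_add[OF scaled_flux_der[OF sol px] DERIV_mult'[OF DERIV_chain2[OF d\<Gamma> \<tau>_der[OF px]] quotient_der[OF sol, of x]]]
        unfolding F_def[symmetric] flux_eq sM t_def B_def w_def .
      have "\<Gamma> t * (M / (c * t)) = \<alpha> x" unfolding \<alpha>_def t_def by simp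
      moreover have "\<alpha> x * \<Gamma> t = B * ((e1 + t) powr (m - 2) * (r t / v t)\<^sup>2)"
      proof -
        have "M * p x = c\<^sup>2 * (e1 + t) powr (m - 2)" unfolding t_def c2_p ..
        hence M: "M = c\<^sup>2 * (e1 + t) powr (m - 2) / p x" using p_pos[of x] by (simp add: eq_divide_eq)
        have "\<alpha> x * \<Gamma> t = M * t / c * (r t / v t)\<^sup>2"
          unfolding \<alpha>_def \<Gamma>_def t_def[symmetric] using t c_pos by (simp add: field_simps power2_eq_square)
        also have "\<dots> = B * ((e1 + t) powr (m - 2) * (r t / v t)\<^sup>2)"
          unfolding M B_def using c_pos by (simp add: power2_eq_square)
        finally show ?thesis .
      qed
      moreover have "B * X1 * w + (y * (N * (f - y * w)) + (X2 + X3) * B * w) = \<alpha> x * f + B * (X1 + X2 - (X4 - X3)) * w"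
        if "y * N = \<alpha> x" "\<alpha> x * y = B * X4" for X1 X2 X3 X4 y N f
      proof -
        have "y * (N * (f - y * w)) = \<alpha> x * f - (\<alpha> x * y) * w" unfolding that(1)[symmetric] by (simp add: algebra_simps)
        thus ?thesis unfolding that(2) by (simp add: algebra_simps)
      qed
      ultimately have "B * ((e1 + t) powr m - (\<sigma> - \<delta>)) * w 
          + (\<Gamma> t * (M / (c * t) * (F x - \<Gamma> t * w)) + ((\<sigma> - t powr m) + t powr (m - 2) * (r t / v t)\<^sup>2) * B * w)
          = \<alpha> x * F x + B * (((e1 + t) powr m - (\<sigma> - \<delta>)) + (\<sigma> - t powr m) - ((e1 + t) powr (m - 2) * (r t / v t)\<^sup>2 - t powr (m - 2) * (r t / v t)\<^sup>2)) * w"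
        by blast
      also have "\<dots> = F' x"
        unfolding F'_def t_def[symmetric] B_def w_def by (simp add: algebra_simps)
      finally show ?thesis using D by simp
    qed
    have ab: "a \<le> b" using b by simp
    have "u b / p1 b > 0 \<and> F b > 0"
    proof (intro conjI linear_system_pos[where f = "\<lambda>x. u x / p1 x" and g = F and \<alpha> = "\<lambda>x. - \<alpha> x" and \<gamma> = \<alpha> and f' = "\<lambda>x. flux u x / (p1 x)\<^sup>2" and g' = F', OF ab])
      show "continuous_on {a..b} (\<lambda>x. - \<alpha> x)" "continuous_on {a..b} (\<lambda>x. - \<alpha> x)" "continuous_on {a..b} \<alpha>" "continuous_on {a..b} \<alpha>"
        using cont_\<alpha> by (auto intro!: continuous_intros)
      show "0 < u a / p1 a" "0 < u a / p1 a" using ua[of a] p1_pos by auto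
      show "((\<lambda>x. u x / p1 x) has_real_derivative flux u x / (p1 x)\<^sup>2) (at x)" for x by (rule quotient_der[OF sol])
      show "((\<lambda>x. u x / p1 x) has_real_derivative flux u x / (p1 x)\<^sup>2) (at x)" for x by (rule quotient_der[OF sol])
      have 1: "- \<alpha> x * (u x / p1 x) \<le> flux u x / (p1 x)\<^sup>2" if "0 < F x" for x
      proof -
        have "flux u x / (p1 x)\<^sup>2 = M / (c * \<tau> x) * F x - \<alpha> x * (u x / p1 x)"
          unfolding flux_eq \<alpha>_def by (simp add: algebra_simps)
        moreover have "M / (c * \<tau> x) * F x > 0" using that M_pos c_pos \<tau>_pos[of x] by simp
        ultimately show ?thesis by simp
      qed
      show "- \<alpha> x * (u x / p1 x) \<le> flux u x / (p1 x)\<^sup>2" if "0 < F x" for x by (rule 1[OF that])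
      show "- \<alpha> x * (u x / p1 x) \<le> flux u x / (p1 x)\<^sup>2" if "0 < F x" for x by (rule 1[OF that])
      have 2: "\<alpha> x * F x \<le> F' x" if x: "x \<in> {a..b}" "0 < u x / p1 x" for x
      proof -
        have "\<tau> x powr m \<le> (e1 + \<tau> x) powr m" using \<tau>_pos[of x] e1_pos m by (intro powr_mono2) auto
        moreover have "(r (\<tau> x) / v (\<tau> x))\<^sup>2 * ((e1 + \<tau> x) powr (m - 2) - \<tau> x powr (m - 2)) \<le> \<delta>"
          by (rule \<delta>(3)) (use dom x b in simp)
        ultimately have A: "0 \<le> (e1 + \<tau> x) powr m - \<tau> x powr m + \<delta> - (r (\<tau> x) / v (\<tau> x))\<^sup>2 * ((e1 + \<tau> x) powr (m - 2) - \<tau> x powr (m - 2))"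
          by linarith
        have B: "0 \<le> c * \<tau> x / p x" using c_pos \<tau>_pos[of x] p_pos[of x] by simp
        show ?thesis unfolding F'_def le_add_same_cancel1
          by (rule mult_nonneg_nonneg[OF mult_nonneg_nonneg[OF B A] less_imp_le[OF x(2)]])
      qed
      show "\<alpha> x * F x \<le> F' x" if "x \<in> {a..b}" "0 < u x / p1 x" for x by (rule 2[OF that])
      show "\<alpha> x * F x \<le> F' x" if "x \<in> {a..b}" "0 < u x / p1 x" for x by (rule 2[OF that])
    qed (use dF Fa in auto)
    thus ?thesis using p1_pos[of b] by (simp add: zero_less_divide_iff)
  qed
  have "a \<le> xZ" by (simp add: a_def)
  have "\<forall>x\<le>xZ. u x > 0" using ua pos by (meson atLeastAtMost_iff linear)
  moreover have "flux u xZ > 0"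
  proof -
    have uF: "u xZ > 0" "F xZ > 0" using pos[of xZ] \<open>a \<le> xZ\<close> by auto
    have "\<Gamma> (\<tau> xZ) < 0" unfolding xZ \<Gamma>_def using Z(1,3) Z(2)[of Z] by simp
    hence "\<Gamma> (\<tau> xZ) * (u xZ / p1 xZ) < 0" using uF p1_pos[of xZ] by (intro mult_neg_pos) auto
    hence "F xZ - \<Gamma> (\<tau> xZ) * (u xZ / p1 xZ) > 0" using uF by simp
    hence "flux u xZ / (p1 xZ)\<^sup>2 > 0" unfolding flux_eq using M_pos c_pos \<tau>_pos[of xZ] by simp
    thus ?thesis using p1_pos[of xZ] by (simp add: zero_less_divide_iff)
  qed
  moreover have "k\<^sup>2 * p xZ powr (m / (m - 2)) > s"
  proof -
    have "\<sigma> < Z powr m" by (rule turning_power_gt[OF m vr Z])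
    also have "\<dots> \<le> (e1 + Z) powr m" using Z(1) e1_pos m by (intro powr_mono2) auto
    finally have "\<sigma> - \<delta> < (e1 + Z) powr m" using \<delta>(1) by simp
    hence "M * (\<sigma> - \<delta>) < M * (e1 + Z) powr m" using M_pos by simp
    thus ?thesis unfolding potential_eq xZ s_def by (simp add: mult.commute)
  qed
  ultimately show ?thesis unfolding turned_def s_def by blast
qed

text \<open>A quotient by v as in the low barrier would blow up at the zero Z, so a Wronskian
  \<open>K\<close> of limit solution and wave quotient is used. If u stayed positive, K would remain
  positive up to Z, making (u / p') / v nonincreasing; then u / p' would be at most a multiple of v
  and hence nonpositive at Z.\<close>

lemma high_barrier:
  assumes vr: "limit_solution m \<sigma> v r" and Z: "Z > 0" "v Z = 0" "\<And>t. t \<in> {0..<Z} \<Longrightarrow> v t > 0" "\<And>t. t \<in> {0<..<Z} \<Longrightarrow> r t \<le> 0"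
    and \<delta>: "e1 powr m < \<delta>" "2 * g1 * \<sigma> < 1"
      "\<And>t. t \<in> {0..Z} \<Longrightarrow> (e1 + t) powr m - t powr m \<le> \<delta>"
    and small: "e + \<Lambda> * Z < \<theta> powr n"
    and u: "decaying k ((\<sigma> + \<delta>) * M) u"
  shows "\<exists>x. u x \<le> 0"
proof (rule ccontr)
  assume "\<not> (\<exists>x. u x \<le> 0)"
  hence u_pos: "u x > 0" for x by (simp add: not_le)
  define s where "s = (\<sigma> + \<delta>) * M"
  note L = limit_solutionD[OF vr]
  have sol: "solves k s u" using u unfolding decaying_def s_def by auto
  have sM: "s / M = \<sigma> + \<delta>" using M_pos by (simp add: s_def)
  obtain xZ where xZ: "\<tau> xZ = Z" "p xZ < \<theta>" using \<tau>_surj[OF Z(1) small] .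
  have dom: "\<tau> x \<in> {0<..<Z}" "p x \<le> \<theta>" if "x < xZ" for x
    using that xZ \<tau>_pos[of x] \<tau>_strict_mono[of x xZ] p_mono[of x xZ] by simp_all
  define K where "K = (\<lambda>x. \<tau> x * r (\<tau> x) * (u x / p1 x) - scaled_flux u x * v (\<tau> x))"
  \<comment> \<open>Relative deviation of the flux coefficient from the limit one. It is
    nonnegative, and multiplied by r \<le> 0 it helps the estimate of (u / p') / v; hence the sign
    of r in \<open>vanishing\<close>.\<close>
  define \<nu> where "\<nu> = (\<lambda>x. 1 - \<tau> x powr (m - 2) / (e1 + \<tau> x) powr (m - 2))"
  have \<nu>: "\<nu> x \<ge> 0" for x
  proof -
    have "\<tau> x powr (m - 2) \<le> (e1 + \<tau> x) powr (m - 2)" using \<tau>_pos[of x] e1_pos m by (intro powr_mono2) auto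
    thus ?thesis unfolding \<nu>_def using \<tau>_pos[of x] e1_pos by (simp add: divide_le_eq)
  qed
  define \<alpha> where "\<alpha> = (\<lambda>x. - (M * r (\<tau> x) * \<nu> x / (c * v (\<tau> x))))"
  have lim: "((\<lambda>x. r (\<tau> x) - scaled_flux u x / (\<tau> x * (u x / p1 x)) * v (\<tau> x)) \<longlongrightarrow> r 0 - c / M * (\<kappa> k s - c / (2 * \<epsilon>)) * v 0) at_bot"
  proof (intro tendsto_diff tendsto_mult filterlim_compose[OF _ \<tau>_at_bot])
    show "((\<lambda>x. scaled_flux u x / (\<tau> x * (u x / p1 x))) \<longlongrightarrow> c / M * (\<kappa> k s - c / (2 * \<epsilon>))) at_bot"
      using initial_ratio[OF u] unfolding s_def .
    show "(r \<longlongrightarrow> r 0) (at 0 within {0..})" "(v \<longlongrightarrow> v 0) (at 0 within {0..})"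
      using L(1,2) unfolding continuous_on_def by auto
  qed
  have "r 0 - c / M * (\<kappa> k s - c / (2 * \<epsilon>)) * v 0 > 0"
    using initial_slope_high[OF \<delta>(1,2)] L(3,4) unfolding s_def by simp
  from order_tendstoD(1)[OF lim this]
  obtain a0 where a0: "\<And>x. x \<le> a0 \<Longrightarrow> r (\<tau> x) - scaled_flux u x / (\<tau> x * (u x / p1 x)) * v (\<tau> x) > 0"
    unfolding eventually_at_bot_linorder by blast
  define a where "a = min a0 (xZ - 1)"
  have "a < xZ" by (simp add: a_def)
  have Ka: "K a > 0"
  proof -
    have pos: "\<tau> a * (u a / p1 a) > 0" using \<tau>_pos[of a] u_pos[of a] p1_pos[of a] by simp
    have cancel: "(y - X / w * z) * w = y * w - X * z" if "w > 0" for X w y z :: real using that by (simp add: left_diff_distrib)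
    have eq: "K a = (r (\<tau> a) - scaled_flux u a / (\<tau> a * (u a / p1 a)) * v (\<tau> a)) * (\<tau> a * (u a / p1 a))"
      unfolding cancel[OF pos] K_def by (simp add: mult_ac)
    have "a \<le> a0" by (simp add: a_def)
    from mult_pos_pos[OF a0[OF this] pos] show ?thesis unfolding eq .
  qed
  have v_pos: "v (\<tau> x) > 0" if "x < xZ" for x using Z(3) dom[OF that] by simp
  have r_neg: "r (\<tau> x) \<le> 0" if "x < xZ" for x using Z(4) dom[OF that] by simp
  have flux_eq: "flux u x / (p1 x)\<^sup>2 = M / (c * \<tau> x) * scaled_flux u x" for x
    unfolding scaled_flux_def using M_pos c_pos \<tau>_pos[of x] by simp
  have dv: "((\<lambda>x. v (\<tau> x)) has_real_derivative \<tau> x powr (m - 3) * r (\<tau> x) * (c * \<tau> x / p x)) (at x)" if "x < xZ" for x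
    using DERIV_chain2[OF L(5)[OF \<tau>_pos] \<tau>_der[OF dom(2)[OF that]]] .
  have pM: "c * \<tau> x / p x * \<tau> x powr (m - 3) = M / c * (\<tau> x powr (m - 2) / (e1 + \<tau> x) powr (m - 2))" for x
  proof -
    have "c * c * (e1 + \<tau> x) powr (m - 2) = M * p x" using c2_p[of x] by (simp add: power2_eq_square)
    hence "c / p x = M / (c * (e1 + \<tau> x) powr (m - 2))"
      using c_pos p_pos[of x] e1_pos \<tau>_pos[of x] by (simp add: frac_eq_eq mult_ac)
    moreover have "\<tau> x powr (m - 2) = \<tau> x powr (m - 3) * \<tau> x" using \<tau>_pos[of x] powr_add[of "\<tau> x" "m - 3" 1] by simp
    ultimately show ?thesis by (simp add: mult_ac) (metis (no_types, lifting) mult.commute times_divide_eq_left)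
  qed
  have K_pos: "K b > 0" if b: "b \<in> {a..<xZ}" for b
  proof -
    have ab: "a \<le> b" using b by simp
    define K' where "K' = (\<lambda>x. \<alpha> x * K x + c * \<tau> x / p x * (\<delta> - ((e1 + \<tau> x) powr m - \<tau> x powr m)) * v (\<tau> x) * (u x / p1 x)
       + M * \<nu> x * \<tau> x * (r (\<tau> x))\<^sup>2 * (u x / p1 x) / (c * v (\<tau> x)))"
    have dK: "(K has_real_derivative K' x) (at x)" if x: "x \<in> {a..b}" for x
    proof -
      define t where "t = \<tau> x"
      define B where "B = c * t / p x"
      define w where "w = u x / p1 x"
      define y where "y = scaled_flux u x"
      have xZ': "x < xZ" using x b by simp
      have t: "t > 0" "v t > 0" using \<tau>_pos v_pos[OF xZ'] by (auto simp: t_def)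
      have px: "p x \<le> \<theta>" by (rule dom[OF xZ'])
      have D: "(K has_real_derivative (t * r t * (M / (c * t) * y) + (t powr m - \<sigma>) * v t * B * w)
          - (y * (t powr (m - 3) * r t * B) + B * ((e1 + t) powr m - (\<sigma> + \<delta>)) * w * v t)) (at x)"
        using DERIV_diff[OF DERIV_mult'[OF DERIV_chain2[OF L(6)[OF \<tau>_pos] \<tau>_der[OF px]] quotient_der[OF sol, of x]]
            DERIV_mult'[OF scaled_flux_der[OF sol px] dv[OF xZ']]]
        unfolding K_def[symmetric] flux_eq sM t_def B_def w_def y_def .
      have "t * r t * (M / (c * t) * y) = M / c * r t * y" using t by simp
      moreover have "y * (t powr (m - 3) * r t * B) = (M / c - M / c * \<nu> x) * r t * y"
        using pM[of x] unfolding B_def \<nu>_def t_def by (simp add: algebra_simps)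
      moreover have "M / c * \<nu> x * r t * y = \<alpha> x * K x + M * \<nu> x * t * (r t)\<^sup>2 * w / (c * v t)"
      proof -
        have K: "K x = t * r t * w - y * v t" unfolding K_def t_def[symmetric] w_def y_def by simp
        show ?thesis unfolding \<alpha>_def t_def[symmetric] K using t c_pos by (simp add: field_simps power2_eq_square)
      qed
      ultimately have "(t * r t * (M / (c * t) * y) + (t powr m - \<sigma>) * v t * B * w)
          - (y * (t powr (m - 3) * r t * B) + B * ((e1 + t) powr m - (\<sigma> + \<delta>)) * w * v t) = K' x"
        unfolding K'_def t_def[symmetric] B_def[symmetric] w_def[symmetric] by (simp add: algebra_simps)
      thus ?thesis using D by simp
    qed
    show ?thesis
    proof (rule linear_inequality_pos[where f = K and f' = K' and \<alpha> = \<alpha>, OF ab])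
      have "continuous_on {a..b} (\<lambda>x. v (\<tau> x))" "continuous_on {a..b} (\<lambda>x. r (\<tau> x))"
        by (rule \<tau>_compose_cont[OF L(1)], rule \<tau>_compose_cont[OF L(2)])
      thus "continuous_on {a..b} \<alpha>" unfolding \<alpha>_def \<nu>_def using c_pos \<tau>_pos v_pos b e1_pos
        by (intro continuous_intros \<tau>_cont continuous_on_powr) (auto simp: less_imp_neq[THEN not_sym] add_pos_pos)
      show "(K has_real_derivative K' x) (at x)" if "x \<in> {a..b}" for x by (rule dK[OF that])
      show "\<alpha> x * K x \<le> K' x" if "x \<in> {a..b}" for x
      proof -
        have xZ': "x < xZ" using that b by simp
        have "(e1 + \<tau> x) powr m - \<tau> x powr m \<le> \<delta>" by (rule \<delta>(3)) (use dom[OF xZ'] in simp)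
        thus ?thesis unfolding K'_def using v_pos[OF xZ'] u_pos[of x] p1_pos[of x] c_pos \<tau>_pos[of x] p_pos[of x] M_pos \<nu>[of x]
          by (simp add: add_nonneg_nonneg)
      qed
    qed (rule Ka)
  qed
  have decreasing: "u b / p1 b \<le> u a / p1 a / v (\<tau> a) * v (\<tau> b)" if b: "b \<in> {a..<xZ}" for b
  proof -
    have ab: "a \<le> b" using b by simp
    have "u b / p1 b / v (\<tau> b) \<le> u a / p1 a / v (\<tau> a)"
    proof (rule DERIV_nonpos_imp_nonincreasing[OF ab, where f = "\<lambda>x. u x / p1 x / v (\<tau> x)"])
      fix x assume x: "a \<le> x" "x \<le> b"
      have xZ': "x < xZ" using x b by simp
      note vp = v_pos[OF xZ']
      have "v (\<tau> x) \<noteq> 0" using vp by simp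
      note D = DERIV_divide[OF quotient_der[OF sol, of x] dv[OF xZ'] this]
      have e: "\<tau> x powr (m - 3) * r (\<tau> x) * (c * \<tau> x / p x) = M / c * (1 - \<nu> x) * r (\<tau> x)"
        using pM[of x] unfolding \<nu>_def by (simp add: mult_ac)
      have "flux u x / (p1 x)\<^sup>2 * v (\<tau> x) - u x / p1 x * (\<tau> x powr (m - 3) * r (\<tau> x) * (c * \<tau> x / p x))
          = M / (c * \<tau> x) * (scaled_flux u x * v (\<tau> x)) - M / c * (1 - \<nu> x) * r (\<tau> x) * (u x / p1 x)"
        unfolding flux_eq e by (simp add: mult_ac)
      also have "scaled_flux u x * v (\<tau> x) = \<tau> x * r (\<tau> x) * (u x / p1 x) - K x" by (simp add: K_def)
      also have "M / (c * \<tau> x) * (\<tau> x * r (\<tau> x) * (u x / p1 x) - K x) - M / c * (1 - \<nu> x) * r (\<tau> x) * (u x / p1 x)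
         = M / c * \<nu> x * (u x / p1 x) * r (\<tau> x) - M / (c * \<tau> x) * K x"
      proof -
        have "M / (c * T) * (T * R * w - y) - M / c * (1 - N) * R * w = M / c * N * w * R - M / (c * T) * y"
          if "T > 0" for T R w y N :: real
          using that c_pos by (simp add: field_simps)
        thus ?thesis using \<tau>_pos[of x] by blast
      qed
      also have "\<dots> \<le> 0"
      proof -
        have "M / c * \<nu> x * (u x / p1 x) * r (\<tau> x) \<le> 0"
          using M_pos c_pos \<nu>[of x] u_pos[of x] p1_pos[of x] r_neg[OF xZ'] by (intro mult_nonneg_nonpos) auto
        moreover have "M / (c * \<tau> x) * K x \<ge> 0" using M_pos c_pos \<tau>_pos[of x] K_pos[of x] x b by simp
        ultimately show ?thesis by simp
      qed
      finally have "(flux u x / (p1 x)\<^sup>2 * v (\<tau> x) - u x / p1 x * (\<tau> x powr (m - 3) * r (\<tau> x) * (c * \<tau> x / p x))) / (v (\<tau> x) * v (\<tau> x)) \<le> 0"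
        by (simp add: divide_nonpos_nonneg)
      thus "\<exists>y. ((\<lambda>x. u x / p1 x / v (\<tau> x)) has_real_derivative y) (at x) \<and> y \<le> 0" using D by blast
    qed
    moreover have "v (\<tau> b) > 0" using v_pos b by simp
    ultimately show ?thesis by (metis pos_divide_le_eq)
  qed
  have contv: "continuous_on {a..xZ} (\<lambda>x. v (\<tau> x))"
    by (rule \<tau>_compose_cont[OF L(1)])
  have contu: "continuous_on {a..xZ} (\<lambda>x. u x / p1 x)"
    by (rule DERIV_at_imp_continuous_on, rule quotient_der[OF sol])
  \<comment> \<open>The comparison divides by v (\<tau> x), which vanishes at \<open>xZ\<close>; so
    it holds to the left, and the conclusion follows in the limit.\<close>
  have nontriv: "at xZ within {a..<xZ} \<noteq> bot"
  proof -
    have "at xZ within {a..<xZ} = at_left xZ" by (rule at_within_nhd[of _ "{a<..}"]) (use \<open>a < xZ\<close> in auto)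
    thus ?thesis by simp
  qed
  have within: "(f \<longlongrightarrow> f xZ) (at xZ within {a..<xZ})" if "continuous_on {a..xZ} f" for f :: "real \<Rightarrow> real"
  proof (rule tendsto_within_subset)
    show "(f \<longlongrightarrow> f xZ) (at xZ within {a..xZ})" using that \<open>a < xZ\<close> unfolding continuous_on_def by simp
  qed auto
  have lim1: "((\<lambda>x. u a / p1 a / v (\<tau> a) * v (\<tau> x)) \<longlongrightarrow> u a / p1 a / v (\<tau> a) * v (\<tau> xZ)) (at xZ within {a..<xZ})"
    by (intro tendsto_mult_left within[OF contv])
  note lim2 = within[OF contu]
  have "u xZ / p1 xZ \<le> u a / p1 a / v (\<tau> a) * v (\<tau> xZ)"
    by (rule tendsto_le[OF nontriv lim1 lim2]) (use decreasing in \<open>auto simp: eventually_at_filter\<close>)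
  hence "u xZ / p1 xZ \<le> 0" using xZ Z(2) by simp
  thus False using u_pos[of xZ] p1_pos[of xZ] by (simp add: divide_le_0_iff)
qed

end

lemma powr_increment_small:
  fixes a Z d :: real
  assumes "a > 0" "d > 0"
  shows "eventually (\<lambda>x. \<forall>t\<in>{0..Z}. (x + t) powr a - t powr a \<le> d) (at_right 0)"
proof -
  have "uniformly_continuous_on {0..Z + 1} (\<lambda>t. t powr a)"
    using assms by (intro compact_uniformly_continuous continuous_on_powr' continuous_intros) auto
  then obtain b where b: "b > 0" "\<And>x y. x \<in> {0..Z + 1} \<Longrightarrow> y \<in> {0..Z + 1} \<Longrightarrow> dist y x < b \<Longrightarrow> dist (y powr a) (x powr a) < d"
    unfolding uniformly_continuous_on_def using assms(2) by meson
  have "eventually (\<lambda>x. x \<in> {0<..<min 1 b}) (at_right 0)"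
    using b(1) by (intro eventually_at_right_real) auto
  thus ?thesis
  proof eventually_elim
    case (elim x)
    show ?case
    proof
      fix t assume "t \<in> {0..Z}"
      hence "dist ((x + t) powr a) (t powr a) < d" using elim by (intro b(2)) (auto simp: dist_real_def)
      thus "(x + t) powr a - t powr a \<le> d" by (simp add: dist_real_def)
    qed
  qed
qed

text \<open>The barriers ask only for small \<Lambda> and e1, so one threshold \<open>E\<close>
  works for all waves and all k.\<close>

lemma uniform_ground_state:
  assumes m: "m > 3" and ign: "ignition G \<theta>" and \<delta>: "\<delta> > 0"
    and low: "turning m \<sigma>\<^sub>1" and high: "vanishing m \<sigma>\<^sub>2" and \<sigma>: "\<sigma>\<^sub>1 < \<sigma>\<^sub>2" "0 < \<sigma>\<^sub>1"
  shows "\<exists>E>0. \<forall>\<epsilon> c p k. wave m \<theta> \<epsilon> c G p \<longrightarrow> k > 0 \<longrightarrow> (c / k) powr (1 / (m - 1)) < E \<longrightarrow>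
     \<epsilon> powr (1 / (m - 2)) / (c / k) powr (1 / (m - 1)) < E \<longrightarrow>
     (\<exists>\<sigma>. \<sigma>\<^sub>1 - \<delta> < \<sigma> \<and> \<sigma> < \<sigma>\<^sub>2 + \<delta> \<and> 
       c\<^sup>2 + 4 * \<epsilon> * (k\<^sup>2 * \<epsilon> powr (m / (m - 2)) - \<sigma> * (k\<^sup>2 * ((c / k) powr (1 / (m - 1))) powr m)) > 0 \<and>
       (\<exists>v\<in>eigenspace m G \<epsilon> k c p (\<sigma> * (k\<^sup>2 * ((c / k) powr (1 / (m - 1))) powr m)). \<forall>x. v x > 0))"
proof -
  obtain v1 r1 Z1 where 1: "limit_solution m \<sigma>\<^sub>1 v1 r1" "Z1 > 0" "\<And>t. t \<in> {0..Z1} \<Longrightarrow> v1 t > 0" "r1 Z1 > 0"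
    using low unfolding turning_def by blast
  obtain v2 r2 Z2 where 2: "limit_solution m \<sigma>\<^sub>2 v2 r2" "Z2 > 0" "v2 Z2 = 0" "\<And>t. t \<in> {0..<Z2} \<Longrightarrow> v2 t > 0" "\<And>t. t \<in> {0<..<Z2} \<Longrightarrow> r2 t \<le> 0"
    using high unfolding vanishing_def by blast
  have "continuous_on {0..Z1} (\<lambda>t. (r1 t / v1 t)\<^sup>2)"
    using limit_solutionD(1,2)[OF 1(1)] 1(3) 
    by (intro continuous_intros) (auto intro: continuous_on_subset simp: less_imp_neq[THEN not_sym])
  then obtain C where C: "C > 0" "\<And>t. t \<in> {0..Z1} \<Longrightarrow> \<bar>(r1 t / v1 t)\<^sup>2\<bar> \<le> C" using continuous_on_Icc_bounded by blast
  have powr0: "((\<lambda>x. x powr a) \<longlongrightarrow> 0) (at_right (0::real))" if "a > 0" for a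
    using that by (intro tendsto_eq_intros | simp add: eventually_at_filter)+
  have powr_small: "eventually (\<lambda>x. x powr a * b < d) (at_right 0)" if "a > 0" "d > 0" for a b d :: real
    by (rule order_tendstoD(2)[OF tendsto_mult_left_zero[OF powr0]]) (use that in auto)
  have lin_small: "eventually (\<lambda>x. x * b < d) (at_right 0)" if "d > 0" for b d :: real
    using powr_small[of 1 d b] that eventually_at_right_less[of 0] by (auto elim!: eventually_elim2)
  \<comment> \<open>Here x stands for e1 and for \<Lambda> alike. The conditions bound the barrier
    errors and initial slopes, keep the radicand positive, keep e + \<Lambda> Z = \<Lambda> (e1 + Z)
    below \<theta>^n by means of e1 < 1, and ensure s < k^2.\<close>
  have "eventually (\<lambda>x. (\<forall>t\<in>{0..Z1}. (x + t) powr (m - 2) - t powr (m - 2) \<le> \<delta> / C) \<and> (\<forall>t\<in>{0..Z2}. (x + t) powr m - t powr m \<le> \<delta>) \<and>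
      x powr (m - 2) * \<sigma>\<^sub>1\<^sup>2 < \<delta> \<and> x powr m * 1 < \<delta> \<and> x powr (m - 2) * (2 * \<sigma>\<^sub>2) < 1 \<and> x powr (m - 2) * (4 * (\<sigma>\<^sub>2 + \<delta>)) < 1 \<and>
      x * (1 + Z1) < \<theta> powr (1 / (m - 2)) \<and> x * (1 + Z2) < \<theta> powr (1 / (m - 2)) \<and> x powr m * (\<sigma>\<^sub>2 + \<delta>) < 1 \<and> x * 1 < 1) (at_right 0)"
    using m \<delta> C(1) ign unfolding ignition_def
    by (intro eventually_conj powr_increment_small powr_small lin_small) auto
  then obtain E where E: "E > 0" and E': "\<And>x. 0 < x \<Longrightarrow> x < E \<Longrightarrow> 
      (\<forall>t\<in>{0..Z1}. (x + t) powr (m - 2) - t powr (m - 2) \<le> \<delta> / C) \<and> (\<forall>t\<in>{0..Z2}. (x + t) powr m - t powr m \<le> \<delta>) \<and>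
      x powr (m - 2) * \<sigma>\<^sub>1\<^sup>2 < \<delta> \<and> x powr m * 1 < \<delta> \<and> x powr (m - 2) * (2 * \<sigma>\<^sub>2) < 1 \<and> x powr (m - 2) * (4 * (\<sigma>\<^sub>2 + \<delta>)) < 1 \<and>
      x * (1 + Z1) < \<theta> powr (1 / (m - 2)) \<and> x * (1 + Z2) < \<theta> powr (1 / (m - 2)) \<and> x powr m * (\<sigma>\<^sub>2 + \<delta>) < 1 \<and> x * 1 < 1"
    unfolding eventually_at_right_field by auto
  show ?thesis
  proof (rule exI[of _ E], intro conjI allI impI)
    fix \<epsilon> c p k
    assume w: "wave m \<theta> \<epsilon> c G p" and k: "k > (0::real)" and L1: "(c / k) powr (1 / (m - 1)) < E"
      and L2: "\<epsilon> powr (1 / (m - 2)) / (c / k) powr (1 / (m - 1)) < E"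
    interpret wave m \<theta> \<epsilon> c G p by (rule w)
    define \<Lambda> where "\<Lambda> = (c / k) powr (1 / (m - 1))"
    define M where "M = k\<^sup>2 * \<Lambda> powr m"
    have \<Lambda>: "\<Lambda> > 0" using c_pos k by (simp add: \<Lambda>_def)
    have "c\<^sup>2 = M * \<Lambda> powr (m - 2)"
    proof -
      have "\<Lambda> powr m * \<Lambda> powr (m - 2) = (c / k) powr (1 / (m - 1) * (m + (m - 2)))"
        unfolding \<Lambda>_def powr_powr powr_add[symmetric] by (simp only: distrib_left)
      also have "1 / (m - 1) * (m + (m - 2)) = 2" using m by (simp add: field_simps)
      also have "(c / k) powr 2 = (c / k)\<^sup>2" using c_pos k by simp
      finally show ?thesis using k by (simp add: M_def power_divide mult.assoc)
    qed
    then interpret scaled_wave m \<theta> \<epsilon> c G p k \<Lambda> M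
      using \<Lambda> k by unfold_locales (auto simp: M_def)
    have e1: "e1 < E" using L2[folded \<Lambda>_def] by (simp add: e1_def)
    note A = E'[OF e1_pos e1]
    note B = E'[OF \<Lambda> L1[folded \<Lambda>_def]]
    have small: "e + \<Lambda> * Z < \<theta> powr n" if "\<Lambda> * (1 + Z) < \<theta> powr n" for Z
    proof -
      have "e = \<Lambda> * e1" using \<Lambda> by (simp add: e1_def)
      moreover have "\<Lambda> * e1 \<le> \<Lambda> * 1" using A \<Lambda> by (intro mult_left_mono) auto
      ultimately show ?thesis using that by (simp add: distrib_left)
    qed
    have rad: "radicand k (y * M) > 0" if "y \<le> \<sigma>\<^sub>2 + \<delta>" for y
    proof -
      have g: "g1 > 0" unfolding g1_def using e1_pos by simp
      have "4 * g1 * y \<le> 4 * g1 * (\<sigma>\<^sub>2 + \<delta>)" using that g by (intro mult_left_mono) auto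
      also have "\<dots> = g1 * (4 * (\<sigma>\<^sub>2 + \<delta>))" by simp
      also have "\<dots> < 1" using A unfolding g1_def by blast
      finally have "4 * g1 * y < 1" .
      moreover have "4 * g1 * e1 powr m > 0" using g e1_pos by simp
      ultimately have "1 + 4 * g1 * (e1 powr m - y) > 0" by (simp add: right_diff_distrib)
      thus ?thesis unfolding radicand_eq using c_pos by simp
    qed
    have k2: "(\<sigma>\<^sub>2 + \<delta>) * M < k\<^sup>2"
    proof -
      have "k\<^sup>2 * (\<Lambda> powr m * (\<sigma>\<^sub>2 + \<delta>)) < k\<^sup>2 * 1" using B k by (intro mult_strict_left_mono) auto
      thus ?thesis by (simp add: M_def mult_ac)
    qed
    obtain s v where s: "(\<sigma>\<^sub>1 - \<delta>) * M < s" "s < (\<sigma>\<^sub>2 + \<delta>) * M" and v: "v \<in> eigenspace m G \<epsilon> k c p s" "\<And>x. v x > 0"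
    proof (rule ground_state_exists[OF _ k2 rad])
      show "(\<sigma>\<^sub>1 - \<delta>) * M < (\<sigma>\<^sub>2 + \<delta>) * M" using \<sigma> \<delta> M_pos by (intro mult_strict_right_mono) auto
      show "turned k ((\<sigma>\<^sub>1 - \<delta>) * M) u" if "decaying k ((\<sigma>\<^sub>1 - \<delta>) * M) u" for u
      proof (rule low_barrier[OF 1 \<delta>(1) _ _ _ that])
        fix t assume t: "t \<in> {0..Z1}"
        have "(r1 t / v1 t)\<^sup>2 * ((e1 + t) powr (m - 2) - t powr (m - 2)) \<le> C * (\<delta> / C)"
          using A t C e1_pos m by (intro mult_mono) (auto intro!: powr_mono2)
        thus "(r1 t / v1 t)\<^sup>2 * ((e1 + t) powr (m - 2) - t powr (m - 2)) \<le> \<delta>" using C(1) by simp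
      qed (use A B small in \<open>auto simp: g1_def\<close>)
      show "\<exists>x. u x \<le> 0" if "decaying k ((\<sigma>\<^sub>2 + \<delta>) * M) u" for u
        by (rule high_barrier[OF 2 _ _ _ _ that]) (use A B small in \<open>auto simp: g1_def mult_ac\<close>)
    qed auto
    define \<sigma> where "\<sigma> = s / M"
    have s_eq: "s = \<sigma> * (k\<^sup>2 * \<Lambda> powr m)" using M_pos unfolding \<sigma>_def M_def[symmetric] by simp
    have \<sigma>: "\<sigma>\<^sub>1 - \<delta> < \<sigma>" "\<sigma> < \<sigma>\<^sub>2 + \<delta>" using s M_pos by (auto simp: \<sigma>_def field_simps)
    show "\<exists>\<sigma>. \<sigma>\<^sub>1 - \<delta> < \<sigma> \<and> \<sigma> < \<sigma>\<^sub>2 + \<delta> \<and> 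
       c\<^sup>2 + 4 * \<epsilon> * (k\<^sup>2 * \<epsilon> powr (m / (m - 2)) - \<sigma> * (k\<^sup>2 * ((c / k) powr (1 / (m - 1))) powr m)) > 0 \<and>
       (\<exists>v\<in>eigenspace m G \<epsilon> k c p (\<sigma> * (k\<^sup>2 * ((c / k) powr (1 / (m - 1))) powr m)). \<forall>x. v x > 0)"
      unfolding \<Lambda>_def[symmetric] using \<sigma> v rad[of \<sigma>] unfolding s_eq M_def by (intro exI[of _ \<sigma>]) auto
  qed (rule E)
qed

section \<open>Dependence of the speed on the temperature ahead of the front\<close>

context wave
begin

text \<open>As p^(n-1) \<ge> 1 and p' < L, adding I (p) / L to the energy still leaves it
  nonincreasing. Its value is at most 0 in the cold tail and tends to -L + I(1) / L at the hot
  end.\<close>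

lemma speed_lower_bound: "integral {0..1} G \<le> (c * (m - 2))\<^sup>2"
proof -
  define I where "I = (\<lambda>r. integral {0..r} G)"
  have dI: "(I has_real_derivative G (p x)) (at (p x))" for x
  proof -
    have "(I has_real_derivative G (p x)) (at (p x) within {0..1})"
      unfolding I_def using p_range by (intro integral_has_real_derivative continuous_on_ignition[OF ign]) auto
    moreover have "at (p x) within {0..1} = at (p x)" using p_pos[of x] p_less_1[of x] by (intro at_within_interior) auto
    ultimately show ?thesis by simp
  qed
  define L where "L = c * (m - 2)"
  have L: "L > 0" using c_pos m by (simp add: L_def)
  define \<Phi> where "\<Phi> = (\<lambda>x. energy x + I (p x) / L)"
  have anti: "\<Phi> y \<le> \<Phi> x" if "x \<le> y" for x y
  proof (rule DERIV_nonpos_imp_nonincreasing[OF that, where f = \<Phi>])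
    fix t
    have D: "(\<Phi> has_real_derivative - (p t powr n / p t * G (p t)) + G (p t) * p1 t / L) (at t)"
      unfolding \<Phi>_def by (intro DERIV_add energy_der[OF p_pos] DERIV_cdivide DERIV_chain2[OF dI p_der])
    have G: "G (p t) \<ge> 0" by (rule ignition_nonneg[OF ign p_range])
    have "n \<le> 1" using m by simp
    hence "p t powr 1 \<le> p t powr n" using p_pos[of t] p_less_1[of t] by (intro powr_mono') auto
    hence "1 \<le> p t powr n / p t" using p_pos[of t] by simp
    hence "1 * G (p t) \<le> p t powr n / p t * G (p t)" using G by (intro mult_right_mono)
    moreover have "G (p t) * (p1 t / L) \<le> G (p t) * 1"
      using p1_less[of t] L G unfolding L_def by (intro mult_left_mono) (auto simp: divide_le_eq)
    ultimately have "- (p t powr n / p t * G (p t)) + G (p t) * p1 t / L \<le> 0" by simp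
    thus "\<exists>y. (\<Phi> has_real_derivative y) (at t) \<and> y \<le> 0" using D by blast
  qed
  obtain x0 where x0: "\<And>x. x \<le> x0 \<Longrightarrow> p x < \<theta>" using p_le_\<theta>_at_bot by blast
  have "I (p x0) = integral {0..p x0} (\<lambda>_. 0)"
    unfolding I_def using x0[of x0] by (intro integral_cong) (auto intro: G_eq_0)
  hence "I (p x0) = 0" by simp
  moreover have "energy x0 \<le> 0" using energy_upper[of x0] mult_pos_pos[OF L e_pos] unfolding L_def by linarith
  ultimately have \<Phi>0: "\<Phi> x0 \<le> 0" by (simp add: \<Phi>_def)
  have "continuous_on {0..1} I"
    unfolding I_def by (intro indefinite_integral_continuous_1 integrable_continuous_real continuous_on_ignition[OF ign])
  hence "(I \<longlongrightarrow> I 1) (at 1 within {0..1})" unfolding continuous_on_def by simp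
  moreover have "filterlim p (at 1 within {0..1}) at_top"
    unfolding filterlim_at using p_at_top p_range p_less_1 by (auto simp: less_imp_neq)
  ultimately have "((\<lambda>x. I (p x)) \<longlongrightarrow> I 1) at_top" by (rule filterlim_compose)
  hence "(\<Phi> \<longlongrightarrow> 1 powr n * (0 - c * (m - 2)) + I 1 / L) at_top"
    unfolding \<Phi>_def energy_def using L by (intro tendsto_intros p_at_top p1_at_top) auto
  hence "1 powr n * (0 - c * (m - 2)) + I 1 / L \<le> \<Phi> x0"
    by (rule tendsto_upperbound[OF _ eventually_mono[OF eventually_ge_at_top[of x0] anti]]) auto
  hence "I 1 / L \<le> L" using \<Phi>0 by (simp add: L_def)
  thus ?thesis using L by (simp add: I_def L_def[symmetric] divide_le_eq power2_eq_square)
qed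

text \<open>Since p is increasing, p' can be written as a function \<open>q\<close> of the
  temperature. Waves with different \<epsilon> and speed thus become comparable on the common
  interval from \<theta> to 1.\<close>

lemma phase_plane:
  "\<exists>q. (\<forall>r\<in>{\<epsilon><..<1}. q r > 0) \<and> continuous_on {\<epsilon><..<1} q \<and>
     (\<forall>r\<in>{\<epsilon><..<1}. ((\<lambda>r. r powr n * q r) has_real_derivative r powr n / r * (c - G r / q r)) (at r)) \<and>
     \<theta> powr n * q \<theta> = c * (m - 2) * (\<theta> powr n - e) \<and>
     (\<forall>d>0. \<exists>r0<1. \<forall>r. r0 < r \<longrightarrow> r < 1 \<longrightarrow> q r < d)"
proof -
  define g where "g = inv p"
  have inj: "inj p" using p_strict_mono by (intro linorder_injI) (metis less_irrefl)
  have gp: "g (p x) = x" for x unfolding g_def using inj by simp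
  have pg: "p (g r) = r" if r: "r \<in> {\<epsilon><..<1}" for r
  proof -
    have "eventually (\<lambda>x. p x < r) at_bot" by (rule order_tendstoD(2)[OF p_at_bot]) (use r in simp)
    then obtain a where a: "p a < r" unfolding eventually_at_bot_linorder by blast
    have "eventually (\<lambda>x. p x > r) at_top" by (rule order_tendstoD[OF p_at_top]) (use r in simp)
    then obtain b where b: "p b > r" unfolding eventually_at_top_linorder by blast
    have "a \<le> b" using a b p_mono[of b a] by linarith
    then obtain x where "p x = r" using IVT'[of p a r b] a b p_cont by force
    thus ?thesis using gp by metis
  qed
  have g_cont: "isCont g r" if r: "r \<in> {\<epsilon><..<1}" for r
  proof -
    have "isCont g (p (g r))"
      by (rule isCont_inverse_function[where d = 1]) (auto simp: gp intro: DERIV_isCont[OF p_der])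
    thus ?thesis using pg[OF r] by simp
  qed
  have g_der: "(g has_real_derivative inverse (p1 (g r))) (at r)" if r: "r \<in> {\<epsilon><..<1}" for r
    by (rule DERIV_inverse_function[where f = p and a = \<epsilon> and b = 1])
       (use r p_der p1_pos[of "g r"] pg g_cont in auto)
  define q where "q = (\<lambda>r. p1 (g r))"
  show ?thesis
  proof (rule exI[of _ q], intro conjI ballI allI impI)
    show "q r > 0" for r unfolding q_def by (rule p1_pos)
    have "continuous_on {\<epsilon><..<1} g" using g_cont by (intro continuous_at_imp_continuous_on) auto
    thus "continuous_on {\<epsilon><..<1} q" unfolding q_def by (rule continuous_on_compose2[OF p1_cont[of UNIV]]) auto
    show "((\<lambda>r. r powr n * q r) has_real_derivative r powr n / r * (c - G r / q r)) (at r)" if r: "r \<in> {\<epsilon><..<1}" for r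
    proof -
      have r0: "r > 0" using r \<epsilon> by simp
      have dq: "(q has_real_derivative p2 (g r) * inverse (p1 (g r))) (at r)"
        unfolding q_def by (rule DERIV_chain2[OF p1_der g_der[OF r]])
      have dr: "((\<lambda>r. r powr n) has_real_derivative r powr n * n / r) (at r)"
        using r0 by (auto intro!: derivative_eq_intros simp: powr_diff)
      have q0: "q r > 0" unfolding q_def by (rule p1_pos)
      have "r * p2 (g r) = (c - q r / (m - 2)) * q r - G r"
        using ode[of "g r"] pg[OF r] by (simp add: q_def)
      hence p2: "p2 (g r) = ((c - n * q r) * q r - G r) / r" using r0 by (simp add: eq_divide_eq mult.commute)
      have "r powr n * (p2 (g r) * inverse (p1 (g r))) + r powr n * n / r * q r = r powr n / r * (c - G r / q r)"
      proof -
        have "z * (((c - a * y) * y - b) / w * inverse y) + z * a / w * y = z / w * (c - b / y)"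
          if "w > 0" "y > 0" for a b w y z :: real
          using that by (simp add: field_simps)
        from this[OF r0 q0] show ?thesis unfolding p2 unfolding q_def .
      qed
      thus ?thesis using DERIV_mult'[OF dr dq] by simp
    qed
    have "\<theta> \<in> {\<epsilon><..<1}" using \<epsilon> \<theta> by simp
    thus "\<theta> powr n * q \<theta> = c * (m - 2) * (\<theta> powr n - e)"
      unfolding q_def using p1_eq[of "g \<theta>"] pg by simp
    show "\<exists>r0<1. \<forall>r. r0 < r \<longrightarrow> r < 1 \<longrightarrow> q r < d" if "d > 0" for d
    proof -
      have "eventually (\<lambda>x. p1 x < d) at_top" by (rule order_tendstoD(2)[OF p1_at_top that])
      then obtain x0 where x0: "\<And>x. x \<ge> x0 \<Longrightarrow> p1 x < d" unfolding eventually_at_top_linorder by blast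
      show ?thesis
      proof (intro exI[of _ "p x0"] conjI allI impI p_less_1)
        fix r assume r: "p x0 < r" "r < 1"
        hence "p (g r) = r" using p_gt[of x0] by (intro pg) auto
        hence "x0 \<le> g r" using r p_mono[of "g r" x0] by force
        thus "q r < d" unfolding q_def by (rule x0)
      qed
    qed
  qed
qed

end

text \<open>If the colder wave were at least as fast, its orbit would lie strictly above the other
  at \<theta>. The weighted gap D satisfies D' \<ge> \<alpha> D with \<alpha> \<ge> 0, so it cannot
  shrink; yet the upper orbit tends to 0 at temperature 1.\<close>

lemma speed_strict_mono:
  assumes w1: "wave m \<theta> \<epsilon>\<^sub>1 c\<^sub>1 G pa" and w2: "wave m \<theta> \<epsilon>\<^sub>2 c\<^sub>2 G pb" and "\<epsilon>\<^sub>1 < \<epsilon>\<^sub>2"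
  shows "c\<^sub>1 < c\<^sub>2"
proof (rule ccontr)
  assume "\<not> c\<^sub>1 < c\<^sub>2"
  hence c: "c\<^sub>2 \<le> c\<^sub>1" by simp
  interpret A: wave m \<theta> \<epsilon>\<^sub>1 c\<^sub>1 G pa by (rule w1)
  interpret B: wave m \<theta> \<epsilon>\<^sub>2 c\<^sub>2 G pb by (rule w2)
  define n where "n = 1 / (m - 2)"
  have m: "m > 3" by (rule A.m)
  have n: "n > 0" using m by (simp add: n_def)
  from A.phase_plane[folded n_def] obtain q1 where "(\<forall>r\<in>{\<epsilon>\<^sub>1<..<1}. q1 r > 0) \<and> continuous_on {\<epsilon>\<^sub>1<..<1} q1 \<and>
     (\<forall>r\<in>{\<epsilon>\<^sub>1<..<1}. ((\<lambda>r. r powr n * q1 r) has_real_derivative r powr n / r * (c\<^sub>1 - G r / q1 r)) (at r)) \<and>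
     \<theta> powr n * q1 \<theta> = c\<^sub>1 * (m - 2) * (\<theta> powr n - \<epsilon>\<^sub>1 powr n) \<and>
     (\<forall>d>0. \<exists>r0<1. \<forall>r. r0 < r \<longrightarrow> r < 1 \<longrightarrow> q1 r < d)" ..
  note q1 = this[THEN conjunct1, rule_format] this[THEN conjunct2, THEN conjunct1] this[THEN conjunct2, THEN conjunct2, THEN conjunct1, rule_format]
    this[THEN conjunct2, THEN conjunct2, THEN conjunct2, THEN conjunct1] this[THEN conjunct2, THEN conjunct2, THEN conjunct2, THEN conjunct2, rule_format]
  from B.phase_plane[folded n_def] obtain q2 where "(\<forall>r\<in>{\<epsilon>\<^sub>2<..<1}. q2 r > 0) \<and> continuous_on {\<epsilon>\<^sub>2<..<1} q2 \<and>
     (\<forall>r\<in>{\<epsilon>\<^sub>2<..<1}. ((\<lambda>r. r powr n * q2 r) has_real_derivative r powr n / r * (c\<^sub>2 - G r / q2 r)) (at r)) \<and>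
     \<theta> powr n * q2 \<theta> = c\<^sub>2 * (m - 2) * (\<theta> powr n - \<epsilon>\<^sub>2 powr n) \<and>
     (\<forall>d>0. \<exists>r0<1. \<forall>r. r0 < r \<longrightarrow> r < 1 \<longrightarrow> q2 r < d)" ..
  note q2 = this[THEN conjunct1, rule_format] this[THEN conjunct2, THEN conjunct1] this[THEN conjunct2, THEN conjunct2, THEN conjunct1, rule_format]
    this[THEN conjunct2, THEN conjunct2, THEN conjunct2, THEN conjunct1] this[THEN conjunct2, THEN conjunct2, THEN conjunct2, THEN conjunct2, rule_format]
  have in12: "r \<in> {\<epsilon>\<^sub>1<..<1}" "r \<in> {\<epsilon>\<^sub>2<..<1}" if "r \<in> {\<theta>..<1}" for r
    using that A.\<epsilon> B.\<epsilon> by auto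
  define D where "D = (\<lambda>r. r powr n * q1 r - r powr n * q2 r)"
  define D' where "D' = (\<lambda>r. r powr n / r * (c\<^sub>1 - G r / q1 r) - r powr n / r * (c\<^sub>2 - G r / q2 r))"
  define \<alpha> where "\<alpha> = (\<lambda>r. G r / (r * q1 r * q2 r))"
  have dD: "(D has_real_derivative D' r) (at r)" if "r \<in> {\<theta>..<1}" for r
    unfolding D_def D'_def using DERIV_diff[OF q1(3)[OF in12(1)[OF that]] q2(3)[OF in12(2)[OF that]]] .
  have D'_ge: "D' r \<ge> \<alpha> r * D r" if r: "r \<in> {\<theta>..<1}" for r
  proof -
    have r0: "r > 0" using r A.\<theta> by simp
    have q: "q1 r > 0" "q2 r > 0" using q1(1) q2(1) in12[OF r] by auto
    have "D' r = r powr n / r * (c\<^sub>1 - c\<^sub>2) + \<alpha> r * D r"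
      unfolding D'_def \<alpha>_def D_def using r0 q by (simp add: field_simps)
    thus ?thesis using c r0 by simp
  qed
  have \<alpha>: "\<alpha> r \<ge> 0" if r: "r \<in> {\<theta>..<1}" for r
    unfolding \<alpha>_def using q1(1)[OF in12(1)[OF r]] q2(1)[OF in12(2)[OF r]] r A.\<theta> ignition_nonneg[OF A.ign, of r] by simp
  have D\<theta>: "D \<theta> > 0"
  proof -
    have "\<epsilon>\<^sub>1 powr n < \<epsilon>\<^sub>2 powr n" "\<epsilon>\<^sub>2 powr n < \<theta> powr n"
      using assms(3) A.\<epsilon> B.\<epsilon> n by (auto intro!: powr_less_mono2)
    hence "c\<^sub>2 * (m - 2) * (\<theta> powr n - \<epsilon>\<^sub>2 powr n) < c\<^sub>2 * (m - 2) * (\<theta> powr n - \<epsilon>\<^sub>1 powr n)"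
      using B.c_pos m by (intro mult_strict_left_mono) auto
    also have "\<dots> \<le> c\<^sub>1 * (m - 2) * (\<theta> powr n - \<epsilon>\<^sub>1 powr n)"
      using c m \<open>\<epsilon>\<^sub>1 powr n < \<epsilon>\<^sub>2 powr n\<close> \<open>\<epsilon>\<^sub>2 powr n < \<theta> powr n\<close> by (intro mult_right_mono) auto
    finally show ?thesis unfolding D_def q1(4) q2(4) by simp
  qed
  have D_pos: "D b > 0" if b: "b \<in> {\<theta>..<1}" for b
  proof (rule linear_inequality_pos[where f = D and f' = D' and \<alpha> = \<alpha> and a = \<theta>])
    have "continuous_on {\<theta>..b} q1" "continuous_on {\<theta>..b} q2"
      using b in12 by (auto intro!: continuous_on_subset[OF q1(2)] continuous_on_subset[OF q2(2)])
    moreover have "continuous_on {\<theta>..b} G" using b A.\<theta> by (intro continuous_on_subset[OF continuous_on_ignition[OF A.ign]]) auto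
    ultimately show "continuous_on {\<theta>..b} \<alpha>" unfolding \<alpha>_def
    proof (intro continuous_intros)
      show "\<forall>x\<in>{\<theta>..b}. x * q1 x * q2 x \<noteq> 0"
        using q1(1) q2(1) in12 b A.\<theta> by (auto simp: less_imp_neq[THEN not_sym])
    qed
  qed (use b dD D'_ge D\<theta> in auto)
  have D_ge: "D b \<ge> D \<theta>" if b: "b \<in> {\<theta>..<1}" for b
  proof (rule DERIV_nonneg_imp_nondecreasing[where f = D])
    fix r assume "\<theta> \<le> r" "r \<le> b"
    hence r: "r \<in> {\<theta>..<1}" using b by simp
    have "0 \<le> \<alpha> r * D r" using \<alpha>[OF r] D_pos[OF r] by simp
    thus "\<exists>y. (D has_real_derivative y) (at r) \<and> 0 \<le> y" using dD[OF r] D'_ge[OF r] by (intro exI[of _ "D' r"]) auto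
  qed (use b in simp)
  obtain r0 where r0: "r0 < 1" "\<And>r. r0 < r \<Longrightarrow> r < 1 \<Longrightarrow> q1 r < D \<theta>" using q1(5)[OF D\<theta>] by blast
  define r where "r = (max r0 \<theta> + 1) / 2"
  have r: "r0 < r" "r < 1" "r \<in> {\<theta>..<1}" using r0(1) A.\<theta> by (auto simp: r_def)
  have "r powr n \<le> 1" using r A.\<theta> n by (intro powr_le1) auto
  have "D r \<le> r powr n * q1 r" using q2(1)[OF in12(2)[OF r(3)]] by (simp add: D_def)
  also have "\<dots> \<le> 1 * q1 r" using \<open>r powr n \<le> 1\<close> q1(1)[OF in12(1)[OF r(3)]] by (intro mult_right_mono) auto
  also have "\<dots> < D \<theta>" using r0(2)[OF r(1,2)] by simp
  finally show False using D_ge[OF r(3)] by simp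
qed

lemma ignition_integral_pos:
  assumes ign: "ignition G \<theta>"
  shows "integral {0..1} G > 0"
proof -
  have \<theta>: "0 < \<theta>" "\<theta> < 1" and G: "\<And>y. y \<in> {0..\<theta>} \<Longrightarrow> G y = 0" "\<And>y. y \<in> {\<theta><..<1} \<Longrightarrow> G y > 0"
    using ign unfolding ignition_def by auto
  define I where "I = (\<lambda>r. integral {0..r} G)"
  have cont: "continuous_on {0..1} I"
    unfolding I_def by (intro indefinite_integral_continuous_1 integrable_continuous_real continuous_on_ignition[OF ign])
  have "I \<theta> < I 1"
  proof (rule DERIV_pos_imp_increasing_open[OF \<theta>(2)])
    fix x assume x: "\<theta> < x" "x < 1"
    have "(I has_real_derivative G x) (at x within {0..1})"
      unfolding I_def using x \<theta> by (intro integral_has_real_derivative continuous_on_ignition[OF ign]) auto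
    moreover have "at x within {0..1} = at x" using x \<theta> by (intro at_within_interior) auto
    ultimately show "\<exists>y. (I has_real_derivative y) (at x) \<and> 0 < y" using G(2)[of x] x by auto
  qed (use \<theta> in \<open>auto intro: continuous_on_subset[OF cont]\<close>)
  moreover have "I \<theta> = integral {0..\<theta>} (\<lambda>_. 0)" unfolding I_def by (intro integral_cong) (auto intro: G(1))
  ultimately show ?thesis by (simp add: I_def)
qed

section \<open>The principal eigenvalue\<close>

text \<open>Source of the exponent 1 - 1 / (m - 1) of k and of the power of c_0 in
  \<gamma>_0.\<close>

lemma scale_eq:
  fixes m c k :: real
  assumes "m > 3" "c > 0" "k > 0"
  shows "k\<^sup>2 * ((c / k) powr (1 / (m - 1))) powr m = c powr (m / (m - 1)) * k powr (1 - 1 / (m - 1))"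
proof -
  have "k\<^sup>2 * ((c / k) powr (1 / (m - 1))) powr m = k powr 2 * (c powr (m / (m - 1)) / k powr (m / (m - 1)))"
    using assms by (simp add: powr_powr powr_divide)
  also have "\<dots> = c powr (m / (m - 1)) * k powr (2 - m / (m - 1))" by (simp add: powr_diff)
  also have "2 - m / (m - 1) = 1 - 1 / (m - 1)" using assms by (simp add: field_simps)
  finally show ?thesis .
qed

text \<open>k < \<epsilon>^(\<eta> - 1/(m-2)) forces \<epsilon> to be small for large k; for \<eta>
  \<ge> 1 / (m - 2) nothing of the region lies above k = 1. Moreover \<epsilon>^\<eta> \<le> 1 gives
  \<epsilon>^(1/(m-2)) < 1 / k, while \<Lambda> is only of order k^(-b) with b < 1.\<close>

lemma region_small:
  fixes m c\<^sub>0 E \<epsilon>\<^sub>1 :: real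
  assumes m: "m > 3" and "c\<^sub>0 > 0" "E > 0" "\<epsilon>\<^sub>1 > 0" "\<theta> < 1"
  shows "\<exists>K\<ge>1. \<forall>\<epsilon> k c. (\<epsilon>, k) \<in> region m \<theta> \<eta> K \<longrightarrow> \<eta> > 0 \<longrightarrow> \<epsilon> < \<epsilon>\<^sub>1 \<and>
     (c\<^sub>0 \<le> c \<longrightarrow> c \<le> 2 * c\<^sub>0 \<longrightarrow> (c / k) powr (1 / (m - 1)) < E \<and>
        \<epsilon> powr (1 / (m - 2)) / (c / k) powr (1 / (m - 1)) < E)"
proof -
  define b where "b = 1 / (m - 1)"
  have b: "0 < b" "b < 1" using m by (auto simp: b_def)
  \<comment> \<open>The second entry forces \<epsilon> below \<open>\<epsilon>\<^sub>1\<close>, the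
    third makes \<Lambda> < E, and the last makes e1 < E.\<close>
  define K where "K = Max {1, \<epsilon>\<^sub>1 powr (\<eta> - 1 / (m - 2)), 2 * c\<^sub>0 / E powr (1 / b), (1 / (E * c\<^sub>0 powr b)) powr (1 / (1 - b))}"
  have K: "1 \<le> K" "\<epsilon>\<^sub>1 powr (\<eta> - 1 / (m - 2)) \<le> K" "2 * c\<^sub>0 / E powr (1 / b) \<le> K" "(1 / (E * c\<^sub>0 powr b)) powr (1 / (1 - b)) \<le> K"
    unfolding K_def by auto
  have "\<epsilon> < \<epsilon>\<^sub>1 \<and> (c\<^sub>0 \<le> c \<longrightarrow> c \<le> 2 * c\<^sub>0 \<longrightarrow> (c / k) powr b < E \<and> \<epsilon> powr (1 / (m - 2)) / (c / k) powr b < E)"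
    if R: "(\<epsilon>, k) \<in> region m \<theta> \<eta> K" and \<eta>: "\<eta> > 0" for \<epsilon> k c
  proof -
    have \<epsilon>: "0 < \<epsilon>" "\<epsilon> < 1" and k: "k > K" and kR: "k < \<epsilon> powr \<eta> / \<epsilon> powr (1 / (m - 2))"
      using R assms(5) unfolding region_def by auto
    have kR': "k < \<epsilon> powr (\<eta> - 1 / (m - 2))" using kR by (simp add: powr_diff)
    have "\<epsilon> < \<epsilon>\<^sub>1"
    proof (rule ccontr)
      assume "\<not> \<epsilon> < \<epsilon>\<^sub>1"
      hence le: "\<epsilon>\<^sub>1 \<le> \<epsilon>" by simp
      show False
      proof (cases "\<eta> - 1 / (m - 2) \<ge> 0")
        case True
        hence "\<epsilon> powr (\<eta> - 1 / (m - 2)) \<le> 1" using \<epsilon> by (intro powr_le1) auto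
        thus False using kR' k K(1) by linarith
      next
        case False
        hence "\<epsilon> powr (\<eta> - 1 / (m - 2)) \<le> \<epsilon>\<^sub>1 powr (\<eta> - 1 / (m - 2))" using le assms(4) by (intro powr_mono2') auto
        thus False using kR' k K(2) by linarith
      qed
    qed
    moreover have "(c / k) powr b < E" if c: "c\<^sub>0 \<le> c" "c \<le> 2 * c\<^sub>0"
    proof -
      have "2 * c\<^sub>0 / E powr (1 / b) < k" using K(3) k by linarith
      hence "2 * c\<^sub>0 < k * E powr (1 / b)" using assms(3) by (simp add: divide_less_eq)
      hence "c / k < E powr (1 / b)" using c k K(1) by (simp add: divide_less_eq mult.commute)
      hence "(c / k) powr b < (E powr (1 / b)) powr b" using c assms(2) k K(1) b by (intro powr_less_mono2) auto
      thus ?thesis using b assms(3) by (simp add: powr_powr)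
    qed
    moreover have "\<epsilon> powr (1 / (m - 2)) / (c / k) powr b < E" if c: "c\<^sub>0 \<le> c"
    proof -
      have k0: "k > 0" using k K(1) by simp
      have "k * \<epsilon> powr (1 / (m - 2)) < \<epsilon> powr \<eta>" using kR \<epsilon> by (simp add: less_divide_eq)
      also have "\<dots> \<le> 1" using \<epsilon> \<eta> by (intro powr_le1) auto
      finally have e: "\<epsilon> powr (1 / (m - 2)) < 1 / k" using k0 by (simp add: less_divide_eq mult.commute)
      have "c\<^sub>0 powr b \<le> c powr b" using c assms(2) b by (intro powr_mono2) auto
      hence c0b: "c\<^sub>0 powr b / k powr b \<le> (c / k) powr b" using c assms(2) k0 by (simp add: powr_divide divide_right_mono)
      have "\<epsilon> powr (1 / (m - 2)) / (c / k) powr b \<le> \<epsilon> powr (1 / (m - 2)) / (c\<^sub>0 powr b / k powr b)"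
        using c0b assms(2) k0 \<epsilon> c by (intro divide_left_mono mult_pos_pos) auto
      also have "\<dots> < (1 / k) / (c\<^sub>0 powr b / k powr b)"
        using e assms(2) k0 by (intro divide_strict_right_mono) auto
      also have "\<dots> = 1 / (c\<^sub>0 powr b * k powr (1 - b))"
        using k0 by (simp add: powr_diff field_simps)
      also have "\<dots> \<le> E"
      proof -
        have "1 / (E * c\<^sub>0 powr b) = ((1 / (E * c\<^sub>0 powr b)) powr (1 / (1 - b))) powr (1 - b)"
          using b assms(2,3) by (simp add: powr_powr)
        also have "\<dots> \<le> k powr (1 - b)" using K(4) k b by (intro powr_mono2) auto
        finally show ?thesis using assms(2,3) k0 by (simp add: field_simps)
      qed
      finally show ?thesis .
    qed
    ultimately show ?thesis by simp
  qed
  thus ?thesis using K(1) unfolding b_def by (intro exI[of _ K] conjI) simp_all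
qed

theorem theorem1:
  fixes m \<theta> :: real and G :: "real \<Rightarrow> real"
  assumes "m > 3" and "ignition G \<theta>"
  shows "\<exists>\<gamma>\<^sub>0>0. \<forall>\<eta>>0. \<exists>k\<^sub>0>0.
    \<forall>(c :: real \<Rightarrow> real) (p :: real \<Rightarrow> real \<Rightarrow> real).
      (\<forall>\<epsilon>\<in>{0<..<\<theta>}. travelling_wave m G \<epsilon> (c \<epsilon>) (p \<epsilon>)) \<longrightarrow>
      (\<exists>s :: real \<Rightarrow> real \<Rightarrow> real.
        (\<forall>(\<epsilon>, k) \<in> region m \<theta> \<eta> k\<^sub>0.
           s \<epsilon> k > 0 \<and>
           principal_eigenvalue m G \<epsilon> k (c \<epsilon>) (p \<epsilon>) (s \<epsilon> k) \<and>
           (\<forall>s'. eigenvalue m G \<epsilon> k (c \<epsilon>) (p \<epsilon>) s' \<longrightarrow> s \<epsilon> k \<le> s') \<and>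
           (\<forall>s'. principal_eigenvalue m G \<epsilon> k (c \<epsilon>) (p \<epsilon>) s' \<longrightarrow> s' = s \<epsilon> k) \<and>
           one_dimensional (eigenspace m G \<epsilon> k (c \<epsilon>) (p \<epsilon>) (s \<epsilon> k))) \<and>
        ((\<lambda>(\<epsilon>, k). s \<epsilon> k / (\<gamma>\<^sub>0 * k powr (1 - 1 / (m - 1)))) \<longlongrightarrow> 1)
          (inf (at_right 0 \<times>\<^sub>F at_top) (principal (region m \<theta> \<eta> k\<^sub>0))))"
proof -
  note m = assms(1) and ign = assms(2)
  have \<theta>: "0 < \<theta>" "\<theta> < 1" using ign unfolding ignition_def by simp_all
  define speeds where "speeds = {c. \<exists>\<epsilon> p. wave m \<theta> \<epsilon> c G p}"
  have wave_iff: "wave m \<theta> \<epsilon> c G p \<longleftrightarrow> 0 < \<epsilon> \<and> \<epsilon> < \<theta> \<and> travelling_wave m G \<epsilon> c p" for \<epsilon> c p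
    using m ign by (simp add: wave_def)
  show ?thesis
  proof (cases "speeds = {}")
    case True
    \<comment> \<open>Without any wave the hypothesis on \<open>c\<close> and \<open>p\<close>
      fails; otherwise the infimum of speeds is taken over a nonempty set.\<close>
    have "\<not> (\<forall>\<epsilon>\<in>{0<..<\<theta>}. travelling_wave m G \<epsilon> (c \<epsilon>) (p \<epsilon>))" for c p
    proof
      assume "\<forall>\<epsilon>\<in>{0<..<\<theta>}. travelling_wave m G \<epsilon> (c \<epsilon>) (p \<epsilon>)"
      hence "wave m \<theta> (\<theta> / 2) (c (\<theta> / 2)) G (p (\<theta> / 2))" using \<theta> unfolding wave_iff by simp
      thus False using True unfolding speeds_def by blast
    qed
    thus ?thesis by (intro exI[of _ 1]) (auto intro!: exI[of _ "1::real"])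
  next
    case False
    define c\<^sub>0 where "c\<^sub>0 = Inf speeds"
    define cmin where "cmin = sqrt (integral {0..1} G) / (m - 2)"
    have cmin: "cmin > 0" using ignition_integral_pos[OF ign] m by (simp add: cmin_def)
    have cmin_le: "cmin \<le> c" if c: "c \<in> speeds" for c
    proof -
      obtain \<epsilon> p where w: "wave m \<theta> \<epsilon> c G p" using c unfolding speeds_def by blast
      have "sqrt (integral {0..1} G) \<le> c * (m - 2)"
        using wave.speed_lower_bound[OF w] wave.c_pos[OF w] m by (intro real_le_lsqrt) auto
      thus ?thesis using m by (simp add: cmin_def divide_le_eq)
    qed
    have bdd: "bdd_below speeds" using cmin_le by (intro bdd_belowI)
    have c\<^sub>0: "c\<^sub>0 > 0" using cInf_greatest[OF False cmin_le] cmin unfolding c\<^sub>0_def by linarith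
    have c\<^sub>0_le: "c\<^sub>0 \<le> c" if "c \<in> speeds" for c unfolding c\<^sub>0_def by (rule cInf_lower[OF that bdd])
    \<comment> \<open>A single wave of nearly minimal speed bounds, by monotonicity, the speed of
      every wave with smaller \<epsilon>.\<close>
    have near: "\<exists>\<epsilon>\<^sub>1>0. \<forall>\<epsilon> c p. wave m \<theta> \<epsilon> c G p \<longrightarrow> \<epsilon> < \<epsilon>\<^sub>1 \<longrightarrow> c\<^sub>0 \<le> c \<and> c < y" if y: "y > c\<^sub>0" for y
    proof -
      obtain c1 where "c1 \<in> speeds" "c1 < y" using y cInf_less_iff[OF False bdd, of y] unfolding c\<^sub>0_def by blast
      then obtain \<epsilon>\<^sub>1 p1 where w1: "wave m \<theta> \<epsilon>\<^sub>1 c1 G p1" unfolding speeds_def by blast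
      have "c\<^sub>0 \<le> c \<and> c < y" if "wave m \<theta> \<epsilon> c G p" "\<epsilon> < \<epsilon>\<^sub>1" for \<epsilon> c p
        using speed_strict_mono[OF that(1) w1 that(2)] \<open>c1 < y\<close> c\<^sub>0_le[of c] that(1) unfolding speeds_def by force
      thus ?thesis using wave_iff w1 by blast
    qed
    obtain \<gamma> where \<gamma>: "\<gamma> > 0"
      and low: "\<And>\<delta>. \<delta> > 0 \<Longrightarrow> \<exists>\<sigma>. 0 < \<sigma> \<and> \<gamma> - \<delta> < \<sigma> \<and> \<sigma> \<le> \<gamma> \<and> turning m \<sigma>"
      and high: "\<And>\<delta>. \<delta> > 0 \<Longrightarrow> \<exists>\<sigma>. \<gamma> < \<sigma> \<and> \<sigma> < \<gamma> + \<delta> \<and> vanishing m \<sigma>"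
      using limit_eigenvalue_exists[OF m] by blast
    define q where "q = m / (m - 1)"
    define \<gamma>\<^sub>0 where "\<gamma>\<^sub>0 = \<gamma> * c\<^sub>0 powr q"
    have \<gamma>\<^sub>0: "\<gamma>\<^sub>0 > 0" using \<gamma> c\<^sub>0 by (simp add: \<gamma>\<^sub>0_def)
    \<comment> \<open>The sign of the radicand is carried along because the Wronskian argument needs
      it; it makes a good s unique.\<close>
    define good where "good = (\<lambda>\<epsilon> k c p s. s > 0 \<and> c\<^sup>2 + 4 * \<epsilon> * (k\<^sup>2 * \<epsilon> powr (m / (m - 2)) - s) > 0 \<and>
       (\<exists>v\<in>eigenspace m G \<epsilon> k c p s. \<forall>x. v x > (0::real)))"
    have good_unique: "s' = s" if w: "wave m \<theta> \<epsilon> c G p" and g: "good \<epsilon> k c p s" "good \<epsilon> k c p s'" for \<epsilon> k c p s s'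
    proof -
      obtain v where v: "v \<in> eigenspace m G \<epsilon> k c p s" "\<And>x. v x > 0" using g(1) unfolding good_def by blast
      have "principal_eigenvalue m G \<epsilon> k c p s'" using g(2) unfolding good_def principal_eigenvalue_def by blast
      thus ?thesis using wave.principal_eigenvalue_properties(3)[OF w v] g(1) unfolding good_def by blast
    qed
    \<comment> \<open>Used with d = 1 to fix k_0, and with arbitrary d for the limit.\<close>
    have key: "\<exists>K\<ge>1. \<forall>\<epsilon> k c p. (\<epsilon>, k) \<in> region m \<theta> \<eta> K \<longrightarrow> wave m \<theta> \<epsilon> c G p \<longrightarrow>
        (\<exists>s. good \<epsilon> k c p s \<and> \<bar>s / (\<gamma>\<^sub>0 * k powr (1 - 1 / (m - 1))) - 1\<bar> < d)"
      if d: "d > 0" and \<eta>: "\<eta> > 0" for d \<eta>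
    proof -
      \<comment> \<open>The ratio will be (\<sigma> / \<gamma>) b with \<bar>\<sigma> / \<gamma> -
        1\<bar> < a and 1 \<le> b < 1 + a < 2, so it differs from 1 by less than 2 a + a \<le> d. As
        \<sigma> lies within 2 \<delta> of \<gamma>, the choice of \<delta> below fits.\<close>
      define a where "a = min (1 / 2) (d / 3)"
      have a: "0 < a" "a \<le> 1 / 2" "3 * a \<le> d" using d by (auto simp: a_def)
      define \<delta> where "\<delta> = a * \<gamma> / 2"
      have \<delta>: "\<delta> > 0" using a \<gamma> by (simp add: \<delta>_def)
      obtain \<sigma>\<^sub>1 where \<sigma>\<^sub>1: "0 < \<sigma>\<^sub>1" "\<gamma> - \<delta> < \<sigma>\<^sub>1" "\<sigma>\<^sub>1 \<le> \<gamma>" "turning m \<sigma>\<^sub>1" using low[OF \<delta>] by blast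
      obtain \<sigma>\<^sub>2 where \<sigma>\<^sub>2: "\<gamma> < \<sigma>\<^sub>2" "\<sigma>\<^sub>2 < \<gamma> + \<delta>" "vanishing m \<sigma>\<^sub>2" using high[OF \<delta>] by blast
      have "\<sigma>\<^sub>1 < \<sigma>\<^sub>2" using \<sigma>\<^sub>1 \<sigma>\<^sub>2 by simp
      obtain E where E: "E > 0" and ground: "\<And>\<epsilon> c p k. wave m \<theta> \<epsilon> c G p \<Longrightarrow> k > 0 \<Longrightarrow> (c / k) powr (1 / (m - 1)) < E \<Longrightarrow>
           \<epsilon> powr (1 / (m - 2)) / (c / k) powr (1 / (m - 1)) < E \<Longrightarrow>
           (\<exists>\<sigma>. \<sigma>\<^sub>1 - \<delta> < \<sigma> \<and> \<sigma> < \<sigma>\<^sub>2 + \<delta> \<and> 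
             c\<^sup>2 + 4 * \<epsilon> * (k\<^sup>2 * \<epsilon> powr (m / (m - 2)) - \<sigma> * (k\<^sup>2 * ((c / k) powr (1 / (m - 1))) powr m)) > 0 \<and>
             (\<exists>v\<in>eigenspace m G \<epsilon> k c p (\<sigma> * (k\<^sup>2 * ((c / k) powr (1 / (m - 1))) powr m)). \<forall>x. v x > 0))"
        using uniform_ground_state[OF m ign \<delta> \<sigma>\<^sub>1(4) \<sigma>\<^sub>2(3) \<open>\<sigma>\<^sub>1 < \<sigma>\<^sub>2\<close> \<sigma>\<^sub>1(1)] by blast
      \<comment> \<open>The factor 2 keeps c within the range allowed by
        \<open>region_small\<close>; the other one gives (c / c_0)^q < 1 + a.\<close>
      define y where "y = c\<^sub>0 * min 2 ((1 + a) powr (1 / q))"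
      have q: "q > 0" using m by (simp add: q_def)
      have "(1 + a) powr (1 / q) > 1" using a q by (intro gr_one_powr) auto
      hence "y > c\<^sub>0" using c\<^sub>0 by (simp add: y_def)
      obtain \<epsilon>\<^sub>1 where \<epsilon>\<^sub>1: "\<epsilon>\<^sub>1 > 0" "\<And>\<epsilon> c p. wave m \<theta> \<epsilon> c G p \<Longrightarrow> \<epsilon> < \<epsilon>\<^sub>1 \<Longrightarrow> c\<^sub>0 \<le> c \<and> c < y"
        using near[OF \<open>y > c\<^sub>0\<close>] by blast
      obtain K where K: "K \<ge> 1" and small: "\<And>\<epsilon> k c. (\<epsilon>, k) \<in> region m \<theta> \<eta> K \<Longrightarrow> \<epsilon> < \<epsilon>\<^sub>1 \<and>
          (c\<^sub>0 \<le> c \<longrightarrow> c \<le> 2 * c\<^sub>0 \<longrightarrow> (c / k) powr (1 / (m - 1)) < E \<and> \<epsilon> powr (1 / (m - 2)) / (c / k) powr (1 / (m - 1)) < E)"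
        using region_small[OF m c\<^sub>0 E \<epsilon>\<^sub>1(1) \<theta>(2), of \<eta>] \<eta> by blast
      have "\<exists>s. good \<epsilon> k c p s \<and> \<bar>s / (\<gamma>\<^sub>0 * k powr (1 - 1 / (m - 1))) - 1\<bar> < d"
        if R: "(\<epsilon>, k) \<in> region m \<theta> \<eta> K" and w: "wave m \<theta> \<epsilon> c G p" for \<epsilon> k c p
      proof -
        have k: "k > 0" using R K unfolding region_def by auto
        have c: "c\<^sub>0 \<le> c" "c < y" using \<epsilon>\<^sub>1(2)[OF w] small[OF R] by auto
        have cpos: "c > 0" using c c\<^sub>0 by simp
        have "y \<le> c\<^sub>0 * 2" unfolding y_def using c\<^sub>0 by (intro mult_left_mono) auto
        hence "c \<le> 2 * c\<^sub>0" using c by simp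
        then obtain \<sigma> where \<sigma>: "\<sigma>\<^sub>1 - \<delta> < \<sigma>" "\<sigma> < \<sigma>\<^sub>2 + \<delta>"
            "c\<^sup>2 + 4 * \<epsilon> * (k\<^sup>2 * \<epsilon> powr (m / (m - 2)) - \<sigma> * (c powr q * k powr (1 - 1 / (m - 1)))) > 0"
            "\<exists>v\<in>eigenspace m G \<epsilon> k c p (\<sigma> * (c powr q * k powr (1 - 1 / (m - 1)))). \<forall>x. v x > 0"
          using ground[OF w k] small[OF R, of c] c unfolding scale_eq[OF m cpos k] q_def by blast
        define s where "s = \<sigma> * (c powr q * k powr (1 - 1 / (m - 1)))"
        have \<sigma>_near: "\<bar>\<sigma> / \<gamma> - 1\<bar> < a"
        proof -
          have "\<bar>\<sigma> - \<gamma>\<bar> < a * \<gamma>" using \<sigma>(1,2) \<sigma>\<^sub>1 \<sigma>\<^sub>2 by (simp add: \<delta>_def abs_less_iff)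
          moreover have "\<sigma> / \<gamma> - 1 = (\<sigma> - \<gamma>) / \<gamma>" using \<gamma> by (simp add: diff_divide_distrib)
          ultimately show ?thesis using \<gamma> by (simp add: abs_divide divide_less_eq)
        qed
        have "\<sigma> > 0"
        proof -
          have "\<sigma> / \<gamma> > 0" using \<sigma>_near a by linarith
          thus ?thesis using \<gamma> by (simp add: zero_less_divide_iff)
        qed
        hence "good \<epsilon> k c p s" unfolding good_def s_def using \<sigma>(3,4) cpos k by auto
        define b where "b = (c / c\<^sub>0) powr q"
        have b: "1 \<le> b" "b < 1 + a"
        proof -
          show "1 \<le> b" unfolding b_def using c c\<^sub>0 q by (intro ge_one_powr_ge_zero) auto
          have "y \<le> c\<^sub>0 * (1 + a) powr (1 / q)" unfolding y_def using c\<^sub>0 by (intro mult_left_mono) auto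
          hence "c < c\<^sub>0 * (1 + a) powr (1 / q)" using c(2) by linarith
          hence "c / c\<^sub>0 < (1 + a) powr (1 / q)" using c\<^sub>0 by (simp add: divide_less_eq mult.commute)
          hence "b < ((1 + a) powr (1 / q)) powr q" unfolding b_def using cpos c\<^sub>0 q by (intro powr_less_mono2) auto
          thus "b < 1 + a" using q a by (simp add: powr_powr)
        qed
        have "s / (\<gamma>\<^sub>0 * k powr (1 - 1 / (m - 1))) = \<sigma> / \<gamma> * b"
          unfolding s_def \<gamma>\<^sub>0_def b_def using k cpos c\<^sub>0 by (simp add: powr_divide)
        moreover have "\<bar>\<sigma> / \<gamma> * b - 1\<bar> < d"
        proof -
          have "\<bar>(\<sigma> / \<gamma> - 1) * b\<bar> \<le> a * 2"
            unfolding abs_mult using \<sigma>_near b a by (intro mult_mono) auto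
          moreover have "(\<sigma> / \<gamma>) * b - 1 = (\<sigma> / \<gamma> - 1) * b + (b - 1)" by (simp add: algebra_simps)
          moreover have "\<bar>b - 1\<bar> < a" using b by simp
          ultimately show ?thesis using a(3) by linarith
        qed
        ultimately show ?thesis using \<open>good \<epsilon> k c p s\<close> by auto
      qed
      thus ?thesis using K by blast
    qed
    show ?thesis
    proof (rule exI[of _ \<gamma>\<^sub>0], intro conjI allI impI \<gamma>\<^sub>0)
      fix \<eta> :: real assume \<eta>: "\<eta> > 0"
      obtain k\<^sub>0 where k\<^sub>0: "k\<^sub>0 \<ge> 1" and exist: "\<And>\<epsilon> k c p. (\<epsilon>, k) \<in> region m \<theta> \<eta> k\<^sub>0 \<Longrightarrow> wave m \<theta> \<epsilon> c G p \<Longrightarrow> \<exists>s. good \<epsilon> k c p s"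
        using key[OF zero_less_one \<eta>] by meson
      show "\<exists>k\<^sub>0>0. \<forall>(c :: real \<Rightarrow> real) (p :: real \<Rightarrow> real \<Rightarrow> real).
        (\<forall>\<epsilon>\<in>{0<..<\<theta>}. travelling_wave m G \<epsilon> (c \<epsilon>) (p \<epsilon>)) \<longrightarrow>
        (\<exists>s :: real \<Rightarrow> real \<Rightarrow> real.
          (\<forall>(\<epsilon>, k) \<in> region m \<theta> \<eta> k\<^sub>0.
             s \<epsilon> k > 0 \<and>
             principal_eigenvalue m G \<epsilon> k (c \<epsilon>) (p \<epsilon>) (s \<epsilon> k) \<and>
             (\<forall>s'. eigenvalue m G \<epsilon> k (c \<epsilon>) (p \<epsilon>) s' \<longrightarrow> s \<epsilon> k \<le> s') \<and>
             (\<forall>s'. principal_eigenvalue m G \<epsilon> k (c \<epsilon>) (p \<epsilon>) s' \<longrightarrow> s' = s \<epsilon> k) \<and>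
             one_dimensional (eigenspace m G \<epsilon> k (c \<epsilon>) (p \<epsilon>) (s \<epsilon> k))) \<and>
          ((\<lambda>(\<epsilon>, k). s \<epsilon> k / (\<gamma>\<^sub>0 * k powr (1 - 1 / (m - 1)))) \<longlongrightarrow> 1)
            (inf (at_right 0 \<times>\<^sub>F at_top) (principal (region m \<theta> \<eta> k\<^sub>0))))"
        (is "\<exists>k\<^sub>0>0. \<forall>c p. ?W c p \<longrightarrow> (\<exists>s. ?spectrum k\<^sub>0 c p s \<and> ?limit k\<^sub>0 s)")
      proof (rule exI[of _ k\<^sub>0], intro conjI allI impI)
        show "k\<^sub>0 > 0" using k\<^sub>0 by simp
        fix c :: "real \<Rightarrow> real" and p :: "real \<Rightarrow> real \<Rightarrow> real"
        assume tw: "\<forall>\<epsilon>\<in>{0<..<\<theta>}. travelling_wave m G \<epsilon> (c \<epsilon>) (p \<epsilon>)"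
        \<comment> \<open>\<open>key\<close> yields an eigenvalue for each accuracy d separately;
          \<open>good_unique\<close> identifies all of them with this choice.\<close>
        define s where "s = (\<lambda>\<epsilon> k. SOME s. good \<epsilon> k (c \<epsilon>) (p \<epsilon>) s)"
        have w: "wave m \<theta> \<epsilon> (c \<epsilon>) G (p \<epsilon>)" if "(\<epsilon>, k) \<in> region m \<theta> \<eta> K" for \<epsilon> k K
          using that tw unfolding wave_iff region_def by auto
        have good_s: "good \<epsilon> k (c \<epsilon>) (p \<epsilon>) (s \<epsilon> k)" if "(\<epsilon>, k) \<in> region m \<theta> \<eta> k\<^sub>0" for \<epsilon> k
          unfolding s_def using exist[OF that w[OF that]] by (rule someI_ex)
        show "\<exists>s. ?spectrum k\<^sub>0 c p s \<and> ?limit k\<^sub>0 s"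
        proof (rule exI[of _ s], intro conjI)
          show "?spectrum k\<^sub>0 c p s"
          proof (rule ballI, rule case_prodI2)
            fix x \<epsilon> k assume x: "x \<in> region m \<theta> \<eta> k\<^sub>0" "x = (\<epsilon>, k)"
            hence R: "(\<epsilon>, k) \<in> region m \<theta> \<eta> k\<^sub>0" by simp
            from good_s[OF R] obtain v where s: "s \<epsilon> k > 0" "(c \<epsilon>)\<^sup>2 + 4 * \<epsilon> * (k\<^sup>2 * \<epsilon> powr (m / (m - 2)) - s \<epsilon> k) > 0"
              and v: "v \<in> eigenspace m G \<epsilon> k (c \<epsilon>) (p \<epsilon>) (s \<epsilon> k)" "\<And>x. v x > 0" unfolding good_def by blast
            note P = wave.principal_eigenvalue_properties[OF w[OF R] v s(2)]
            show "s \<epsilon> k > 0 \<and>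
             principal_eigenvalue m G \<epsilon> k (c \<epsilon>) (p \<epsilon>) (s \<epsilon> k) \<and>
             (\<forall>s'. eigenvalue m G \<epsilon> k (c \<epsilon>) (p \<epsilon>) s' \<longrightarrow> s \<epsilon> k \<le> s') \<and>
             (\<forall>s'. principal_eigenvalue m G \<epsilon> k (c \<epsilon>) (p \<epsilon>) s' \<longrightarrow> s' = s \<epsilon> k) \<and>
             one_dimensional (eigenspace m G \<epsilon> k (c \<epsilon>) (p \<epsilon>) (s \<epsilon> k))"
              by (intro conjI allI impI s(1) P)
          qed
          show "?limit k\<^sub>0 s"
          proof (rule tendstoI)
            fix d :: real assume d: "d > 0"
            obtain K where "K \<ge> 1" and K: "\<And>\<epsilon> k c p. (\<epsilon>, k) \<in> region m \<theta> \<eta> K \<Longrightarrow> wave m \<theta> \<epsilon> c G p \<Longrightarrow>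
                \<exists>s. good \<epsilon> k c p s \<and> \<bar>s / (\<gamma>\<^sub>0 * k powr (1 - 1 / (m - 1))) - 1\<bar> < d"
              using key[OF d \<eta>] by meson
            have "eventually (\<lambda>k. k > K) at_top" by (rule eventually_gt_at_top)
            hence "eventually (\<lambda>x. snd x > K) (at_right (0::real) \<times>\<^sub>F at_top)"
              by (rule eventually_compose_filterlim[OF _ filterlim_snd])
            thus "eventually (\<lambda>x. dist (case x of (\<epsilon>, k) \<Rightarrow> s \<epsilon> k / (\<gamma>\<^sub>0 * k powr (1 - 1 / (m - 1)))) 1 < d)
              (inf (at_right 0 \<times>\<^sub>F at_top) (principal (region m \<theta> \<eta> k\<^sub>0)))"
              unfolding eventually_inf_principal
            proof eventually_elim
              case (elim x)
              show ?case
              proof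
                assume x: "x \<in> region m \<theta> \<eta> k\<^sub>0"
                obtain \<epsilon> k where xk: "x = (\<epsilon>, k)" by (cases x)
                have R: "(\<epsilon>, k) \<in> region m \<theta> \<eta> k\<^sub>0" using x xk by simp
                hence RK: "(\<epsilon>, k) \<in> region m \<theta> \<eta> K" using elim xk unfolding region_def by simp
                obtain s' where s': "good \<epsilon> k (c \<epsilon>) (p \<epsilon>) s'" "\<bar>s' / (\<gamma>\<^sub>0 * k powr (1 - 1 / (m - 1))) - 1\<bar> < d"
                  using K[OF RK w[OF RK]] by blast
                have "s' = s \<epsilon> k" by (rule good_unique[OF w[OF R] good_s[OF R] s'(1)])
                thus "dist (case x of (\<epsilon>, k) \<Rightarrow> s \<epsilon> k / (\<gamma>\<^sub>0 * k powr (1 - 1 / (m - 1)))) 1 < d"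
                  using s'(2) xk by (simp add: dist_real_def)
              qed
            qed
          qed
        qed
      qed
    qed
  qed
qed

end
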